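(* Let $k\ge 1$, $T>0$, $\sigma_k:=\min\{2k+1,k+3\}$, and let $u$ be the exact (periodic) solution of $\partial_t u+\partial_x u=0$ on $\Omega$, with $u\in C^1([0,T];H^{\sigma_k+1}(\Omega))$. Let $\boldsymbol u_h=(u_h^C,u_h^D)$ be the semidiscrete CDG approximation of $u$ on a uniform one-dimensional overlapping mesh of size $h$, and define the corrected error $$\hat{\boldsymbol\zeta}:=\boldsymbol u_h-\boldsymbol P^*u+\sum_{l=1}^{\min\{k,2\}}\boldsymbol R^l u .$$ If $\|\hat{\boldsymbol\zeta}(\cdot,0)\|\lesssim h^{\sigma_k}$, then $$\|\hat{\boldsymbol\zeta}(\cdot,T)\|\lesssim h^{\sigma_k}.$$
   Context: Convention: $A\lesssim B$ means $A\le MB$ with a constant $M>0$ independent of the mesh size $h$. Mesh and spaces. $\Omega\subset\mathbb R$ is a bounded interval with periodic boundary conditions (all functions and Sobolev spaces are periodic). The primal mesh consists of the cells $I_i=[x_{i-1/2},x_{i+1/2}]$, all of length $h$, with centres $x_i$; the dual mesh consists of the cells $I_{i+1/2}=[x_i,x_{i+1}]$ (indices taken periodically). $V_h$ (resp. $W_h$) is the space of $L^2$ functions whose restriction to each $I_i$ (resp. each $I_{i+1/2}$) is a polynomial of degree $\le k$. $(\cdot,\cdot)_i$, $(\cdot,\cdot)_{i+1/2}$ are the $L^2$ inner products on $I_i$, $I_{i+1/2}$. For pairs $\boldsymbol w=(w_C,w_D)$, $\|\boldsymbol w\|^2=\int_\Omega(w_C^2+w_D^2)\,dx$. $V_x^0\subset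 V_h$ and $W_x^0\subset W_h$ are the subspaces of functions with zero mean on every primal, resp. dual, cell. $\tau_{\max}=C_{\rm CFL}h$ with a fixed constant $C_{\rm CFL}>0$. Superscripts $\pm$ denote right/left limits. Semidiscrete CDG method. $\boldsymbol u_h(t)\in V_h\times W_h$ satisfies, for all $i$ and all $(\phi_1,\phi_2)\in V_h\times W_h$, $(\partial_t u_h^C,\phi_1)_i=\hat B_i(\boldsymbol u_h,\phi_1)$ and $(\partial_t u_h^D,\phi_2)_{i+1/2}=\tilde B_{i+1/2}(\boldsymbol u_h,\phi_2)$, where $$\hat B_i(\boldsymbol w,\phi_1)=\tfrac1{\tau_{\max}}\int_{I_i}(w_D-w_C)\phi_1dx+\int_{I_i}w_D\partial_x\phi_1dx-w_D(x_{i+1/2})\phi_1(x_{i+1/2}^-)+w_D(x_{i-1/2})\phi_1(x_{i-1/2}^+),$$ $$\tilde B_{i+1/2}(\boldsymbol w,\phi_2)=\tfrac1{\tau_{\max}}\int_{I_{i+1/2}}(w_C-w_D)\phi_2dx+\int_{I_{i+1/2}}w_C\partial_x\phi_2dx-w_C(x_{i+1})\phi_2(x_{i+1}^-)+w_C(x_i)\phi_2(x_i^+).$$ Projection. Define $$\widehat P_i(\omega;\phi)=\tfrac1{\tau_{\max}}\Big[\int_{x_{i-1/2}}^{x_i}(\omega(x+\tfrac h2)-\omega(x))\phi\,dx+\int_{x_i}^{x_{i+1/2}}(\omega(x-\tfrac h2)-\omega(x))\phi\,dx\Big]+\int_{x_{i-1/2}}^{x_i}\omega(x+\tfrac h2)\partial_x\phi\,dx+\int_{x_i}^{x_{i+1/2}}\omega(x-\tfrac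 h2)\partial_x\phi\,dx-\omega(x_i)\big(\phi(x_{i+1/2}^-)-\phi(x_{i-1/2}^+)\big),$$ and $\widetilde P_{i+1/2}$ by the same formula with every index shifted by $1/2$ (dual cell $I_{i+1/2}$, centre $x_{i+1/2}$). For $\omega\in W^{1,\infty}(\Omega)$, $P_C^*\omega\in V_h$ is the (uniquely determined) function with $\int_{I_i}P_C^*\omega=\int_{I_i}\omega$ and $\widehat P_i(P_C^*\omega;\phi)=\widehat P_i(\omega;\phi)$ for all $\phi\in\mathbb P^k(I_i)$ and all $i$; $P_D^*\omega\in W_h$ is defined analogously on dual cells with $\widetilde P_{i+1/2}$. Set $\boldsymbol P^*\omega=(P_C^*\omega,P_D^*\omega)$. Correction functions. $\boldsymbol R^0u=(R_C^0u,R_D^0u):=(u-P_C^*u,\,u-P_D^*u)$. For $l=1,2$, $\boldsymbol R^lu=(R_C^lu,R_D^lu)\in V_x^0\times W_x^0$ is defined by requiring for all $(\phi_1,\phi_2)\in V_x^0\times W_x^0$ and all $i$ $$\widehat P_i(R_C^lu,\phi_1)=-(R_C^{l-1}\partial_xu,\phi_1)_i-\hat B_i(\boldsymbol R^{l-1}u,\phi_1)+\widehat P_i(R_C^{l-1}u,\phi_1),$$ $$\widetilde P_{i+1/2}(R_D^lu,\phi_2)=-(R_D^{l-1}\partial_xu,\phi_2)_{i+1/2}-\tilde B_{i+1/2}(\boldsymbol R^{l-1}u,\phi_2)+\widetilde P_{i+1/2}(R_D^{l-1}u,\phi_2).$$ These act on $u(\cdot,t)$ for each fixed $t$. *)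

theory Defs
  imports "HOL-Analysis.Analysis" "HOL-Computational_Algebra.Polynomial"
begin

section \<open>Periodic Sobolev spaces of integer order on $\Omega = (a, b)$\<close>

text \<open>
  Functions on the periodic interval are represented by functions on the real line of period
  $b - a$; integrals over $\Omega$ are integrals over \<open>{a..b}\<close>.
\<close>

definition periodic :: "real \<Rightarrow> (real \<Rightarrow> real) \<Rightarrow> bool" where
  "periodic L f \<longleftrightarrow> (\<forall>x. f (x + L) = f x)"

definition smooth :: "(real \<Rightarrow> real) \<Rightarrow> bool" where
  "smooth f \<longleftrightarrow> (\<forall>m x. (deriv ^^ m) f differentiable (at x))"

definition L2 :: "real \<Rightarrow> real \<Rightarrow> (real \<Rightarrow> real) set" where
  "L2 a b = {f. f \<in> borel_measurable (lebesgue_on {a..b}) \<and> (\<lambda>x. (f x)\<^sup>2) integrable_on {a..b}}"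

definition weak_deriv :: "real \<Rightarrow> real \<Rightarrow> nat \<Rightarrow> (real \<Rightarrow> real) \<Rightarrow> (real \<Rightarrow> real) \<Rightarrow> bool" where
  "weak_deriv a b m f g \<longleftrightarrow>
     (\<forall>\<phi>. smooth \<phi> \<and> periodic (b - a) \<phi> \<longrightarrow>
        integral {a..b} (\<lambda>x. f x * (deriv ^^ m) \<phi> x)
          = (- 1) ^ m * integral {a..b} (\<lambda>x. g x * \<phi> x))"

definition Hs :: "real \<Rightarrow> real \<Rightarrow> nat \<Rightarrow> (real \<Rightarrow> real) set" where
  "Hs a b s = {f. periodic (b - a) f \<and> f \<in> L2 a b \<and>
                  (\<forall>m\<le>s. \<exists>g\<in>L2 a b. weak_deriv a b m f g)}"

text \<open>The weak derivative is unique up to null sets, so the choice does not affect the norm.\<close>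

definition Hs_norm :: "real \<Rightarrow> real \<Rightarrow> nat \<Rightarrow> (real \<Rightarrow> real) \<Rightarrow> real" where
  "Hs_norm a b s f =
     sqrt (\<Sum>m\<le>s. integral {a..b} (\<lambda>x. ((SOME g. g \<in> L2 a b \<and> weak_deriv a b m f g) x)\<^sup>2))"

text \<open>
  $C^1([0,T]; H^s(\Omega))$: \<open>v\<close> is the time derivative in the $H^s$ norm, one-sided at
  $0$ and $T$.
\<close>

definition C1_Hs :: "real \<Rightarrow> real \<Rightarrow> nat \<Rightarrow> real \<Rightarrow> (real \<Rightarrow> real \<Rightarrow> real) \<Rightarrow> bool" where
  "C1_Hs a b s T u \<longleftrightarrow>
     (\<exists>v. \<forall>t\<in>{0..T}. u t \<in> Hs a b s \<and> v t \<in> Hs a b s \<and>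
        ((\<lambda>r. Hs_norm a b s (\<lambda>x. (u r x - u t x) / (r - t) - v t x)) \<longlongrightarrow> 0) (at t within {0..T}) \<and>
        ((\<lambda>r. Hs_norm a b s (\<lambda>x. v r x - v t x)) \<longlongrightarrow> 0) (at t within {0..T}))"

text \<open>
  For $s > 3/2$ a solution in $C^1([0,T]; H^s)$ has a representative that is classically
  differentiable in time and space; \<open>u\<close> is this representative, since the projections below
  use its point values.
\<close>

definition advection_solution :: "real \<Rightarrow> (real \<Rightarrow> real \<Rightarrow> real) \<Rightarrow> bool" where
  "advection_solution T u \<longleftrightarrow>
     (\<forall>t\<in>{0..T}. \<forall>x. \<exists>ut ux.
        ((\<lambda>r. u r x) has_real_derivative ut) (at t within {0..T}) \<and>
        (u t has_real_derivative ux) (at x) \<and> ut + ux = 0)"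

section \<open>Overlapping uniform mesh and piecewise polynomials\<close>

text \<open>
  Mesh points $x_r$ for $r \in \frac12\mathbb Z$, with $x_{1/2} = a$.  Primal cells are centred
  at $x_i$, dual cells at $x_{i+1/2}$, for integer $i$; all integers are allowed, and
  periodicity identifies indices modulo the number of cells.
\<close>

definition mesh_pt :: "real \<Rightarrow> real \<Rightarrow> real \<Rightarrow> real" where
  "mesh_pt a h r = a + (r - 1/2) * h"

definition primal_ctr :: "real \<Rightarrow> real \<Rightarrow> int \<Rightarrow> real" where
  "primal_ctr a h i = mesh_pt a h (of_int i)"

definition dual_ctr :: "real \<Rightarrow> real \<Rightarrow> int \<Rightarrow> real" where
  "dual_ctr a h i = mesh_pt a h (of_int i + 1/2)"

definition cell :: "real \<Rightarrow> real \<Rightarrow> real set" where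
  "cell h c = {c - h/2..c + h/2}"

text \<open>
  The space of piecewise polynomials of degree at most \<open>k\<close> on the cells of length \<open>h\<close> with
  centres \<open>ctr i\<close>.  As an $L^2$ function is determined only almost everywhere, the
  right-continuous representative is taken, so that functions equal in $L^2$ are equal.
\<close>

definition pw_poly :: "nat \<Rightarrow> real \<Rightarrow> real \<Rightarrow> (int \<Rightarrow> real) \<Rightarrow> (real \<Rightarrow> real) set" where
  "pw_poly k L h ctr = {f. periodic L f \<and>
     (\<forall>i. \<exists>p. degree p \<le> k \<and> (\<forall>x\<in>{ctr i - h/2..<ctr i + h/2}. f x = poly p x))}"

definition pw_poly0 :: "nat \<Rightarrow> real \<Rightarrow> real \<Rightarrow> (int \<Rightarrow> real) \<Rightarrow> (real \<Rightarrow> real) set" where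
  "pw_poly0 k L h ctr = {f \<in> pw_poly k L h ctr. \<forall>i. integral (cell h (ctr i)) f = 0}"

abbreviation trace_left :: "(real \<Rightarrow> real) \<Rightarrow> real \<Rightarrow> real" where
  "trace_left f x \<equiv> Lim (at_left x) f"

abbreviation trace_right :: "(real \<Rightarrow> real) \<Rightarrow> real \<Rightarrow> real" where
  "trace_right f x \<equiv> Lim (at_right x) f"

definition L2_pair_norm :: "real \<Rightarrow> real \<Rightarrow> (real \<Rightarrow> real) \<times> (real \<Rightarrow> real) \<Rightarrow> real" where
  "L2_pair_norm a b w = sqrt (integral {a..b} (\<lambda>x. (fst w x)\<^sup>2 + (snd w x)\<^sup>2))"

section \<open>Central DG method\<close>

text \<open>
  The forms $\hat B_i$ and $\tilde B_{i+1/2}$ are one expression, on the cell with centre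
  \<open>c\<close>, in the component \<open>own\<close> living on that mesh and the component \<open>oth\<close> living on the other
  mesh.  The parameter \<open>C\<close> is the CFL constant, so that $\tau_{\max}$ is \<open>C * h\<close>.
\<close>

definition cdg_form ::
  "real \<Rightarrow> real \<Rightarrow> real \<Rightarrow> (real \<Rightarrow> real) \<Rightarrow> (real \<Rightarrow> real) \<Rightarrow> (real \<Rightarrow> real) \<Rightarrow> real" where
  "cdg_form C h c own oth \<phi> =
     1 / (C * h) * integral (cell h c) (\<lambda>x. (oth x - own x) * \<phi> x)
     + integral (cell h c) (\<lambda>x. oth x * deriv \<phi> x)
     - oth (c + h/2) * trace_left \<phi> (c + h/2)
     + oth (c - h/2) * trace_right \<phi> (c - h/2)"

definition cdg_solution ::
  "nat \<Rightarrow> real \<Rightarrow> real \<Rightarrow> real \<Rightarrow> real \<Rightarrow> real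
     \<Rightarrow> (real \<Rightarrow> real \<Rightarrow> real) \<Rightarrow> (real \<Rightarrow> real \<Rightarrow> real) \<Rightarrow> bool" where
  "cdg_solution k a b C h T uC uD \<longleftrightarrow>
     (\<forall>t\<in>{0..T}.
        uC t \<in> pw_poly k (b - a) h (primal_ctr a h) \<and>
        uD t \<in> pw_poly k (b - a) h (dual_ctr a h) \<and>
        (\<exists>dC dD.
           (\<forall>x. ((\<lambda>r. uC r x) has_real_derivative dC x) (at t within {0..T})) \<and>
           (\<forall>x. ((\<lambda>r. uD r x) has_real_derivative dD x) (at t within {0..T})) \<and>
           (\<forall>i. \<forall>\<phi>1 \<in> pw_poly k (b - a) h (primal_ctr a h).
                \<forall>\<phi>2 \<in> pw_poly k (b - a) h (dual_ctr a h).
              integral (cell h (primal_ctr a h i)) (\<lambda>x. dC x * \<phi>1 x)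
                = cdg_form C h (primal_ctr a h i) (uC t) (uD t) \<phi>1 \<and>
              integral (cell h (dual_ctr a h i)) (\<lambda>x. dD x * \<phi>2 x)
                = cdg_form C h (dual_ctr a h i) (uD t) (uC t) \<phi>2)))"

section \<open>Projection\<close>

text \<open>$\hat P_i$ for \<open>c\<close> $= x_i$ and $\tilde P_{i+1/2}$ for \<open>c\<close> $= x_{i+1/2}$.\<close>

definition proj_form :: "real \<Rightarrow> real \<Rightarrow> real \<Rightarrow> (real \<Rightarrow> real) \<Rightarrow> (real \<Rightarrow> real) \<Rightarrow> real" where
  "proj_form C h c \<omega> \<phi> =
     1 / (C * h) *
       (integral {c - h/2..c} (\<lambda>x. (\<omega> (x + h/2) - \<omega> x) * \<phi> x)
        + integral {c..c + h/2} (\<lambda>x. (\<omega> (x - h/2) - \<omega> x) * \<phi> x))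
     + integral {c - h/2..c} (\<lambda>x. \<omega> (x + h/2) * deriv \<phi> x)
     + integral {c..c + h/2} (\<lambda>x. \<omega> (x - h/2) * deriv \<phi> x)
     - \<omega> c * (trace_left \<phi> (c + h/2) - trace_right \<phi> (c - h/2))"

definition cdg_proj ::
  "nat \<Rightarrow> real \<Rightarrow> real \<Rightarrow> real \<Rightarrow> (int \<Rightarrow> real) \<Rightarrow> (real \<Rightarrow> real) \<Rightarrow> real \<Rightarrow> real" where
  "cdg_proj k L C h ctr \<omega> =
     (THE p. p \<in> pw_poly k L h ctr \<and>
        (\<forall>i. integral (cell h (ctr i)) p = integral (cell h (ctr i)) \<omega> \<and>
             (\<forall>q. degree q \<le> k \<longrightarrow>
                proj_form C h (ctr i) p (poly q) = proj_form C h (ctr i) \<omega> (poly q))))"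

definition proj_C ::
  "nat \<Rightarrow> real \<Rightarrow> real \<Rightarrow> real \<Rightarrow> real \<Rightarrow> (real \<Rightarrow> real) \<Rightarrow> real \<Rightarrow> real" where
  "proj_C k a b C h \<omega> = cdg_proj k (b - a) C h (primal_ctr a h) \<omega>"

definition proj_D ::
  "nat \<Rightarrow> real \<Rightarrow> real \<Rightarrow> real \<Rightarrow> real \<Rightarrow> (real \<Rightarrow> real) \<Rightarrow> real \<Rightarrow> real" where
  "proj_D k a b C h \<omega> = cdg_proj k (b - a) C h (dual_ctr a h) \<omega>"

section \<open>Correction functions\<close>

text \<open>
  One component of the step from $l-1$ to $l$: \<open>d\<close> is the same component of
  $R^{l-1}\partial_x u$, and \<open>own\<close>, \<open>oth\<close> are this and the other component of $R^{l-1}u$.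
\<close>

definition corr_step ::
  "nat \<Rightarrow> real \<Rightarrow> real \<Rightarrow> real \<Rightarrow> (int \<Rightarrow> real)
     \<Rightarrow> (real \<Rightarrow> real) \<Rightarrow> (real \<Rightarrow> real) \<Rightarrow> (real \<Rightarrow> real) \<Rightarrow> real \<Rightarrow> real" where
  "corr_step k L C h ctr d own oth =
     (THE r. r \<in> pw_poly0 k L h ctr \<and>
        (\<forall>\<phi>\<in>pw_poly0 k L h ctr. \<forall>i.
           proj_form C h (ctr i) r \<phi> =
             - integral (cell h (ctr i)) (\<lambda>x. d x * \<phi> x)
             - cdg_form C h (ctr i) own oth \<phi>
             + proj_form C h (ctr i) own \<phi>))"

primrec corr ::
  "nat \<Rightarrow> real \<Rightarrow> real \<Rightarrow> real \<Rightarrow> real \<Rightarrow> nat \<Rightarrow> (real \<Rightarrow> real)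
     \<Rightarrow> (real \<Rightarrow> real) \<times> (real \<Rightarrow> real)" where
  "corr k a b C h 0 = (\<lambda>u.
     (\<lambda>x. u x - proj_C k a b C h u x, \<lambda>x. u x - proj_D k a b C h u x))"
| "corr k a b C h (Suc l) = (\<lambda>u.
     let (dC, dD) = corr k a b C h l (deriv u);
         (rC, rD) = corr k a b C h l u
     in (corr_step k (b - a) C h (primal_ctr a h) dC rC rD,
         corr_step k (b - a) C h (dual_ctr a h) dD rD rC))"

definition corr_error ::
  "nat \<Rightarrow> real \<Rightarrow> real \<Rightarrow> real \<Rightarrow> real
     \<Rightarrow> (real \<Rightarrow> real) \<Rightarrow> (real \<Rightarrow> real) \<Rightarrow> (real \<Rightarrow> real)
     \<Rightarrow> (real \<Rightarrow> real) \<times> (real \<Rightarrow> real)" where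
  "corr_error k a b C h u uC uD =
     (\<lambda>x. uC x - proj_C k a b C h u x + (\<Sum>l = 1..min k 2. fst (corr k a b C h l u) x),
      \<lambda>x. uD x - proj_D k a b C h u x + (\<Sum>l = 1..min k 2. snd (corr k a b C h l u) x))"

end

theory Submission
  imports Defs
begin

text \<open>
  The exact solution is $u(t, x) = u_0(x - t)$ with $u_0 \in H^{\sigma+1}$, so every estimate is
  one for $u_0$.  On a cell rescaled to $[-1/2, 1/2]$ the projection error and the corrections
  make sense for every real cell centre $c$, and they are bounded linear functionals of the
  derivatives of $u$ near $c$ which commute with translations.  Hence differentiation in $c$ amounts to
  replacing $u$ by $\partial_x u$, and the difference of a primal and a dual correction, which is a
  difference in $c$, gains one order.

  By the recursion for $R^l$ the consistency error of the corrected method telescopes.  It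
  vanishes if $u$ is a polynomial of degree at most $\sigma$: against test functions of zero mean by
  counting degrees, and against constants because $\hat P(w; x)$ is the flux of $w$ for $w$ of zero
  mean, while the projection makes $\hat P(w; x)$ and $\hat P(w; x^2)$ zero.  Taylor expansion about $c$
  then bounds the consistency error by $h^\sigma$ times the norm of $\partial_x^{\sigma+1} u_0$ on a
  few neighbouring cells.  The bilinear form of the method is dissipative, since on each overlap of
  a primal and a dual cell the boundary terms cancel and $-\tau_{\max}^{-1} \int (w_C - w_D)^2$
  remains, so that Gronwall's inequality finishes the proof.
\<close>

section \<open>Trigonometric polynomials and weak derivatives\<close>

text \<open>The obstacle is the cell average. The recursion prescribes \<open>R^l\<close> against
  tests of zero mean only, so against the constant nothing telescopes and each level is treated by
  itself. A constant test leaves a difference of fluxes of two neighbours, and fluxes that vanish in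
  degree below \<sigma> do not depend on the centre in degree \<sigma>. Level \<open>lmax\<close>
  vanishes there by its degree; for level 0, and for level 1 if k \<ge> 2, the tests x and x^2 step
  in. Zero-mean tests give the same order: \<open>Rcor l\<close> kills degree k + l, the last
  \<open>corrF\<close> gains one more, and k + min k 2 + 1 = \<sigma>. The derivative of order
  \<sigma> + 1 exists only in L^2. It enters through a monotone \<Gamma>, the integral of its
  square, with (D_\<sigma> x - D_\<sigma> y)^2 \<le> (x - y) (\<Gamma> x - \<Gamma> y). Each cell
  pays with the increment of \<Gamma> over a window of eight cells, and these increments sum to a
  fixed multiple of the growth of \<Gamma> per period, whatever h is. As all functionals live on the
  reference cell and D carries the powers of h, no constant depends on the mesh.\<close>

inductive_set trig :: "real \<Rightarrow> (real \<Rightarrow> real) set" for \<omega> where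
  trig_cos: "(\<lambda>x. cos (of_int n * (\<omega> * x))) \<in> trig \<omega>"
| trig_sin: "(\<lambda>x. sin (of_int n * (\<omega> * x))) \<in> trig \<omega>"
| trig_add: "f \<in> trig \<omega> \<Longrightarrow> g \<in> trig \<omega> \<Longrightarrow> (\<lambda>x. f x + g x) \<in> trig \<omega>"
| trig_scale: "f \<in> trig \<omega> \<Longrightarrow> (\<lambda>x. c * f x) \<in> trig \<omega>"

lemma trig_const: "(\<lambda>x. c) \<in> trig \<omega>"
  using trig_scale[OF trig_cos[of 0 \<omega>], of c] by simp

lemma trig_diff: "f \<in> trig \<omega> \<Longrightarrow> g \<in> trig \<omega> \<Longrightarrow> (\<lambda>x. f x - g x) \<in> trig \<omega>"
  using trig_add[OF _ trig_scale[of g \<omega> "-1"], of f] by simp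

lemma trig_mult:
  assumes "f \<in> trig \<omega>" "g \<in> trig \<omega>"
  shows "(\<lambda>x. f x * g x) \<in> trig \<omega>"
  using assms(1)
proof induction
  case (trig_cos n)
  show ?case using assms(2)
  proof induction
    case (trig_cos m)
    have "(\<lambda>x. 1/2 * (cos (of_int (m - n) * (\<omega> * x)) + cos (of_int (n + m) * (\<omega> * x)))) \<in> trig \<omega>"
      by (intro trig.intros)
    then show ?case by (simp add: cos_times_cos algebra_simps add_divide_distrib diff_divide_distrib)
  next
    case (trig_sin m)
    have "(\<lambda>x. 1/2 * (sin (of_int (n + m) * (\<omega> * x)) - sin (of_int (n - m) * (\<omega> * x)))) \<in> trig \<omega>"
      by (intro trig.intros trig_diff)
    then show ?case by (simp add: cos_times_sin algebra_simps add_divide_distrib diff_divide_distrib)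
  next
    case (trig_add f g)
    show ?case using trig.trig_add[OF trig_add.IH] by (simp add: algebra_simps)
  next
    case (trig_scale f c)
    show ?case using trig.trig_scale[OF trig_scale.IH, of c] by (simp add: algebra_simps)
  qed
next
  case (trig_sin n)
  show ?case using assms(2)
  proof induction
    case (trig_cos m)
    have "(\<lambda>x. 1/2 * (sin (of_int (n + m) * (\<omega> * x)) + sin (of_int (n - m) * (\<omega> * x)))) \<in> trig \<omega>"
      by (intro trig.intros)
    then show ?case unfolding sin_times_cos by (simp add: algebra_simps add_divide_distrib
        diff_divide_distrib)
  next
    case (trig_sin m)
    have "(\<lambda>x. 1/2 * (cos (of_int (m - n) * (\<omega> * x)) - cos (of_int (n + m) * (\<omega> * x)))) \<in> trig \<omega>"
      by (intro trig.intros trig_diff)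
    then show ?case by (simp add: sin_times_sin algebra_simps add_divide_distrib diff_divide_distrib)
  next
    case (trig_add f g)
    show ?case using trig.trig_add[OF trig_add.IH] by (simp add: algebra_simps)
  next
    case (trig_scale f c)
    show ?case using trig.trig_scale[OF trig_scale.IH, of c] by (simp add: algebra_simps)
  qed
next
  case (trig_add f1 f2)
  show ?case using trig.trig_add[OF trig_add.IH] by (simp add: algebra_simps)
next
  case (trig_scale f c)
  show ?case using trig.trig_scale[OF trig_scale.IH, of c] by (simp add: algebra_simps)
qed

lemma trig_polynomial:
  assumes "real_polynomial_function p"
  shows "(\<lambda>x. p (cis (\<omega> * x))) \<in> trig \<omega>"
  using assms
proof induction
  case (linear f)
  have f: "f z = Re z * f 1 + Im z * f \<i>" for z
  proof -
    have "f z = f (Re z *\<^sub>R 1 + Im z *\<^sub>R \<i>)"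
      by (metis (no_types, lifting) complex_eq mult.commute mult.right_neutral scaleR_conv_of_real)
    then show ?thesis using linear by (simp add: bounded_linear.axioms(1) linear_add linear_scale
        bounded_linear.linear)
  qed
  have 1: "(\<lambda>x. f 1 * cos (of_int 1 * (\<omega> * x)) + f \<i> * sin (of_int 1 * (\<omega> * x))) \<in> trig \<omega>"
    by (intro trig.intros)
  have 2: "(\<lambda>x. f (cis (\<omega> * x)))
      = (\<lambda>x. f 1 * cos (of_int 1 * (\<omega> * x)) + f \<i> * sin (of_int 1 * (\<omega> * x)))"
    by (rule ext, subst f) simp
  show ?case unfolding 2 by (rule 1)
qed (auto intro: trig_const trig_add trig_mult)

text \<open>Stone-Weierstrass on the unit circle. The map e wraps [a, b] around the circle so that
  both ends meet, and \<psi> factors through it as \<Psi>, since e x = e y only for equal points or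
  for the two ends. Preimages of closed sets under \<Psi> are images under e of compact sets, whence
  \<Psi> is continuous.\<close>

lemma trig_dense:
  fixes \<psi> :: "real \<Rightarrow> real"
  assumes "a < b" "continuous_on {a..b} \<psi>" "\<psi> a = \<psi> b" "\<epsilon> > 0"
  obtains f where "f \<in> trig (2 * pi / (b - a))" "\<And>x. x \<in> {a..b} \<Longrightarrow> \<bar>\<psi> x - f x\<bar> < \<epsilon>"
proof -
  define e where "e x = cis (2 * pi / (b - a) * x)" for x
  have cont: "continuous_on X e" for X
    unfolding e_def by (intro continuous_intros)
  have inj: "\<psi> x = \<psi> y" if xy: "x \<in> {a..b}" "y \<in> {a..b}" "e x = e y" for x y
  proof -
    from xy(3) have "sin (2 * pi / (b - a) * x) = sin (2 * pi / (b - a) * y)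
        \<and> cos (2 * pi / (b - a) * x) = cos (2 * pi / (b - a) * y)"
      unfolding e_def by (metis cis.sel)
    then obtain n :: int where "2 * pi / (b - a) * x = 2 * pi / (b - a) * y + 2 * pi * n"
      using sin_cos_eq_iff by blast
    then have "2 * pi * (x - y) = 2 * pi * (n * (b - a))"
      using assms(1) by (simp add: field_simps)
    then have n: "x - y = n * (b - a)" by simp
    moreover have "\<bar>x - y\<bar> \<le> b - a" using xy by auto
    ultimately have "\<bar>real_of_int n\<bar> \<le> 1" using assms(1)
      by (simp add: abs_mult)
    then have "n = 0 \<or> n = 1 \<or> n = -1" by linarith
    then show ?thesis
    proof (elim disjE)
      assume "n = 1" then have "x = b" "y = a" using n xy by auto
      then show ?thesis using assms by simp
    next
      assume "n = -1" then have "x = a" "y = b" using n xy by auto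
      then show ?thesis using assms by simp
    qed (use n in auto)
  qed
  define S where "S = e ` {a..b}"
  define \<Psi> where "\<Psi> z = \<psi> (SOME x. x \<in> {a..b} \<and> e x = z)" for z
  have \<Psi>: "\<Psi> (e x) = \<psi> x" if "x \<in> {a..b}" for x
    unfolding \<Psi>_def by (rule someI2[of _ x], use that in simp, metis inj that)
  have "compact S" unfolding S_def by (intro compact_continuous_image cont) auto
  moreover have "continuous_on S \<Psi>"
    unfolding continuous_on_closed_invariant
  proof (intro allI impI)
    fix B :: "real set" assume "closed B"
    let ?A = "e ` ({a..b} \<inter> \<psi> -` B)"
    have "closed ({a..b} \<inter> \<psi> -` B)"
      using assms(2) \<open>closed B\<close> by (simp add: continuous_closed_preimage)
    then have "compact ({a..b} \<inter> \<psi> -` B)"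
      by (metis bounded_Int bounded_closed_interval compact_eq_bounded_closed)
    then have "closed ?A" by (intro compact_imp_closed compact_continuous_image cont)
    moreover have "?A \<inter> S = \<Psi> -` B \<inter> S" 
    proof (intro set_eqI iffI)
      fix z assume "z \<in> ?A \<inter> S"
      then obtain x where "x \<in> {a..b}" "\<psi> x \<in> B" "z = e x" by auto
      then show "z \<in> \<Psi> -` B \<inter> S" using \<Psi>[of x] by (simp add: S_def)
    next
      fix z assume "z \<in> \<Psi> -` B \<inter> S"
      then obtain x where "x \<in> {a..b}" "\<Psi> z \<in> B" "z = e x" by (auto simp: S_def)
      then show "z \<in> ?A \<inter> S" using \<Psi>[of x] by (simp add: S_def)
    qed
    ultimately show "\<exists>A. closed A \<and> A \<inter> S = \<Psi> -` B \<inter> S" by blast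
  qed
  ultimately obtain p where p: "real_polynomial_function p" "\<And>z. z \<in> S \<Longrightarrow> \<bar>\<Psi> z - p z\<bar> < \<epsilon>"
    using Stone_Weierstrass_real_polynomial_function assms(4) by blast
  show ?thesis
  proof
    show "(\<lambda>x. p (e x)) \<in> trig (2 * pi / (b - a))"
      unfolding e_def by (rule trig_polynomial[OF p(1)])
    show "\<bar>\<psi> x - p (e x)\<bar> < \<epsilon>" if "x \<in> {a..b}" for x
      using p(2)[of "e x"] \<Psi>[OF that] that S_def by auto
  qed
qed

lemma trig_continuous: "f \<in> trig \<omega> \<Longrightarrow> continuous_on X f"
  by (induction rule: trig.induct) (auto intro!: continuous_intros)

lemma abs_integrable_mult_continuous:
  fixes w f :: "real \<Rightarrow> real"
  assumes "w absolutely_integrable_on {a..b}" "continuous_on {a..b} f"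
  shows "(\<lambda>x. w x * f x) absolutely_integrable_on {a..b}"
proof -
  have "(\<lambda>x. f x * w x) absolutely_integrable_on {a..b}"
  proof (rule absolutely_integrable_bounded_measurable_product_real)
    show "f \<in> borel_measurable (lebesgue_on {a..b})"
      by (rule continuous_imp_measurable_on_sets_lebesgue) (use assms in auto)
    show "bounded (f ` {a..b})"
      by (rule compact_imp_bounded, rule compact_continuous_image) (use assms in auto)
  qed (use assms in auto)
  then show ?thesis by (simp add: mult.commute)
qed

lemma abs_integral_le:
  fixes f g :: "real \<Rightarrow> real"
  assumes "f integrable_on S" "g integrable_on S" "\<And>x. x \<in> S \<Longrightarrow> \<bar>f x\<bar> \<le> g x"
  shows "\<bar>integral S f\<bar> \<le> integral S g"
  using integral_norm_bound_integral[of f S g] assms by auto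

lemma orth_trig_imp_orth_continuous:
  fixes w \<psi> :: "real \<Rightarrow> real"
  assumes "a < b" and w: "w absolutely_integrable_on {a..b}"
    and orth: "\<And>f. f \<in> trig (2 * pi / (b - a)) \<Longrightarrow> integral {a..b} (\<lambda>x. w x * f x) = 0"
    and \<psi>: "continuous_on {a..b} \<psi>" "\<psi> a = \<psi> b"
  shows "integral {a..b} (\<lambda>x. w x * \<psi> x) = 0"
proof (rule ccontr)
  define I where "I = \<bar>integral {a..b} (\<lambda>x. w x * \<psi> x)\<bar>"
  define J where "J = integral {a..b} (\<lambda>x. \<bar>w x\<bar>)"
  assume "integral {a..b} (\<lambda>x. w x * \<psi> x) \<noteq> 0"
  then have "I > 0" by (simp add: I_def)
  have wi: "(\<lambda>x. \<bar>w x\<bar>) integrable_on {a..b}"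
    using w unfolding absolutely_integrable_on_def by auto
  have "J \<ge> 0" unfolding J_def by (rule integral_nonneg[OF wi]) auto
  \<comment> \<open>The tolerance makes the total error at most I * J / (J + 1), which is less than
    I; the summand 1 covers J = 0.\<close>
  obtain f where f: "f \<in> trig (2 * pi / (b - a))" "\<And>x. x \<in> {a..b} \<Longrightarrow> \<bar>\<psi> x - f x\<bar> < I / (J + 1)"
    using trig_dense[OF assms(1) \<psi>, of "I / (J + 1)"] \<open>I > 0\<close> \<open>J \<ge> 0\<close> by auto
  have i1: "(\<lambda>x. w x * \<psi> x) integrable_on {a..b}" "(\<lambda>x. w x * f x) integrable_on {a..b}"
    using abs_integrable_mult_continuous[OF w] \<psi>(1) trig_continuous[OF f(1)]
      set_lebesgue_integral_eq_integral(1) by blast+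
  have "integral {a..b} (\<lambda>x. w x * \<psi> x) = integral {a..b} (\<lambda>x. w x * \<psi> x - w x * f x)"
    using i1 orth[OF f(1)] by (simp add: integral_diff)
  then have "I \<le> integral {a..b} (\<lambda>x. I / (J + 1) * \<bar>w x\<bar>)"
    unfolding I_def
  proof (simp only:, intro abs_integral_le)
    fix x assume "x \<in> {a..b}"
    have "\<bar>w x * \<psi> x - w x * f x\<bar> = \<bar>\<psi> x - f x\<bar> * \<bar>w x\<bar>"
      by (simp add: abs_mult[symmetric] algebra_simps)
    also have "\<dots> \<le> I / (J + 1) * \<bar>w x\<bar>"
      using f(2)[OF \<open>x \<in> {a..b}\<close>] by (intro mult_right_mono) auto
    finally show "\<bar>w x * \<psi> x - w x * f x\<bar>
       \<le> \<bar>integral {a..b} (\<lambda>x. w x * \<psi> x - w x * f x)\<bar> / (J + 1) * \<bar>w x\<bar>"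
      using \<open>integral {a..b} (\<lambda>x. w x * \<psi> x) = _\<close> by (simp add: I_def)
    next
    show "(\<lambda>x. w x * \<psi> x - w x * f x) integrable_on {a..b}" by (rule integrable_diff[OF i1])
  next
    show "(\<lambda>x. \<bar>integral {a..b} (\<lambda>x. w x * \<psi> x - w x * f x)\<bar> / (J + 1) * \<bar>w x\<bar>) integrable_on {a..b}"
      by (rule integrable_on_mult_right[OF wi])
  qed
  also have "\<dots> = I / (J + 1) * J" unfolding J_def by simp
  also have "\<dots> < I" using \<open>I > 0\<close> \<open>J \<ge> 0\<close> by (simp add: field_simps)
  finally show False by simp
qed

text \<open>The test that detects w is sgn w. It is a limit of continuous functions outside a null
  set, and dominated convergence passes from their vanishing integrals to the integral of
  |w|.\<close>

lemma orth_trig_imp_zero: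
  fixes w :: "real \<Rightarrow> real"
  assumes "a < b" and w: "w absolutely_integrable_on {a..b}"
    and orth: "\<And>f. f \<in> trig (2 * pi / (b - a)) \<Longrightarrow> integral {a..b} (\<lambda>x. w x * f x) = 0"
  shows "negligible {x \<in> {a..b}. w x \<noteq> 0}"
proof -
  have wi: "(\<lambda>x. \<bar>w x\<bar>) integrable_on {a..b}" "w integrable_on {a..b}"
    using w unfolding absolutely_integrable_on_def by auto
  have wm: "w \<in> borel_measurable (lebesgue_on {a..b})"
    using w by (simp add: absolutely_integrable_measurable_real)
  have "(\<lambda>x. sgn (w x)) \<in> borel_measurable (lebesgue_on {a..b})"
    using wm by measurable
  then have "(\<lambda>x. sgn (w x)) measurable_on {a..b}"
    by (simp add: measurable_on_iff_borel_measurable)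
  then obtain N g where N: "negligible N" and g: "\<And>n. continuous_on UNIV (g n)"
    and lim: "\<And>x. x \<notin> N \<Longrightarrow> (\<lambda>n. g n x) \<longlonglongrightarrow> (if x \<in> {a..b} then sgn (w x) else 0)"
    unfolding measurable_on_def by blast
  \<comment> \<open>\<tau> forces the value 0 at both ends, so that \<psi> has equal end values, and
    it tends to 1 inside. The clamp to [-1, 1] in \<psi> provides the majorant |w|.\<close>
  define \<tau> where "\<tau> n x = min 1 (real n * ((x - a) * (b - x)))" for n x
  define \<psi> where "\<psi> n x = max (-1) (min 1 (g n x)) * \<tau> n x" for n x
  have \<psi>c: "continuous_on {a..b} (\<psi> n)" for n
    unfolding \<psi>_def \<tau>_def by (intro continuous_intros continuous_on_subset[OF g]) auto
  have \<psi>0: "integral {a..b} (\<lambda>x. w x * \<psi> n x) = 0" for n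
    by (rule orth_trig_imp_orth_continuous[OF assms(1) w orth \<psi>c]) (auto simp: \<psi>_def \<tau>_def)
  let ?N = "N \<union> {a, b}"
  have conv: "(\<lambda>n. w x * \<psi> n x) \<longlonglongrightarrow> \<bar>w x\<bar>" if x: "x \<in> {a..b} - ?N" for x
  proof -
    have "(x - a) * (b - x) > 0" using x by (auto intro!: mult_pos_pos simp: less_le)
    then obtain n0 where n0: "1 < real n0 * ((x - a) * (b - x))"
      using reals_Archimedean3 by blast
    have "\<tau> n x = 1" if "n \<ge> n0" for n
    proof -
      have "real n0 * ((x - a) * (b - x)) \<le> real n * ((x - a) * (b - x))"
        using that \<open>(x - a) * (b - x) > 0\<close> by (intro mult_right_mono) auto
      then show ?thesis using n0 unfolding \<tau>_def by linarith
    qed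
    then have "\<forall>\<^sub>F n in sequentially. \<tau> n x = 1"
      unfolding eventually_sequentially by blast
    then have 1: "(\<lambda>n. \<tau> n x) \<longlonglongrightarrow> 1" by (rule tendsto_eventually)
    have "(\<lambda>n. g n x) \<longlonglongrightarrow> sgn (w x)" using lim[of x] x by auto
    then have "(\<lambda>n. max (-1) (min 1 (g n x))) \<longlonglongrightarrow> max (-1) (min 1 (sgn (w x)))"
      by (intro tendsto_intros)
    moreover have "max (-1) (min 1 (sgn (w x))) = sgn (w x)" by (simp add: sgn_if)
    ultimately have "(\<lambda>n. w x * \<psi> n x) \<longlonglongrightarrow> w x * (sgn (w x) * 1)"
      unfolding \<psi>_def using 1 by (intro tendsto_intros) auto
    moreover have "w x * (sgn (w x) * 1) = \<bar>w x\<bar>" by (simp add: sgn_if)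
    ultimately show ?thesis by simp
  qed
  \<comment> \<open>Setting both sides to 0 on the null set and at the two ends turns convergence
    almost everywhere into convergence at every point.\<close>
  define F where "F n x = (if x \<in> ?N then 0 else w x * \<psi> n x)" for n x
  define G where "G x = (if x \<in> ?N then 0 else \<bar>w x\<bar>)" for x
  have negl: "negligible ?N" using N by simp
  have Fi: "F n integrable_on {a..b}" for n
    by (rule integrable_spike[OF set_lebesgue_integral_eq_integral(1)[OF
        abs_integrable_mult_continuous[OF w \<psi>c[of n]]] negl])
      (auto simp: F_def)
  have F0: "integral {a..b} (F n) = 0" for n
    using integral_spike[OF negl, of "{a..b}" "F n" "\<lambda>x. w x * \<psi> n x"] \<psi>0 by (simp add: F_def)
  have "(\<lambda>n. integral {a..b} (F n)) \<longlonglongrightarrow> integral {a..b} G"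
  proof (rule dominated_convergence(2)[OF Fi wi(1)])
    fix n x assume "x \<in> {a..b}"
    then have "0 \<le> (x - a) * (b - x)" by auto
    then have "0 \<le> real n * ((x - a) * (b - x))" by simp
    then have "\<bar>\<tau> n x\<bar> \<le> 1" unfolding \<tau>_def by linarith
    moreover have "\<bar>max (-1) (min 1 (g n x))\<bar> \<le> 1" by auto
    ultimately have "\<bar>\<psi> n x\<bar> \<le> 1" unfolding \<psi>_def abs_mult by (simp add: mult_le_one)
    then show "norm (F n x) \<le> \<bar>w x\<bar>" by (simp add: F_def abs_mult mult_left_le)
  next
    fix x assume "x \<in> {a..b}"
    then show "(\<lambda>n. F n x) \<longlonglongrightarrow> G x" using conv[of x] by (auto simp: F_def G_def)
  qed
  then have "integral {a..b} G = 0" using F0 by (simp add: LIMSEQ_const_iff)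
  moreover have "integral {a..b} G = integral {a..b} (\<lambda>x. \<bar>w x\<bar>)"
    by (rule integral_spike[OF negl]) (auto simp: G_def)
  ultimately have z: "integral {a..b} (\<lambda>x. \<bar>w x\<bar>) = 0" by simp
  have "integrable (lebesgue_on {a..b}) (\<lambda>x. \<bar>w x\<bar>)"
    using w by (simp add: absolutely_integrable_measurable_real)
  moreover from this have "integral\<^sup>L (lebesgue_on {a..b}) (\<lambda>x. \<bar>w x\<bar>) = 0"
    using z lebesgue_integral_eq_integral by fastforce
  ultimately have "AE x in lebesgue_on {a..b}. \<bar>w x\<bar> = 0"
    using integral_nonneg_eq_0_iff_AE[of "lebesgue_on {a..b}" "\<lambda>x. \<bar>w x\<bar>"] by simp
  then have "AE x in lebesgue. x \<in> {a..b} \<longrightarrow> w x = 0"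
    by (simp add: AE_restrict_space_iff)
  then obtain N' where N': "negligible N'" "{x. \<not> (x \<in> {a..b} \<longrightarrow> w x = 0)} \<subseteq> N'"
    unfolding eventually_ae_filter_negligible by blast
  show ?thesis by (rule negligible_subset[OF N'(1)]) (use N'(2) in auto)
qed

text \<open>The increments are o(|y - x|) because \<Gamma> is continuous, so H has derivative 0.
  This proves integral identities for merely integrable functions without differentiating their
  primitives.\<close>

lemma eq_endpoints_of_increment_bound:
  fixes H \<Gamma> :: "real \<Rightarrow> real"
  assumes "a \<le> b" and H: "\<And>x y. a \<le> x \<Longrightarrow> x \<le> y \<Longrightarrow> y \<le> b \<Longrightarrow> \<bar>H y - H x\<bar> \<le> K * (y - x) * (\<Gamma> y - \<Gamma> x)"
    and \<Gamma>: "continuous_on {a..b} \<Gamma>"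
  shows "H b = H a"
proof -
  have "(H has_field_derivative 0) (at x within {a..b})" if x: "x \<in> {a..b}" for x
    unfolding has_field_derivative_iff
  proof (rule Lim_null_comparison)
    have "\<bar>(H y - H x) / (y - x)\<bar> \<le> \<bar>K\<bar> * \<bar>\<Gamma> y - \<Gamma> x\<bar>" if y: "y \<in> {a..b}" "y \<noteq> x" for y
    proof -
      have "\<bar>H y - H x\<bar> \<le> \<bar>K * (y - x) * (\<Gamma> y - \<Gamma> x)\<bar>"
      proof (cases "x \<le> y")
        case True
        then show ?thesis using H[of x y] x y by auto
      next
        case False
        then have "\<bar>H x - H y\<bar> \<le> K * (x - y) * (\<Gamma> x - \<Gamma> y)" using H[of y x] x y by auto
        also have "\<dots> = K * (y - x) * (\<Gamma> y - \<Gamma> x)" by (simp add: algebra_simps)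
        finally show ?thesis by (simp add: abs_minus_commute)
      qed
      then show ?thesis using y by (simp add: abs_mult divide_simps mult_ac)
    qed
    then show "\<forall>\<^sub>F y in at x within {a..b}. norm ((H y - H x) / (y - x)) \<le> \<bar>K\<bar> * \<bar>\<Gamma> y - \<Gamma> x\<bar>"
      by (auto simp: eventually_at intro!: exI[of _ 1])
    have "(\<Gamma> \<longlongrightarrow> \<Gamma> x) (at x within {a..b})" using \<Gamma> x by (auto simp: continuous_on_def)
    then have "((\<lambda>y. \<bar>K\<bar> * \<bar>\<Gamma> y - \<Gamma> x\<bar>) \<longlongrightarrow> \<bar>K\<bar> * \<bar>\<Gamma> x - \<Gamma> x\<bar>) (at x within {a..b})"
      by (intro tendsto_intros)
    then show "((\<lambda>y. \<bar>K\<bar> * \<bar>\<Gamma> y - \<Gamma> x\<bar>) \<longlongrightarrow> 0) (at x within {a..b})" by simp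
  qed
  then obtain c where "\<And>x. x \<in> {a..b} \<Longrightarrow> H x = c"
    using has_field_derivative_zero_constant[of "{a..b}" H] by auto
  then show ?thesis using assms(1) by auto
qed

lemma integrable_on_sub:
  fixes f :: "real \<Rightarrow> real"
  shows "f integrable_on {a..b} \<Longrightarrow> a \<le> x \<Longrightarrow> y \<le> b \<Longrightarrow> f integrable_on {x..y}"
  by (rule integrable_on_subinterval) auto

text \<open>The primitive F of g need not be differentiable at every point. Instead H, the defect of
  the formula on [a, x], is shown to be constant: its increment over [x, y] is a difference of two
  integrals, each bounded by M (y - x), which stems from \<phi>, times the integral of |g| over
  [x, y].\<close>

lemma integral_indefinite_by_parts:
  fixes g \<phi> \<phi>' :: "real \<Rightarrow> real"
  assumes "a \<le> b" and g: "g absolutely_integrable_on {a..b}"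
    and \<phi>: "\<And>x. (\<phi> has_real_derivative \<phi>' x) (at x)" and \<phi>': "continuous_on {a..b} \<phi>'"
  shows "integral {a..b} (\<lambda>x. integral {a..x} g * \<phi>' x)
      = integral {a..b} g * \<phi> b - integral {a..b} (\<lambda>x. g x * \<phi> x)"
proof -
  define F where "F x = integral {a..x} g" for x
  define \<Gamma> where "\<Gamma> x = integral {a..x} (\<lambda>x. \<bar>g x\<bar>)" for x
  have gi: "g integrable_on {a..b}" "(\<lambda>x. \<bar>g x\<bar>) integrable_on {a..b}"
    using g unfolding absolutely_integrable_on_def by auto
  have F: "continuous_on {a..b} F" and \<Gamma>: "continuous_on {a..b} \<Gamma>"
    unfolding F_def \<Gamma>_def using gi by (auto intro: indefinite_integral_continuous_1)
  have \<phi>c: "continuous_on X \<phi>" for X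
    by (rule DERIV_continuous_on) (use \<phi> in \<open>auto intro: has_field_derivative_at_within\<close>)
  obtain M where M: "M \<ge> 0" "\<And>x. x \<in> {a..b} \<Longrightarrow> \<bar>\<phi>' x\<bar> \<le> M"
  proof -
    have "bounded (\<phi>' ` {a..b})"
      by (rule compact_imp_bounded, rule compact_continuous_image) (use \<phi>' in auto)
    then obtain M where "M > 0" "\<forall>y\<in>\<phi>' ` {a..b}. norm y \<le> M" unfolding bounded_pos by blast
    then show ?thesis using that[of M] by auto
  qed
  have g\<phi>: "(\<lambda>x. g x * \<phi> x) integrable_on {a..b}"
    using abs_integrable_mult_continuous[OF g \<phi>c] set_lebesgue_integral_eq_integral(1) by blast
  have F\<phi>': "(\<lambda>x. F x * \<phi>' x) integrable_on {a..b}"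
    by (intro integrable_continuous_interval continuous_intros F \<phi>')
  define H where "H x = F x * \<phi> x - integral {a..x} (\<lambda>x. F x * \<phi>' x) - integral {a..x}
      (\<lambda>x. g x * \<phi> x)" for x
  have split: "integral {a..y} f = integral {a..x} f + integral {x..y} f"
    if "f integrable_on {a..b}" "a \<le> x" "x \<le> y" "y \<le> b" for f :: "real \<Rightarrow> real" and x y
    using Henstock_Kurzweil_Integration.integral_combine[of a x y f] integrable_on_sub[OF that(1),
        of a y] that by auto
  have "H b = H a"
  proof (rule eq_endpoints_of_increment_bound[OF assms(1) _ \<Gamma>, of _ "2 * M"])
    fix x y assume xy: "a \<le> x" "x \<le> y" "y \<le> b"
    note sub = integrable_on_sub[OF _ xy(1) xy(3)]
    have gpart: "integral {x..y} (\<lambda>s. g s * (\<phi> y - \<phi> s)) = integral {x..y} g * \<phi> y - integral {x..y}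
        (\<lambda>s. g s * \<phi> s)"
      using sub[OF gi(1)] sub[OF g\<phi>] by (simp add: right_diff_distrib integral_diff
          integrable_on_mult_left)
    have ftc: "(\<phi>' has_integral (\<phi> y - \<phi> x)) {x..y}"
      by (rule fundamental_theorem_of_calculus[OF xy(2)])
        (use \<phi> in \<open>auto simp: has_real_derivative_iff_has_vector_derivative[symmetric] intro:
            has_field_derivative_at_within\<close>)
    have "((\<lambda>s. F x * \<phi>' s) has_integral F x * (\<phi> y - \<phi> x)) {x..y}"
      by (rule has_integral_mult_right[OF ftc])
    from has_integral_diff[OF integrable_integral[OF sub[OF F\<phi>']] this]
    have Fpart: "((\<lambda>s. (F s - F x) * \<phi>' s) has_integral
        integral {x..y} (\<lambda>s. F s * \<phi>' s) - F x * (\<phi> y - \<phi> x)) {x..y}"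
      by (simp add: algebra_simps)
    have "H y - H x = integral {x..y} (\<lambda>s. g s * (\<phi> y - \<phi> s)) - integral {x..y} (\<lambda>s. (F s - F x) * \<phi>' s)"
      unfolding gpart integral_unique[OF Fpart] H_def split[OF F\<phi>' xy] split[OF g\<phi> xy]
      using split[OF gi(1) xy] by (simp add: F_def algebra_simps)
    moreover have "\<bar>integral {x..y} (\<lambda>s. g s * (\<phi> y - \<phi> s))\<bar> \<le> M * (y - x) * (\<Gamma> y - \<Gamma> x)"
    proof -
      have "\<bar>integral {x..y} (\<lambda>s. g s * (\<phi> y - \<phi> s))\<bar> \<le> integral {x..y} (\<lambda>s. M * (y - x) * \<bar>g s\<bar>)"
      proof (rule abs_integral_le)
        show "(\<lambda>s. g s * (\<phi> y - \<phi> s)) integrable_on {x..y}"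
          using sub[OF gi(1)] sub[OF g\<phi>] by (simp add: right_diff_distrib integrable_diff
              integrable_on_mult_left)
        show "(\<lambda>s. M * (y - x) * \<bar>g s\<bar>) integrable_on {x..y}"
          by (rule integrable_on_mult_right[OF sub[OF gi(2)]])
        fix s assume s: "s \<in> {x..y}"
        have "\<bar>\<phi> y - \<phi> s\<bar> \<le> M * (y - s)"
        proof -
          have "norm (\<phi> y - \<phi> s) \<le> M * norm (y - s)"
            by (rule field_differentiable_bound[of "{s..y}" \<phi> \<phi>'])
              (use \<phi> M(2) s xy in \<open>auto intro: has_field_derivative_at_within\<close>)
          then show ?thesis using s by simp
        qed
        also have "\<dots> \<le> M * (y - x)" using s M by (intro mult_left_mono) auto
        finally show "\<bar>g s * (\<phi> y - \<phi> s)\<bar> \<le> M * (y - x) * \<bar>g s\<bar>"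
          by (simp add: abs_mult mult.commute mult_left_mono)
      qed
      also have "\<dots> = M * (y - x) * (\<Gamma> y - \<Gamma> x)"
        using split[OF gi(2) xy] by (simp add: \<Gamma>_def)
      finally show ?thesis .
    qed
    moreover have "\<bar>integral {x..y} (\<lambda>s. (F s - F x) * \<phi>' s)\<bar> \<le> M * (y - x) * (\<Gamma> y - \<Gamma> x)"
    proof -
      have "\<bar>integral {x..y} (\<lambda>s. (F s - F x) * \<phi>' s)\<bar> \<le> integral {x..y} (\<lambda>s. (\<Gamma> y - \<Gamma> x) * M)"
      proof (rule abs_integral_le)
        show "(\<lambda>s. (F s - F x) * \<phi>' s) integrable_on {x..y}" using Fpart by blast
        fix s assume s: "s \<in> {x..y}"
        have "\<bar>F s - F x\<bar> = \<bar>integral {x..s} g\<bar>"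
          using split[OF gi(1), of x s] s xy by (simp add: F_def)
        also have "\<dots> \<le> integral {x..s} (\<lambda>x. \<bar>g x\<bar>)"
          by (rule abs_integral_le) (use integrable_on_sub[OF gi(1), of x s] integrable_on_sub[OF
              gi(2), of x s] s xy in auto)
        also have "\<dots> = \<Gamma> s - \<Gamma> x"
          using split[OF gi(2), of x s] s xy by (simp add: \<Gamma>_def)
        also have "\<dots> \<le> \<Gamma> y - \<Gamma> x"
        proof -
          have "0 \<le> integral {s..y} (\<lambda>x. \<bar>g x\<bar>)"
            by (rule integral_nonneg) (use integrable_on_sub[OF gi(2), of s y] s xy in auto)
          then show ?thesis using split[OF gi(2), of s y] s xy by (simp add: \<Gamma>_def)
        qed
        finally show "\<bar>(F s - F x) * \<phi>' s\<bar> \<le> (\<Gamma> y - \<Gamma> x) * M"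
          unfolding abs_mult using M(2)[of s] s xy M(1) by (intro mult_mono) auto
      qed auto
      then show ?thesis using xy by (simp add: mult_ac)
    qed
    ultimately show "\<bar>H y - H x\<bar> \<le> 2 * M * (y - x) * (\<Gamma> y - \<Gamma> x)" by linarith
  qed
  then show ?thesis by (simp add: H_def F_def)
qed

lemma deriv_iter_trig: "\<exists>A' B'. (deriv ^^ m) (\<lambda>x. A * cos (c * x) + B * sin (c * x))
    = (\<lambda>x. A' * cos (c * x) + B' * sin (c * x :: real))"
proof (induction m)
  case (Suc m)
  then obtain A' B' where *: "(deriv ^^ m) (\<lambda>x. A * cos (c * x) + B * sin (c * x))
    = (\<lambda>x. A' * cos (c * x) + B' * sin (c * x))" by blast
  have "deriv (\<lambda>x. A' * cos (c * x) + B' * sin (c * x)) = (\<lambda>x. (B' * c) * cos (c * x) +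
      (- A' * c) * sin (c * x))"
    by (rule ext, rule DERIV_imp_deriv) (auto intro!: derivative_eq_intros)
  then show ?case unfolding funpow.simps o_def * by blast
qed auto

lemma smooth_trig: "smooth (\<lambda>x. A * cos (c * x) + B * sin (c * x))"
  unfolding smooth_def
proof (intro allI)
  fix m x
  obtain A' B' where "(deriv ^^ m) (\<lambda>x. A * cos (c * x) + B * sin (c * x))
    = (\<lambda>x. A' * cos (c * x) + B' * sin (c * x))" using deriv_iter_trig by blast
  moreover have "((\<lambda>x. A' * cos (c * x) + B' * sin (c * x)) has_real_derivative
      (B' * c * cos (c * x) - A' * c * sin (c * x))) (at x)"
    by (auto intro!: derivative_eq_intros)
  ultimately show "(deriv ^^ m) (\<lambda>x. A * cos (c * x) + B * sin (c * x)) differentiable at x"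
    using real_differentiable_def by metis
qed

lemma periodic_trig:
  assumes "a < b"
  shows "periodic (b - a) (\<lambda>x. A * cos (of_int n * (2 * pi / (b - a)) * x) + B * sin (of_int n *
      (2 * pi / (b - a)) * x))"
proof -
  have "of_int n * (2 * pi / (b - a)) * (x + (b - a)) = of_int n * (2 * pi / (b - a)) * x
      + 2 * pi * of_int n" for x
    using assms by (simp add: field_simps)
  then have "sin (of_int n * (2 * pi / (b - a)) * (x + (b - a))) = sin (of_int n * (2 * pi /
      (b - a)) * x)
    \<and> cos (of_int n * (2 * pi / (b - a)) * (x + (b - a))) = cos (of_int n * (2 * pi / (b - a)) * x)"
        for x
    by (subst sin_cos_eq_iff) blast
  then show ?thesis unfolding periodic_def by simp
qed

text \<open>Both weak derivatives are tied to f, not to each other. Testing order m with \<phi>' and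
  order m + 1 with \<phi> gives the same integral of f, so g' acts as the weak derivative of g on
  trigonometric tests.\<close>

lemma weak_deriv_trig_step:
  assumes "a < b" "weak_deriv a b m f g" "weak_deriv a b (Suc m) f g'"
    and c: "c = of_int n * (2 * pi / (b - a))"
  shows "integral {a..b} (\<lambda>x. g x * (B * c * cos (c * x) - A * c * sin (c * x)))
       = - integral {a..b} (\<lambda>x. g' x * (A * cos (c * x) + B * sin (c * x)))"
proof -
  let ?\<phi> = "\<lambda>x. A * cos (c * x) + B * sin (c * x)"
  let ?\<phi>' = "\<lambda>x. (B * c) * cos (c * x) + (- A * c) * sin (c * x)"
  have d: "deriv ?\<phi> = ?\<phi>'"
    by (rule ext, rule DERIV_imp_deriv) (auto intro!: derivative_eq_intros)
  have "integral {a..b} (\<lambda>x. f x * (deriv ^^ m) ?\<phi>' x) = (- 1) ^ m * integral {a..b} (\<lambda>x. g x * ?\<phi>' x)"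
    using assms(2) smooth_trig periodic_trig[OF assms(1)] unfolding weak_deriv_def c by blast
  moreover have "integral {a..b} (\<lambda>x. f x * (deriv ^^ Suc m) ?\<phi> x) = (- 1) ^ Suc m * integral {a..b}
      (\<lambda>x. g' x * ?\<phi> x)"
    using assms(3) smooth_trig periodic_trig[OF assms(1)] unfolding weak_deriv_def c by blast
  moreover have "(deriv ^^ Suc m) ?\<phi> = (deriv ^^ m) ?\<phi>'"
    unfolding funpow_Suc_right o_def d ..
  ultimately have "(- 1) ^ m * integral {a..b} (\<lambda>x. g x * ?\<phi>' x) = (- 1) ^ m * (- integral {a..b}
      (\<lambda>x. g' x * ?\<phi> x))"
    by simp
  moreover have "(- 1 :: real) ^ m \<noteq> 0" by simp
  ultimately have "integral {a..b} (\<lambda>x. g x * ?\<phi>' x) = - integral {a..b} (\<lambda>x. g' x * ?\<phi> x)"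
    by (simp only: mult_cancel_left simp_thms)
  then show ?thesis by simp
qed

lemma orth_trig_induct:
  fixes w :: "real \<Rightarrow> real"
  assumes "a < b" and w: "w absolutely_integrable_on {a..b}"
    and c: "\<And>n. integral {a..b} (\<lambda>x. w x * cos (of_int n * (2 * pi / (b - a)) * x)) = 0"
    and s: "\<And>n. integral {a..b} (\<lambda>x. w x * sin (of_int n * (2 * pi / (b - a)) * x)) = 0"
  shows "negligible {x \<in> {a..b}. w x \<noteq> 0}"
proof (rule orth_trig_imp_zero[OF assms(1) w])
  fix f assume "f \<in> trig (2 * pi / (b - a))"
  then show "integral {a..b} (\<lambda>x. w x * f x) = 0"
  proof induction
    case (trig_cos n) then show ?case using c[of n] by (simp add: mult.assoc)
  next
    case (trig_sin n) then show ?case using s[of n] by (simp add: mult.assoc)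
  next
    case (trig_add f g)
    have "(\<lambda>x. w x * f x) integrable_on {a..b}" "(\<lambda>x. w x * g x) integrable_on {a..b}"
      using abs_integrable_mult_continuous[OF w trig_continuous] trig_add.hyps
        set_lebesgue_integral_eq_integral(1) by blast+
    then show ?case using trig_add.IH by (simp add: distrib_left integral_add)
  next
    case (trig_scale f c)
    have "(\<lambda>x. w x * (c * f x)) = (\<lambda>x. c * (w x * f x))" by auto
    then show ?case using trig_scale.IH by simp
  qed
qed

text \<open>The argument of du Bois-Reymond: g minus the primitive of g' is orthogonal to the
  derivative of every trigonometric function, hence to all nonzero frequencies. The constant c
  removes frequency 0.\<close>

lemma weak_deriv_step:
  assumes "a < b" and g: "g absolutely_integrable_on {a..b}" and g': "g' absolutely_integrable_on {a..b}"
    and wd: "weak_deriv a b m f g" "weak_deriv a b (Suc m) f g'"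
  shows "integral {a..b} g' = 0" "\<exists>c. negligible {x \<in> {a..b}. g x \<noteq> c + integral {a..x} g'}"
proof -
  \<comment> \<open>Frequency 0 with A = 1 tests with the constant 1, whose derivative
    vanishes.\<close>
  show z: "integral {a..b} g' = 0"
    using weak_deriv_trig_step[OF assms(1) wd refl, of 0 0 1] by simp
  define F where "F x = integral {a..x} g'" for x
  have gi: "g' integrable_on {a..b}" "g integrable_on {a..b}"
    using g g' unfolding absolutely_integrable_on_def by auto
  have Fc: "continuous_on {a..b} F" unfolding F_def by (rule indefinite_integral_continuous_1[OF gi(1)])
  have Fa: "F absolutely_integrable_on {a..b}" by (rule absolutely_integrable_continuous_real[OF Fc])
  define c where "c = integral {a..b} (\<lambda>x. g x - F x) / (b - a)"
  define w where "w x = g x - (F x + c)" for x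
  have w: "w absolutely_integrable_on {a..b}" unfolding w_def
    by (intro set_integral_diff(1)[OF g] absolutely_integrable_continuous_real continuous_intros Fc)
  have w0: "integral {a..b} w = 0"
  proof -
    have "integral {a..b} (\<lambda>x. (g x - F x) - c) = integral {a..b} (\<lambda>x. g x - F x) - integral {a..b}
        (\<lambda>x. c)"
      by (rule integral_diff) (use gi Fc integrable_continuous_interval in \<open>auto intro!:
          integrable_diff\<close>)
    also have "\<dots> = 0" using assms(1) by (simp add: c_def)
    finally show ?thesis by (simp add: w_def[abs_def] algebra_simps)
  qed
  have key: "integral {a..b} (\<lambda>x. w x * (B * \<kappa> * cos (\<kappa> * x) - A * \<kappa> * sin (\<kappa> * x))) = 0"
    if \<kappa>: "\<kappa> = of_int n * (2 * pi / (b - a))" for \<kappa> n A B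
  proof -
    let ?\<phi> = "\<lambda>x. A * cos (\<kappa> * x) + B * sin (\<kappa> * x)"
    let ?\<phi>' = "\<lambda>x. B * \<kappa> * cos (\<kappa> * x) - A * \<kappa> * sin (\<kappa> * x)"
    have d: "(?\<phi> has_real_derivative ?\<phi>' x) (at x)" for x by (auto intro!: derivative_eq_intros)
    have c': "continuous_on {a..b} ?\<phi>'" by (intro continuous_intros)
    have 1: "integral {a..b} (\<lambda>x. F x * ?\<phi>' x) = - integral {a..b} (\<lambda>x. g' x * ?\<phi> x)"
      using integral_indefinite_by_parts[OF _ g' d c'] z assms(1) by (simp add: F_def)
    have 2: "integral {a..b} (\<lambda>x. g x * ?\<phi>' x) = - integral {a..b} (\<lambda>x. g' x * ?\<phi> x)"
      by (rule weak_deriv_trig_step[OF assms(1) wd \<kappa>])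
    have "?\<phi> b = ?\<phi> a" using periodic_trig[OF assms(1), of A n B] unfolding periodic_def \<kappa>
      by (metis add.commute diff_add_cancel)
    moreover have "(?\<phi>' has_integral (?\<phi> b - ?\<phi> a)) {a..b}"
      by (rule fundamental_theorem_of_calculus)
        (use d assms(1) in \<open>auto simp: has_real_derivative_iff_has_vector_derivative[symmetric]
            intro: has_field_derivative_at_within\<close>)
    ultimately have 3: "((\<lambda>x. c * ?\<phi>' x) has_integral 0) {a..b}"
      using has_integral_mult_right[of ?\<phi>' 0 "{a..b}" c] by simp
    have i: "(\<lambda>x. g x * ?\<phi>' x) integrable_on {a..b}" "(\<lambda>x. F x * ?\<phi>' x) integrable_on {a..b}"
      using abs_integrable_mult_continuous[OF _ c'] g Fa set_lebesgue_integral_eq_integral(1) by blast+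
    have "((\<lambda>x. g x * ?\<phi>' x - F x * ?\<phi>' x - c * ?\<phi>' x) has_integral
        (integral {a..b} (\<lambda>x. g x * ?\<phi>' x) - integral {a..b} (\<lambda>x. F x * ?\<phi>' x) - 0)) {a..b}"
      by (intro has_integral_diff integrable_integral i 3)
    then have "((\<lambda>x. w x * ?\<phi>' x) has_integral 0) {a..b}"
      unfolding 1 2 by (simp add: w_def algebra_simps)
    then show ?thesis by blast
  qed
  have "negligible {x \<in> {a..b}. w x \<noteq> 0}"
  proof (rule orth_trig_induct[OF assms(1) w])
    fix n :: int
    define \<kappa> where "\<kappa> = of_int n * (2 * pi / (b - a))"
    have \<kappa>0: "\<kappa> = 0 \<longleftrightarrow> n = 0" using assms(1) by (simp add: \<kappa>_def)
    show "integral {a..b} (\<lambda>x. w x * cos (of_int n * (2 * pi / (b - a)) * x)) = 0"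
      using key[OF \<kappa>_def, of "1 / \<kappa>" 0] w0 \<kappa>0 unfolding \<kappa>_def[symmetric] by (cases "n = 0") auto
    show "integral {a..b} (\<lambda>x. w x * sin (of_int n * (2 * pi / (b - a)) * x)) = 0"
      using key[OF \<kappa>_def, of 0 "- (1 / \<kappa>)"] \<kappa>0 unfolding \<kappa>_def[symmetric] by (cases "n = 0") auto
  qed
  then show "\<exists>c. negligible {x \<in> {a..b}. g x \<noteq> c + integral {a..x} g'}"
    by (intro exI[of _ c]) (simp add: w_def F_def add.commute)
qed

section \<open>Square-integrable functions on an interval\<close>

lemma L2_abs_integrable:
  assumes "f \<in> L2 a b" shows "f absolutely_integrable_on {a..b}"
proof (rule measurable_bounded_by_integrable_imp_absolutely_integrable)
  show "f \<in> borel_measurable (lebesgue_on {a..b})" using assms by (simp add: L2_def)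
  show "(\<lambda>x. 1 + (f x)\<^sup>2) integrable_on {a..b}"
    by (rule integrable_add) (use assms in \<open>auto simp: L2_def\<close>)
  show "norm (f x) \<le> 1 + (f x)\<^sup>2" for x
    using zero_le_power2[of "\<bar>f x\<bar> - 1/2"] by (simp add: power2_eq_square algebra_simps)
qed simp

lemma L2_mult_integrable:
  assumes "f \<in> L2 a b" "g \<in> L2 a b" shows "(\<lambda>x. f x * g x) absolutely_integrable_on {a..b}"
proof (rule measurable_bounded_by_integrable_imp_absolutely_integrable)
  show "(\<lambda>x. f x * g x) \<in> borel_measurable (lebesgue_on {a..b})"
    using assms by (auto simp: L2_def)
  show "(\<lambda>x. (f x)\<^sup>2 + (g x)\<^sup>2) integrable_on {a..b}"
    by (rule integrable_add) (use assms in \<open>auto simp: L2_def\<close>)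
  show "norm (f x * g x) \<le> (f x)\<^sup>2 + (g x)\<^sup>2" for x
    using zero_le_power2[of "\<bar>f x\<bar> - \<bar>g x\<bar>"] mult_nonneg_nonneg[of "\<bar>f x\<bar>" "\<bar>g x\<bar>"]
    unfolding power2_diff real_norm_def abs_mult power2_abs by linarith
qed simp

lemma L2_integrable: "f \<in> L2 a b \<Longrightarrow> f integrable_on {a..b}"
  using L2_abs_integrable set_lebesgue_integral_eq_integral(1) by blast

lemma L2_mult_integrable': "f \<in> L2 a b \<Longrightarrow> g \<in> L2 a b \<Longrightarrow> (\<lambda>x. f x * g x) integrable_on {a..b}"
  using L2_mult_integrable set_lebesgue_integral_eq_integral(1) by blast

lemma L2_scale: "f \<in> L2 a b \<Longrightarrow> (\<lambda>x. c * f x) \<in> L2 a b"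
  by (auto simp: L2_def power_mult_distrib intro: integrable_on_mult_right)

lemma L2_add: assumes "f \<in> L2 a b" "g \<in> L2 a b" shows "(\<lambda>x. f x + g x) \<in> L2 a b"
proof -
  have "(\<lambda>x. (f x)\<^sup>2 + (g x)\<^sup>2 + 2 * (f x * g x)) integrable_on {a..b}"
    using assms by (intro integrable_add integrable_on_mult_right L2_mult_integrable')
        (auto simp: L2_def)
  moreover have "(\<lambda>x. (f x)\<^sup>2 + (g x)\<^sup>2 + 2 * (f x * g x)) = (\<lambda>x. (f x + g x)\<^sup>2)"
    by (auto simp: power2_sum)
  ultimately show ?thesis using assms by (auto simp: L2_def)
qed

lemma L2_diff: assumes "f \<in> L2 a b" "g \<in> L2 a b" shows "(\<lambda>x. f x - g x) \<in> L2 a b"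
  using L2_add[OF assms(1) L2_scale[OF assms(2), of "-1"]] by simp

lemma L2_continuous: "continuous_on {a..b} f \<Longrightarrow> f \<in> L2 a b"
  by (auto simp: L2_def intro!: continuous_imp_measurable_on_sets_lebesgue
      integrable_continuous_interval continuous_intros)

lemma L2_subinterval: "f \<in> L2 a b \<Longrightarrow> a \<le> x \<Longrightarrow> y \<le> b \<Longrightarrow> f \<in> L2 x y"
  unfolding L2_def
  by (auto intro: integrable_on_sub measurable_restrict_mono)

text \<open>The discriminant of a nonnegative quadratic in m. The sign of C is part of the
  conclusion: C = 0 forces B = 0, C < 0 is refuted by a large m, and otherwise m = B / C is the
  minimiser.\<close>

lemma quadratic_form_nonneg_imp:
  fixes A B C :: real
  assumes "\<And>m. 0 \<le> A - 2 * m * B + m\<^sup>2 * C" shows "B\<^sup>2 \<le> A * C"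
proof (cases "C = 0")
  case True
  have "B = 0"
  proof (rule ccontr)
    assume "B \<noteq> 0"
    with assms[of "(A + 1) / (2 * B)"] True show False by (simp add: field_simps)
  qed
  then show ?thesis using True by simp
next
  case False
  have "C > 0"
  proof (rule ccontr)
    assume "\<not> C > 0" then have "C < 0" using False by simp
    define m where "m = (\<bar>A\<bar> + 2 * \<bar>B\<bar> + 1) / (- C) + 1"
    have "0 \<le> (\<bar>A\<bar> + 2 * \<bar>B\<bar> + 1) / (- C)" using \<open>C < 0\<close> by (intro divide_nonneg_pos) auto
    then have m: "m \<ge> 1" unfolding m_def by linarith
    have "m * (- C) \<ge> \<bar>A\<bar> + 2 * \<bar>B\<bar> + 1"
      using \<open>C < 0\<close> by (simp add: m_def field_simps)
    then have "m * (m * (- C)) \<ge> m * (\<bar>A\<bar> + 2 * \<bar>B\<bar> + 1)" using m by (intro mult_left_mono) auto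
    moreover have "m * (\<bar>A\<bar> + 1) \<ge> 1 * (\<bar>A\<bar> + 1)" using m by (intro mult_right_mono) auto
    moreover have "- (2 * m * B) \<le> 2 * m * \<bar>B\<bar>" using m mult_left_mono[of "-B" "\<bar>B\<bar>" "2 * m"] by simp
    ultimately show False using assms[of m] by (simp add: algebra_simps power2_eq_square)
  qed
  then show ?thesis using assms[of "B / C"] by (simp add: field_simps power2_eq_square)
qed

lemma L2_Cauchy_Schwarz:
  assumes f: "f \<in> L2 a b" and g: "g \<in> L2 a b"
  shows "(integral {a..b} (\<lambda>x. f x * g x))\<^sup>2 \<le> integral {a..b} (\<lambda>x. (f x)\<^sup>2) * integral {a..b} (\<lambda>x.
      (g x)\<^sup>2)"
proof (rule quadratic_form_nonneg_imp)
  fix m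
  have "(\<lambda>x. f x - m * g x) \<in> L2 a b" by (intro L2_diff L2_scale f g)
  then have "0 \<le> integral {a..b} (\<lambda>x. (f x - m * g x)\<^sup>2)"
    by (intro integral_nonneg) (auto simp: L2_def)
  also have "(\<lambda>x. (f x - m * g x)\<^sup>2) = (\<lambda>x. (f x)\<^sup>2 - 2 * m * (f x * g x) + m\<^sup>2 * (g x)\<^sup>2)"
    by (auto simp: power2_diff power_mult_distrib algebra_simps)
  also have "integral {a..b} \<dots> = integral {a..b} (\<lambda>x. (f x)\<^sup>2) - 2 * m * integral {a..b} (\<lambda>x. f x * g x)
      + m\<^sup>2 * integral {a..b} (\<lambda>x. (g x)\<^sup>2)"
    using f g L2_mult_integrable'[OF f g]
    by (intro integral_unique has_integral_add has_integral_diff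
        has_integral_mult_right integrable_integral)
      (auto simp: L2_def)
  finally show "0 \<le> integral {a..b} (\<lambda>x. (f x)\<^sup>2) - 2 * m * integral {a..b} (\<lambda>x. f x * g x)
      + m\<^sup>2 * integral {a..b} (\<lambda>x. (g x)\<^sup>2)" .
qed

lemma L2_integral_square_le:
  assumes "g \<in> L2 a b" "a \<le> y" "y \<le> x" "x \<le> b"
  shows "(integral {y..x} g)\<^sup>2 \<le> (x - y) * integral {y..x} (\<lambda>x. (g x)\<^sup>2)"
  using L2_Cauchy_Schwarz[of "\<lambda>_. 1" y x g] L2_continuous[of y x "\<lambda>_. 1"] L2_subinterval[OF
      assms(1), of y x] assms
  by simp

section \<open>Periodic functions and the continuous representatives of Sobolev functions\<close>

lemma periodic_of_int:
  assumes "periodic L f" shows "f (x + of_int q * L) = f x"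
proof (induction q rule: int_induct[where k = 0])
  case (step1 i)
  have "f (x + of_int (i + 1) * L) = f ((x + of_int i * L) + L)" by (simp add: algebra_simps)
  then show ?case using assms step1 unfolding periodic_def by simp
next
  case (step2 i)
  have "f (x + of_int i * L) = f ((x + of_int (i - 1) * L) + L)" by (simp add: algebra_simps)
  then show ?case using assms step2 unfolding periodic_def by simp
qed simp

text \<open>Cauchy-Schwarz for two summands. It joins two bounds of the form (length) times
  (increment of a monotone function) across a break point without losing a constant.\<close>

lemma sum_sqrt_products_le:
  fixes \<alpha> :: real
  assumes "\<alpha> \<ge> 0" "\<beta> \<ge> 0" "A \<ge> 0" "B \<ge> 0" "p\<^sup>2 \<le> \<alpha> * A" "q\<^sup>2 \<le> \<beta> * B"
  shows "(p + q)\<^sup>2 \<le> (\<alpha> + \<beta>) * (A + B)"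
proof -
  have "(p * q)\<^sup>2 \<le> (\<alpha> * A) * (\<beta> * B)"
    unfolding power_mult_distrib using assms by (intro mult_mono) auto
  also have "\<dots> = (\<alpha> * B) * (\<beta> * A)" by simp
  also have "\<dots> \<le> ((\<alpha> * B + \<beta> * A) / 2)\<^sup>2"
    using zero_le_power2[of "\<alpha> * B - \<beta> * A"] by (simp add: power2_eq_square field_simps)
  finally have "\<bar>p * q\<bar> \<le> \<bar>(\<alpha> * B + \<beta> * A) / 2\<bar>" by (simp only: abs_le_square_iff)
  also have "\<dots> = (\<alpha> * B + \<beta> * A) / 2" using assms by simp
  finally have "p * q \<le> (\<alpha> * B + \<beta> * A) / 2" using abs_ge_self[of "p * q"] by (rule order_trans[rotated])
  then show ?thesis using assms by (simp add: power2_sum algebra_simps)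
qed

text \<open>Whole periods between two points contribute nothing to the increment of a periodic
  function, so the bound on one period extends to the line.\<close>

lemma periodic_extension:
  fixes G \<Gamma> :: "real \<Rightarrow> real"
  assumes ab: "a < b" and G: "G b = G a"
    and mono: "\<And>x y. a \<le> y \<Longrightarrow> y \<le> x \<Longrightarrow> x \<le> b \<Longrightarrow> \<Gamma> y \<le> \<Gamma> x" and "\<Gamma> a = 0"
    and incr: "\<And>x y. a \<le> y \<Longrightarrow> y \<le> x \<Longrightarrow> x \<le> b \<Longrightarrow> (G x - G y)\<^sup>2 \<le> (x - y) * (\<Gamma> x - \<Gamma> y)"
  obtains D \<Gamma>' M where "\<And>x. x \<in> {a..b} \<Longrightarrow> D x = G x" "periodic (b - a) D"
    "\<And>x. \<Gamma>' (x + (b - a)) = \<Gamma>' x + M" "mono \<Gamma>'"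
    "\<And>x y. y \<le> x \<Longrightarrow> (D x - D y)\<^sup>2 \<le> (x - y) * (\<Gamma>' x - \<Gamma>' y)"
proof -
  define L where "L = b - a"
  have L: "L > 0" using ab by (simp add: L_def)
  define q where "q x = \<lfloor>(x - a) / L\<rfloor>" for x
  define r where "r x = x - of_int (q x) * L" for x
  define M where "M = \<Gamma> b"
  have r: "a \<le> r x" "r x < b" for x
  proof -
    have "of_int (q x) \<le> (x - a) / L" "(x - a) / L < of_int (q x) + 1" unfolding q_def by linarith+
    then show "a \<le> r x" "r x < b" using L unfolding r_def by (auto simp: field_simps L_def)
  qed
  have qL: "q (x + L) = q x + 1" for x
  proof -
    have "(x + L - a) / L = (x - a) / L + 1" using L by (simp add: field_simps)
    then show ?thesis unfolding q_def by simp
  qed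
  have rL: "r (x + L) = r x" for x unfolding r_def qL by (simp add: algebra_simps)
  define D where "D x = G (r x)" for x
  \<comment> \<open>D repeats, but \<Gamma>' adds M, the increment over one period, at each period
    end and so stays monotone.\<close>
  define \<Gamma>' where "\<Gamma>' x = of_int (q x) * M + \<Gamma> (r x)" for x
  have M: "M \<ge> 0" using mono[of a b] ab \<open>\<Gamma> a = 0\<close> by (simp add: M_def)
  have \<Gamma>0: "0 \<le> \<Gamma> (r x)" "\<Gamma> (r x) \<le> M" for x
    using mono[of a "r x"] mono[of "r x" b] r[of x] \<open>\<Gamma> a = 0\<close> by (auto simp: M_def)
  have main: "(D x - D y)\<^sup>2 \<le> (x - y) * (\<Gamma>' x - \<Gamma>' y) \<and> \<Gamma>' y \<le> \<Gamma>' x" if "y \<le> x" for x y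
  proof (cases "q x = q y")
    case True
    then have "r x - r y = x - y" "\<Gamma>' x - \<Gamma>' y = \<Gamma> (r x) - \<Gamma> (r y)"
      by (auto simp: r_def \<Gamma>'_def)
    then show ?thesis using incr[of "r y" "r x"] mono[of "r y" "r x"] that r[of x] r[of y] by
        (simp add: D_def)
  next
    case False
    have "q y \<le> q x" unfolding q_def using that L by (intro floor_mono divide_right_mono) auto
    with False have "q y + 1 \<le> q x" by simp
    then obtain n where n: "q x = q y + 1 + int n" using zle_iff_zadd by blast
    have xy: "x - y = (r x - a) + (b - r y) + real n * L"
      by (simp add: r_def n L_def algebra_simps)
    have gxy: "\<Gamma>' x - \<Gamma>' y = (\<Gamma> (r x) - 0) + (M - \<Gamma> (r y)) + real n * M"
      by (simp add: \<Gamma>'_def n algebra_simps)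
    \<comment> \<open>The rest of the period of y and the beginning of the period of x meet at a
      period end, where G b = G a, so that their bounds can be joined.\<close>
    have "((G (r x) - G a) + (G b - G (r y)))\<^sup>2 \<le> ((r x - a) + (b - r y)) * ((\<Gamma> (r x) - 0) + (M - \<Gamma>
        (r y)))"
      using incr[of a "r x"] incr[of "r y" b] r[of x] r[of y] \<Gamma>0[of x] \<Gamma>0[of y] \<open>\<Gamma> a = 0\<close>
      by (intro sum_sqrt_products_le) (auto simp: M_def)
    also have "\<dots> \<le> (x - y) * (\<Gamma>' x - \<Gamma>' y)"
      unfolding xy gxy using r[of x] r[of y] \<Gamma>0[of x] \<Gamma>0[of y] M L by (intro mult_mono) auto
    finally have "(D x - D y)\<^sup>2 \<le> (x - y) * (\<Gamma>' x - \<Gamma>' y)" using G by (simp add: D_def)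
    moreover have "\<Gamma>' x - \<Gamma>' y \<ge> 0" unfolding gxy using \<Gamma>0[of x] \<Gamma>0[of y] M by auto
    ultimately show ?thesis by simp
  qed
  show ?thesis
  proof
    show "D x = G x" if "x \<in> {a..b}" for x
    proof (cases "x = b")
      case True
      have "(b - a) / L = 1" using L by (simp add: L_def)
      then have "r b = a" by (simp add: r_def q_def L_def)
      then show ?thesis using True G by (simp add: D_def)
    next
      case False
      then have "0 \<le> (x - a) / L" "(x - a) / L < 1" using that L by (auto simp: L_def field_simps)
      then have "q x = 0" unfolding q_def by (simp add: floor_eq_iff)
      then show ?thesis by (simp add: D_def r_def)
    qed
    show "periodic (b - a) D" using rL by (simp add: periodic_def D_def L_def)
    show "\<Gamma>' (x + (b - a)) = \<Gamma>' x + M" for x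
      using rL[of x] qL[of x] by (simp add: \<Gamma>'_def L_def algebra_simps)
    show "mono \<Gamma>'" using main by (auto intro: monoI)
    show "(D x - D y)\<^sup>2 \<le> (x - y) * (\<Gamma>' x - \<Gamma>' y)" if "y \<le> x" for x y using main[OF that] by blast
  qed
qed

lemma continuous_of_increment_bound:
  fixes D \<Gamma> :: "real \<Rightarrow> real"
  assumes "mono \<Gamma>" and incr: "\<And>x y. y \<le> x \<Longrightarrow> (D x - D y)\<^sup>2 \<le> (x - y) * (\<Gamma> x - \<Gamma> y)"
  shows "continuous_on UNIV D"
  unfolding continuous_on_eq_continuous_at[OF open_UNIV]
proof
  fix x
  define K where "K = \<Gamma> (x + 1) - \<Gamma> (x - 1)"
  have bound: "\<bar>D y - D x\<bar> \<le> sqrt (\<bar>y - x\<bar> * K)" if "\<bar>y - x\<bar> \<le> 1" for y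
  proof -
    have "(D y - D x)\<^sup>2 \<le> \<bar>y - x\<bar> * K"
    proof (cases "y \<le> x")
      case True
      have "(D y - D x)\<^sup>2 = (D x - D y)\<^sup>2" by (rule power2_commute)
      also have "\<dots> \<le> (x - y) * (\<Gamma> x - \<Gamma> y)" by (rule incr[OF True])
      also have "\<dots> \<le> \<bar>y - x\<bar> * K"
        unfolding K_def using True that monoD[OF assms(1), of x "x + 1"] monoD[OF assms(1), of "x - 1" y]
          monoD[OF assms(1) True]
        by (intro mult_mono) auto
      finally show ?thesis .
    next
      case False
      then have "(D y - D x)\<^sup>2 \<le> (y - x) * (\<Gamma> y - \<Gamma> x)" by (intro incr) auto
      also have "\<dots> \<le> \<bar>y - x\<bar> * K"
        unfolding K_def using False that monoD[OF assms(1), of y "x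
            + 1"] monoD[OF assms(1), of "x - 1" x]
          monoD[OF assms(1), of x y]
        by (intro mult_mono) auto
      finally show ?thesis .
    qed
    then show ?thesis by (simp add: real_le_rsqrt)
  qed
  have "((\<lambda>y. D y - D x) \<longlongrightarrow> 0) (at x)"
  proof (rule Lim_null_comparison)
    show "\<forall>\<^sub>F y in at x. norm (D y - D x) \<le> sqrt (\<bar>y - x\<bar> * K)"
      unfolding eventually_at by (rule exI[of _ 1]) (auto simp: dist_real_def intro: bound)
    have "((\<lambda>y. sqrt (\<bar>y - x\<bar> * K)) \<longlongrightarrow> sqrt (\<bar>x - x\<bar> * K)) (at x)" by (intro tendsto_intros)
    then show "((\<lambda>y. sqrt (\<bar>y - x\<bar> * K)) \<longlongrightarrow> 0) (at x)" by simp
  qed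
  then show "isCont D x" unfolding isCont_def using Lim_null by blast
qed

lemma antiderivative_real:
  fixes f :: "real \<Rightarrow> real"
  assumes "continuous_on UNIV f"
  obtains F where "\<And>x. (F has_real_derivative f x) (at x)" "F a = c"
proof -
  obtain F where F: "\<And>x. (F has_vector_derivative f x) (at x)"
    using einterval_antiderivative[of "-\<infinity>" "\<infinity>" f] assms
    by (auto simp: continuous_on_eq_continuous_at)
  show ?thesis
    by (rule that[of "\<lambda>x. F x + (c - F a)"])
      (auto intro!: derivative_eq_intros F simp: has_real_derivative_iff_has_vector_derivative)
qed

lemma eq_of_negligible:
  fixes f g :: "real \<Rightarrow> real"
  assumes "a < b" "continuous_on {a..b} f" "continuous_on {a..b} g"
    and "negligible {x \<in> {a..b}. f x \<noteq> g x}" "x \<in> {a..b}"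
  shows "f x = g x"
proof -
  have "integral {a..b} (\<lambda>x. (f x - g x)\<^sup>2) = integral {a..b} (\<lambda>x. 0)"
    by (rule integral_spike[OF assms(4)]) auto
  then have "\<forall>x\<in>{a..b}. (f x - g x)\<^sup>2 = 0"
    by (subst (asm) integral_const_real, subst integral_eq_0_iff[symmetric])
      (use assms in \<open>auto intro!: continuous_intros\<close>)
  then show ?thesis using assms by simp
qed

lemma eq_of_periodic:
  assumes "a < b" "periodic (b - a) f" "periodic (b - a) g" "\<And>x. x \<in> {a..b} \<Longrightarrow> f x = g x"
  shows "f = g"
proof
  fix x
  define q where "q = \<lfloor>(x - a) / (b - a)\<rfloor>"
  have "of_int q \<le> (x - a) / (b - a)" "(x - a) / (b - a) < of_int q + 1" unfolding q_def by linarith+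
  then have "x + of_int (- q) * (b - a) \<in> {a..b}" using assms(1) by (auto simp: field_simps)
  then have "f (x + of_int (- q) * (b - a)) = g (x + of_int (- q) * (b - a))" by (rule assms(4))
  then show "f x = g x" unfolding periodic_of_int[OF assms(2)] periodic_of_int[OF assms(3)] .
qed

text \<open>The weak derivative of order n + 1 is only in L^2; its primitive \<open>D n\<close>
  satisfies the increment bound by Cauchy-Schwarz, with \<Gamma> the primitive of its square. The
  lower orders follow downwards: by \<open>weak_deriv_step\<close> each weak derivative is a
  primitive of the next one up to a null set, and mean zero makes that primitive periodic. Since f
  is continuous, order 0 is f itself.\<close>

lemma Hs_regular:
  assumes ab: "a < b" and f: "f \<in> Hs a b (Suc n)" "continuous_on UNIV f"
  obtains D \<Gamma> M where "D 0 = f" "\<And>j x. j < n \<Longrightarrow> (D j has_real_derivative D (Suc j) x) (at x)"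
    "\<And>j. j \<le> n \<Longrightarrow> periodic (b - a) (D j)" "\<And>j. j \<le> n \<Longrightarrow> continuous_on UNIV (D j)"
    "mono \<Gamma>" "\<And>x. \<Gamma> (x + (b - a)) = \<Gamma> x + M"
    "\<And>x y. y \<le> x \<Longrightarrow> (D n x - D n y)\<^sup>2 \<le> (x - y) * (\<Gamma> x - \<Gamma> y)"
proof -
  have "\<exists>g. m \<le> Suc n \<longrightarrow> g \<in> L2 a b \<and> weak_deriv a b m f g \<and> (m = 0 \<longrightarrow> g = f)" for m
  proof (cases "m = 0")
    case True
    then show ?thesis using f unfolding Hs_def by (intro exI[of _ f]) (auto simp: weak_deriv_def)
  next
    case False
    then show ?thesis using f unfolding Hs_def by auto
  qed
  then obtain g where g: "\<And>m. m \<le> Suc n \<Longrightarrow> g m \<in> L2 a b" "\<And>m. m \<le> Suc n \<Longrightarrow> weak_deriv a b m f (g m)"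
    and g0: "g 0 = f" by (metis le0)
  have mean: "integral {a..b} (g (Suc m)) = 0"
    and prim: "\<exists>c. negligible {x \<in> {a..b}. g m x \<noteq> c + integral {a..x} (g (Suc m))}" if "m \<le> n" for m
    using weak_deriv_step[OF ab L2_abs_integrable L2_abs_integrable, of "g m" "g
        (Suc m)" m f] g that by auto
  obtain c where c: "negligible {x \<in> {a..b}. g n x \<noteq> c + integral {a..x} (g (Suc n))}"
      using prim[of n] by blast
  let ?g = "g (Suc n)"
  have gL: "?g \<in> L2 a b" using g by simp
  have gi: "?g integrable_on {a..b}" "(\<lambda>x. (?g x)\<^sup>2) integrable_on {a..b}"
    using L2_integrable[OF gL] gL by (auto simp: L2_def)
  have split: "integral {a..x} f = integral {a..y} f + integral {y..x} f"
    if "f integrable_on {a..b}" "a \<le> y" "y \<le> x" "x \<le> b" for f :: "real \<Rightarrow> real" and x y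
    using Henstock_Kurzweil_Integration.integral_combine[of a y x f] integrable_on_sub[OF that(1),
        of a x] that by auto
  obtain Dn \<Gamma> M where Dn: "\<And>x. x \<in> {a..b} \<Longrightarrow> Dn x = c + integral {a..x} ?g" "periodic (b - a) Dn"
    "\<And>x. \<Gamma> (x + (b - a)) = \<Gamma> x + M" "mono \<Gamma>"
    "\<And>x y. y \<le> x \<Longrightarrow> (Dn x - Dn y)\<^sup>2 \<le> (x - y) * (\<Gamma> x - \<Gamma> y)"
  proof (rule periodic_extension[OF ab, of "\<lambda>x. c + integral {a..x} ?g" "\<lambda>x. integral {a..x} (\<lambda>x.
      (?g x)\<^sup>2)"])
    show "c + integral {a..b} ?g = c + integral {a..a} ?g" using mean[of n] by simp
    fix x y assume xy: "a \<le> y" "y \<le> x" "x \<le> b"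
    have "0 \<le> integral {y..x} (\<lambda>x. (?g x)\<^sup>2)"
      by (rule integral_nonneg) (use integrable_on_sub[OF gi(2)] xy in auto)
    then show "integral {a..y} (\<lambda>x. (?g x)\<^sup>2) \<le> integral {a..x} (\<lambda>x. (?g x)\<^sup>2)"
      using split[OF gi(2) xy] by simp
    show "(c + integral {a..x} ?g - (c + integral {a..y} ?g))\<^sup>2
       \<le> (x - y) * (integral {a..x} (\<lambda>x. (?g x)\<^sup>2) - integral {a..y} (\<lambda>x. (?g x)\<^sup>2))"
      using L2_integral_square_le[OF gL xy] split[OF gi(1) xy] split[OF gi(2) xy] by simp
  qed (use that in auto)
  \<comment> \<open>The invariant of the downward induction: the levels from m to n have been built,
    and each agrees with the weak derivative \<open>g j\<close> up to a null set.\<close>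
  define P where "P m D \<longleftrightarrow> (\<forall>j. m \<le> j \<and> j < n \<longrightarrow> (\<forall>x. (D j has_real_derivative D (Suc j) x) (at x))) \<and>
    (\<forall>j. m \<le> j \<and> j \<le> n \<longrightarrow> periodic (b - a) (D j) \<and> continuous_on UNIV (D j)
        \<and> negligible {x \<in> {a..b}. g j x \<noteq> D j x}) \<and> D n = Dn"
    for m and D :: "nat \<Rightarrow> real \<Rightarrow> real"
  have "\<exists>D. P 0 D"
  proof (rule inc_induct[of 0 n "\<lambda>m. \<exists>D. P m D"])
    have "{x \<in> {a..b}. g n x \<noteq> Dn x} = {x \<in> {a..b}. g n x \<noteq> c + integral {a..x} ?g}" using Dn(1) by auto
    then have "P n (\<lambda>_. Dn)" unfolding P_def
      using Dn(2) c continuous_of_increment_bound[OF Dn(4,5)] by (auto dest: le_antisym)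
    then show "\<exists>D. P n D" by blast
  next
    fix m assume m: "m < n" and "\<exists>D. P (Suc m) D"
    then obtain D where D: "P (Suc m) D" by blast
    obtain c where c: "negligible {x \<in> {a..b}. g m x \<noteq> c + integral {a..x} (g (Suc m))}"
        using prim[of m] m by auto
    have Dc: "continuous_on UNIV (D (Suc m))" and Dp: "periodic (b - a) (D (Suc m))"
      and Dneg: "negligible {x \<in> {a..b}. g (Suc m) x \<noteq> D (Suc m) x}" using D m unfolding P_def by auto
    obtain F where F: "\<And>x. (F has_real_derivative D (Suc m) x) (at x)" "F a = c"
      using antiderivative_real[OF Dc] by blast
    have FI: "F x = c + integral {a..x} (g (Suc m))" if "x \<in> {a..b}" for x
    proof -
      have "(D (Suc m) has_integral (F x - F a)) {a..x}"
        by (rule fundamental_theorem_of_calculus)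
          (use F that in \<open>auto simp: has_real_derivative_iff_has_vector_derivative[symmetric] intro:
              has_field_derivative_at_within\<close>)
      moreover have "integral {a..x} (D (Suc m)) = integral {a..x} (g (Suc m))"
        by (rule integral_spike[OF Dneg]) (use that in auto)
      ultimately show ?thesis using F(2) by (auto simp: integral_unique)
    qed
    have Fab: "F b = F a" using FI[of b] mean[of m] m ab F(2) by simp
    have "periodic (b - a) F"
    proof -
      have "((\<lambda>x. F (x + (b - a)) - F x) has_real_derivative 0) (at x)" for x
        using DERIV_diff[OF DERIV_shift[THEN iffD1, OF F(1)[of "x + (b - a)"]] F(1)[of x]] Dp
        unfolding periodic_def by (simp add: add.commute)
      then have "F (x + (b - a)) - F x = F (a + (b - a)) - F a" for x
        using DERIV_isconst_all[of "\<lambda>x. F (x + (b - a)) - F x"] by blast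
      then show ?thesis using Fab by (auto simp: periodic_def)
    qed
    moreover have "continuous_on UNIV F"
      by (rule DERIV_continuous_on) (use F in \<open>auto intro: has_field_derivative_at_within\<close>)
    moreover have "{x \<in> {a..b}. g m x \<noteq> F x} = {x \<in> {a..b}. g m x \<noteq> c + integral {a..x} (g (Suc m))}"
      using FI by auto
    ultimately have "P m (D(m := F))" using D m F(1) c unfolding P_def
      by (auto simp: Suc_le_eq less_le)
    then show "\<exists>D. P m D" by blast
  qed simp
  then obtain D where D: "P 0 D" by blast
  have "D 0 = f"
  proof (rule eq_of_periodic[OF ab])
    show "periodic (b - a) (D 0)" "periodic (b - a) f" using D f unfolding P_def Hs_def by auto
    fix x assume "x \<in> {a..b}"
    moreover have "negligible {x \<in> {a..b}. f x \<noteq> D 0 x}" "continuous_on {a..b} (D 0)"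
      using D g0 unfolding P_def by (auto intro: continuous_on_subset)
    ultimately show "D 0 x = f x"
      using eq_of_negligible[OF ab continuous_on_subset[OF f(2)], of "D 0" x] by auto
  qed
  then show ?thesis using that[of D \<Gamma> M] D Dn unfolding P_def by auto
qed

text \<open>The summand of order 0 in the norm is some L^2 function chosen by \<open>SOME\<close>.
  It has the same integrals as f against all smooth periodic tests, in particular against sines and
  cosines, so it equals f almost everywhere.\<close>

lemma Hs_norm_ge_L2:
  assumes "a < b" "f \<in> L2 a b"
  shows "integral {a..b} (\<lambda>x. (f x)\<^sup>2) \<le> (Hs_norm a b s f)\<^sup>2"
proof -
  define G where "G m = (SOME g. g \<in> L2 a b \<and> weak_deriv a b m f g)" for m
  have nn: "0 \<le> integral {a..b} (\<lambda>x. (G m x)\<^sup>2)" for m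
    by (cases "(\<lambda>x. (G m x)\<^sup>2) integrable_on {a..b}") (auto intro: integral_nonneg simp:
        not_integrable_integral)
  have "\<exists>g. g \<in> L2 a b \<and> weak_deriv a b 0 f g" using assms by (intro exI[of _ f])
      (auto simp: weak_deriv_def)
  then have G: "G 0 \<in> L2 a b" "weak_deriv a b 0 f (G 0)" unfolding G_def by (metis
      (mono_tags, lifting) someI_ex)+
  have "negligible {x \<in> {a..b}. f x - G 0 x \<noteq> 0}"
  proof (rule orth_trig_induct[OF assms(1)])
    show "(\<lambda>x. f x - G 0 x) absolutely_integrable_on {a..b}"
      by (intro L2_abs_integrable L2_diff assms G)
    have *: "integral {a..b} (\<lambda>x. (f x - G 0 x) * \<phi> x) = 0" if \<phi>: "smooth \<phi>" "periodic (b - a) \<phi>" for \<phi>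
    proof -
      have "(deriv ^^ 0) \<phi> differentiable at x" for x using \<phi>(1) unfolding smooth_def by blast
      then have \<phi>c: "continuous_on {a..b} \<phi>"
        by (auto intro!: continuous_at_imp_continuous_on differentiable_imp_continuous_within)
      have "(\<lambda>x. f x * \<phi> x) integrable_on {a..b}" "(\<lambda>x. G 0 x * \<phi> x) integrable_on {a..b}"
        by (intro L2_mult_integrable' assms G L2_continuous \<phi>c)+
      then show ?thesis using G(2) \<phi> unfolding weak_deriv_def by
          (simp add: left_diff_distrib integral_diff)
    qed
    fix n :: int
    show "integral {a..b} (\<lambda>x. (f x - G 0 x) * cos (of_int n * (2 * pi / (b - a)) * x)) = 0"
      using *[of "\<lambda>x. 1 * cos (of_int n * (2 * pi / (b - a)) * x) + 0 * sin (of_int n * (2 * pi /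
          (b - a)) * x)"]
        smooth_trig[of 1 "of_int n * (2 * pi / (b - a))" 0] periodic_trig[OF assms(1), of 1 n 0]
      by auto
    show "integral {a..b} (\<lambda>x. (f x - G 0 x) * sin (of_int n * (2 * pi / (b - a)) * x)) = 0"
      using *[of "\<lambda>x. 0 * cos (of_int n * (2 * pi / (b - a)) * x) + 1 * sin (of_int n * (2 * pi /
          (b - a)) * x)"]
        smooth_trig[of 0 "of_int n * (2 * pi / (b - a))" 1] periodic_trig[OF assms(1), of 0 n 1]
      by auto
  qed
  then have "integral {a..b} (\<lambda>x. (f x)\<^sup>2) = integral {a..b} (\<lambda>x. (G 0 x)\<^sup>2)"
    by (rule integral_spike) auto
  also have "\<dots> \<le> (\<Sum>m\<le>s. integral {a..b} (\<lambda>x. (G m x)\<^sup>2))"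
    by (rule member_le_sum) (use nn in auto)
  also have "\<dots> = (Hs_norm a b s f)\<^sup>2"
    unfolding Hs_norm_def G_def[symmetric] by (simp add: sum_nonneg nn)
  finally show ?thesis .
qed

section \<open>Solutions of the advection equation\<close>

lemma Hs_imp_L2: "f \<in> Hs a b s \<Longrightarrow> f \<in> L2 a b"
  by (simp add: Hs_def)

lemma integral_power2_add_le:
  assumes "f \<in> L2 a b" "g \<in> L2 a b"
  shows "integral {a..b} (\<lambda>x. (f x + g x)\<^sup>2) \<le> 2 * integral {a..b} (\<lambda>x. (f x)\<^sup>2)
      + 2 * integral {a..b} (\<lambda>x. (g x)\<^sup>2)"
proof -
  have i: "(\<lambda>x. (f x)\<^sup>2) integrable_on {a..b}" "(\<lambda>x. (g x)\<^sup>2) integrable_on {a..b}"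
    using assms by (auto simp: L2_def)
  have "integral {a..b} (\<lambda>x. (f x + g x)\<^sup>2) \<le> integral {a..b} (\<lambda>x. 2 * (f x)\<^sup>2 + 2 * (g x)\<^sup>2)"
  proof (rule integral_le)
    show "(\<lambda>x. (f x + g x)\<^sup>2) integrable_on {a..b}" using L2_add[OF assms] by (simp add: L2_def)
    show "(\<lambda>x. 2 * (f x)\<^sup>2 + 2 * (g x)\<^sup>2) integrable_on {a..b}"
      by (intro integrable_add integrable_on_mult_right i)
    show "(f x + g x)\<^sup>2 \<le> 2 * (f x)\<^sup>2 + 2 * (g x)\<^sup>2" for x
      using zero_le_power2[of "f x - g x"] by (simp add: power2_eq_square algebra_simps)
  qed
  also have "\<dots> = 2 * integral {a..b} (\<lambda>x. (f x)\<^sup>2) + 2 * integral {a..b} (\<lambda>x. (g x)\<^sup>2)"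
    using i by (simp add: integral_add integrable_on_mult_right)
  finally show ?thesis .
qed

lemma integral_power2_nn_integral:
  assumes "f \<in> L2 a b"
  shows "(\<integral>\<^sup>+ x. ennreal ((f x)\<^sup>2) \<partial>lebesgue_on {a..b}) = ennreal (integral {a..b} (\<lambda>x. (f x)\<^sup>2))"
proof -
  have "(\<lambda>x. f x * f x) absolutely_integrable_on {a..b}" by (rule L2_mult_integrable[OF assms assms])
  then have "integrable (lebesgue_on {a..b}) (\<lambda>x. (f x)\<^sup>2)"
    by (simp add: power2_eq_square absolutely_integrable_measurable_real)
  then show ?thesis
    by (subst nn_integral_eq_integral) (auto simp: lebesgue_integral_eq_integral)
qed

text \<open>A pointwise limit z and a mean-square limit v of the same sequence agree: by Fatou the
  integral of (z - v)^2 is at most the liminf of the integrals of (q n - v)^2.\<close>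

lemma L2_limit_unique:
  assumes q: "\<And>n. q n \<in> L2 a b" and v: "v \<in> L2 a b" and z: "z \<in> L2 a b"
    and pt: "\<And>x. x \<in> {a..b} \<Longrightarrow> (\<lambda>n. q n x) \<longlonglongrightarrow> z x"
    and lim: "(\<lambda>n. integral {a..b} (\<lambda>x. (q n x - v x)\<^sup>2)) \<longlonglongrightarrow> 0"
  shows "integral {a..b} (\<lambda>x. (z x - v x)\<^sup>2) = 0"
proof -
  let ?M = "lebesgue_on {a..b}"
  have m: "q n \<in> borel_measurable ?M" "v \<in> borel_measurable ?M" for n using q v by (auto simp: L2_def)
  have "(\<integral>\<^sup>+ x. ennreal ((z x - v x)\<^sup>2) \<partial>?M) = (\<integral>\<^sup>+ x. liminf (\<lambda>n. ennreal ((q n x - v x)\<^sup>2)) \<partial>?M)"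
  proof (rule nn_integral_cong)
    fix x assume "x \<in> space ?M"
    then have "(\<lambda>n. ennreal ((q n x - v x)\<^sup>2)) \<longlonglongrightarrow> ennreal ((z x - v x)\<^sup>2)"
      using pt[of x] by (intro tendsto_intros) auto
    then show "ennreal ((z x - v x)\<^sup>2) = liminf (\<lambda>n. ennreal ((q n x - v x)\<^sup>2))"
      by (rule lim_imp_Liminf[symmetric, OF sequentially_bot])
  qed
  also have "\<dots> \<le> liminf (\<lambda>n. \<integral>\<^sup>+ x. ennreal ((q n x - v x)\<^sup>2) \<partial>?M)"
    by (rule nn_integral_liminf) (use m in measurable)
  also have "\<dots> = liminf (\<lambda>n. ennreal (integral {a..b} (\<lambda>x. (q n x - v x)\<^sup>2)))"
    using integral_power2_nn_integral[OF L2_diff[OF q v]] by simp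
  also have "\<dots> = 0"
  proof -
    have "(\<lambda>n. ennreal (integral {a..b} (\<lambda>x. (q n x - v x)\<^sup>2))) \<longlonglongrightarrow> ennreal 0"
      by (intro tendsto_ennrealI lim)
    then show ?thesis using lim_imp_Liminf[OF sequentially_bot] by fastforce
  qed
  finally have "ennreal (integral {a..b} (\<lambda>x. (z x - v x)\<^sup>2)) = 0"
    using integral_power2_nn_integral[OF L2_diff[OF z v]] by simp
  moreover have "0 \<le> integral {a..b} (\<lambda>x. (z x - v x)\<^sup>2)"
    by (rule integral_nonneg) (use L2_diff[OF z v] in \<open>auto simp: L2_def\<close>)
  ultimately show ?thesis by (simp add: ennreal_eq_0_iff)
qed

lemma at_within_Icc_neq_bot: "a < b \<Longrightarrow> t \<in> {a..b} \<Longrightarrow> at t within {a..b::real} \<noteq> bot"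
  by (metis atLeastAtMost_iff islimpt_Icc trivial_limit_within)

text \<open>The classical and the \<open>L\<^sup>2\<close> time derivative of \<open>u\<close> agree by Fatou's lemma.\<close>

lemma C1_Hs_L2_derivative:
  assumes ab: "a < b" and T: "T > 0" and u: "C1_Hs a b s T u" "advection_solution T u" and t: "t \<in>
      {0..T}"
    and d: "\<And>x. (u t has_real_derivative d x) (at x)" "continuous_on UNIV d"
  shows "((\<lambda>r. integral {a..b} (\<lambda>x. ((u r x - u t x) / (r - t) + d x)\<^sup>2)) \<longlongrightarrow> 0) (at t within {0..T})"
proof -
  obtain v where v: "\<And>t. t \<in> {0..T} \<Longrightarrow> u t \<in> Hs a b s \<and> v t \<in> Hs a b s"
    "\<And>t. t \<in> {0..T} \<Longrightarrow> ((\<lambda>r. Hs_norm a b s (\<lambda>x. (u r x - u t x) / (r - t) - v t x)) \<longlongrightarrow> 0)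
        (at t within {0..T})"
    using u(1) unfolding C1_Hs_def by blast
  have uL: "u r \<in> L2 a b" and vL: "v r \<in> L2 a b" if "r \<in> {0..T}" for r using v(1)[OF that] Hs_imp_L2
      by auto
  have dL: "d \<in> L2 a b" by (rule L2_continuous) (rule continuous_on_subset[OF d(2)], simp)
  have qL: "(\<lambda>x. (u r x - u t x) / (r - t)) \<in> L2 a b" if "r \<in> {0..T}" for r
    using L2_scale[OF L2_diff[OF uL[OF that] uL[OF t]], of "1 / (r - t)"] by simp
  have pt: "((\<lambda>r. (u r x - u t x) / (r - t)) \<longlongrightarrow> - d x) (at t within {0..T})" for x
  proof -
    obtain ut ux where "((\<lambda>r. u r x) has_real_derivative ut) (at t within {0..T})"
      "(u t has_real_derivative ux) (at x)" "ut + ux = 0"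
      using u(2) t unfolding advection_solution_def by blast
    moreover from this have "ux = d x" using d(1) DERIV_unique by blast
    then have "ut = - d x" using \<open>ut + ux = 0\<close> by linarith
    ultimately have "((\<lambda>r. u r x) has_real_derivative - d x) (at t within {0..T})"
      by simp
    then show ?thesis by (simp add: has_field_derivative_iff)
  qed
  have lim: "((\<lambda>r. integral {a..b} (\<lambda>x. ((u r x - u t x) / (r - t) - v t x)\<^sup>2)) \<longlongrightarrow> 0)
      (at t within {0..T})"
  proof (rule tendsto_sandwich[OF _ _ tendsto_const])
    have "((\<lambda>r. (Hs_norm a b s (\<lambda>x. (u r x - u t x) / (r - t) - v t x))\<^sup>2) \<longlongrightarrow> 0\<^sup>2) (at t within {0..T})"
      by (intro tendsto_intros v(2) t)
    then show "((\<lambda>r. (Hs_norm a b s (\<lambda>x. (u r x - u t x) / (r - t) - v t x))\<^sup>2) \<longlongrightarrow> 0)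
        (at t within {0..T})" by simp
    have *: "(\<lambda>x. (u r x - u t x) / (r - t) - v t x) \<in> L2 a b" if "r \<in> {0..T}" for r
      by (intro L2_diff qL vL t that)
    show "\<forall>\<^sub>F r in at t within {0..T}. integral {a..b} (\<lambda>x. ((u r x - u t x) / (r - t) - v t x)\<^sup>2)
        \<le> (Hs_norm a b s (\<lambda>x. (u r x - u t x) / (r - t) - v t x))\<^sup>2"
      unfolding eventually_at by (rule exI[of _ 1]) (auto intro!: Hs_norm_ge_L2[OF ab *])
    show "\<forall>\<^sub>F r in at t within {0..T}. 0 \<le> integral {a..b} (\<lambda>x. ((u r x - u t x) / (r - t) - v t x)\<^sup>2)"
      unfolding eventually_at by (rule exI[of _ 1]) (use * in \<open>auto intro!: integral_nonneg simp:
          L2_def\<close>)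
  qed
  \<comment> \<open>Fatou's lemma works along sequences, so the limit in time is taken along some r
    n tending to t.\<close>
  obtain r where r: "\<And>n. r n \<in> {0..T} - {t}" "r \<longlonglongrightarrow> t"
    using islimpt_sequential[of t "{0..T}"] islimpt_Icc[of 0 T t] T t by auto
  then have rf: "filterlim r (at t within {0..T}) sequentially"
    by (auto simp: filterlim_at)
  have "integral {a..b} (\<lambda>x. (- d x - v t x)\<^sup>2) = 0"
  proof (rule L2_limit_unique)
    show "(\<lambda>x. (u (r n) x - u t x) / (r n - t)) \<in> L2 a b" for n using r(1)[of n] by (intro qL) auto
    show "v t \<in> L2 a b" by (rule vL[OF t])
    show "(\<lambda>x. - d x) \<in> L2 a b" using L2_scale[OF dL, of "-1"] by simp
    show "(\<lambda>n. (u (r n) x - u t x) / (r n - t)) \<longlonglongrightarrow> - d x" for x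
      by (rule filterlim_compose[OF pt rf])
    show "(\<lambda>n. integral {a..b} (\<lambda>x. ((u (r n) x - u t x) / (r n - t) - v t x)\<^sup>2)) \<longlonglongrightarrow> 0"
      by (rule filterlim_compose[OF lim rf])
  qed
  then have z: "integral {a..b} (\<lambda>x. (v t x + d x)\<^sup>2) = 0"
    using power2_minus[of "v t _ + d _"] by (simp add: algebra_simps)
  show ?thesis
  proof (rule tendsto_sandwich[OF _ _ tendsto_const])
    have "((\<lambda>r. 2 * integral {a..b} (\<lambda>x. ((u r x - u t x) / (r - t) - v t x)\<^sup>2)) \<longlongrightarrow> 2 * 0)
        (at t within {0..T})"
      by (intro tendsto_intros lim)
    then show "((\<lambda>r. 2 * integral {a..b} (\<lambda>x. ((u r x - u t x) / (r - t) - v t x)\<^sup>2)) \<longlongrightarrow> 0)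
        (at t within {0..T})" by simp
    have "integral {a..b} (\<lambda>x. ((u r x - u t x) / (r - t) + d x)\<^sup>2)
      \<le> 2 * integral {a..b} (\<lambda>x. ((u r x - u t x) / (r - t) - v t x)\<^sup>2)" if "r \<in> {0..T}" for r
      using integral_power2_add_le[OF L2_diff[OF qL[OF that] vL[OF t]] L2_add[OF vL[OF t] dL]] z by simp
    then show "\<forall>\<^sub>F r in at t within {0..T}. integral {a..b} (\<lambda>x. ((u r x - u t x) / (r - t) + d x)\<^sup>2)
      \<le> 2 * integral {a..b} (\<lambda>x. ((u r x - u t x) / (r - t) - v t x)\<^sup>2)"
      unfolding eventually_at by (intro exI[of _ 1]) auto
    show "\<forall>\<^sub>F r in at t within {0..T}. 0 \<le> integral {a..b} (\<lambda>x. ((u r x - u t x) / (r - t) + d x)\<^sup>2)"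
      unfolding eventually_at
      by (rule exI[of _ 1]) (use L2_add[OF qL dL] in \<open>auto intro!: integral_nonneg simp: L2_def\<close>)
  qed
qed

lemma periodic_bounded:
  assumes "a < b" "periodic (b - a) f" "continuous_on UNIV f"
  obtains K where "K \<ge> 0" "\<And>x. \<bar>f x\<bar> \<le> K"
proof -
  have "bounded (f ` {a..b})"
    by (rule compact_imp_bounded, rule compact_continuous_image)
        (use assms in \<open>auto intro: continuous_on_subset\<close>)
  then obtain K where K: "K > 0" "\<forall>y\<in>f ` {a..b}. norm y \<le> K" unfolding bounded_pos by blast
  have "\<bar>f x\<bar> \<le> K" for x
  proof -
    define q where "q = \<lfloor>(x - a) / (b - a)\<rfloor>"
    have "of_int q \<le> (x - a) / (b - a)" "(x - a) / (b - a) < of_int q + 1" unfolding q_def by linarith+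
    then have "x + of_int (- q) * (b - a) \<in> {a..b}" using assms(1) by (auto simp: field_simps)
    then have "norm (f (x + of_int (- q) * (b - a))) \<le> K" using K(2) by blast
    then show ?thesis unfolding periodic_of_int[OF assms(2)] by simp
  qed
  then show ?thesis by (rule that[OF less_imp_le[OF K(1)]])
qed

text \<open>The mean value bound is applied twice, first to f' and then to f minus its tangent,
  which yields K in place of the sharp K / 2.\<close>

lemma taylor_remainder_bound:
  fixes f f' f'' :: "real \<Rightarrow> real"
  assumes f: "\<And>x. (f has_real_derivative f' x) (at x)" and f': "\<And>x. (f' has_real_derivative f'' x)
      (at x)"
    and K: "\<And>x. \<bar>f'' x\<bar> \<le> K"
  shows "\<bar>f (y + d) - f y - d * f' y\<bar> \<le> K * d\<^sup>2"
proof -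
  have lip: "\<bar>f' x - f' y\<bar> \<le> K * \<bar>x - y\<bar>" for x
    using field_differentiable_bound[of UNIV f' f'' K x y] f' K by auto
  have "norm ((\<lambda>z. f z - f' y * z) (y + d) - (\<lambda>z. f z - f' y * z) y) \<le> K * \<bar>d\<bar> * norm ((y + d) - y)"
  proof (rule field_differentiable_bound[of "closed_segment y (y + d)" _ "\<lambda>z. f' z - f' y"])
    fix z assume z: "z \<in> closed_segment y (y + d)"
    show "((\<lambda>z. f z - f' y * z) has_field_derivative f' z - f' y) (at z within closed_segment y (y + d))"
      by (auto intro!: derivative_eq_intros has_field_derivative_at_within[OF f])
    have "\<bar>z - y\<bar> \<le> \<bar>d\<bar>" using z by (auto simp: closed_segment_eq_real_ivl split: if_splits)
    moreover have "K \<ge> 0" using K[of 0] by linarith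
    ultimately show "norm (f' z - f' y) \<le> K * \<bar>d\<bar>" using lip[of z] mult_left_mono[of "\<bar>z - y\<bar>" "\<bar>d\<bar>"
        K] by simp
  qed auto
  then show ?thesis by (simp add: power2_eq_square algebra_simps)
qed

lemma periodic_deriv_mult_integral:
  assumes "a \<le> b" "periodic (b - a) w" "\<And>x. (w has_real_derivative w' x) (at x)"
  shows "integral {a..b} (\<lambda>x. w x * w' x) = 0"
proof -
  have "((\<lambda>x. w x * w' x) has_integral ((w b)\<^sup>2 / 2 - (w a)\<^sup>2 / 2)) {a..b}"
    by (rule fundamental_theorem_of_calculus[OF assms(1)])
      (auto intro!: derivative_eq_intros has_field_derivative_at_within[OF assms(3)]
        simp: has_real_derivative_iff_has_vector_derivative[symmetric] power2_eq_square)
  moreover have "w b = w a" using assms(2) unfolding periodic_def by (metis add.commute diff_add_cancel)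
  ultimately show ?thesis by (simp add: integral_unique)
qed

text \<open>The difference w of u and the transported initial value solves the same equation with
  zero data. Its energy E has derivative 0, since 2 w \<partial>_t w = - \<partial>_x (w^2)
  integrates to 0 over a period. Time differentiability of u is uniform in x only in the L^2 sense,
  so E is differentiated by hand.\<close>

lemma advection_transport:
  assumes ab: "a < b" and T: "T > 0" and u: "C1_Hs a b (Suc (Suc (Suc n))) T u" "advection_solution T u"
    and t: "t \<in> {0..T}"
  shows "u t x = u 0 (x - t)"
proof -
  have uH: "u t \<in> Hs a b (Suc (Suc (Suc n)))" if "t \<in> {0..T}" for t
    using u(1) that unfolding C1_Hs_def by blast
  have uc: "continuous_on UNIV (u t)" if "t \<in> {0..T}" for t
    using u(2) that unfolding advection_solution_def
    by (metis DERIV_isCont continuous_at_imp_continuous_on)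
  have uper: "periodic (b - a) (u t)" if "t \<in> {0..T}" for t
    using uH[OF that] by (simp add: Hs_def)
  have "\<exists>d. (\<forall>x. (u t has_real_derivative d x) (at x)) \<and> continuous_on UNIV d" if t: "t \<in> {0..T}" for t
  proof -
    from Hs_regular[OF ab uH[OF t] uc[OF t]] obtain D where "D 0 = u t"
      "\<And>j x. j < Suc (Suc n) \<Longrightarrow> (D j has_real_derivative D (Suc j) x) (at x)"
      "\<And>j. j \<le> Suc (Suc n) \<Longrightarrow> continuous_on UNIV (D j)" by metis
    then show ?thesis by (intro exI[of _ "D 1"]) (metis One_nat_def le_simps(3) less_Suc_eq_0_disj
        zero_less_Suc Suc_le_mono le0)
  qed
  then obtain d where d: "\<And>t x. t \<in> {0..T} \<Longrightarrow> (u t has_real_derivative d t x) (at x)"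
    "\<And>t. t \<in> {0..T} \<Longrightarrow> continuous_on UNIV (d t)" by metis
  have 0: "0 \<in> {0..T}" using T by simp
  from Hs_regular[OF ab uH[OF 0] uc[OF 0]] obtain D where D: "D 0 = u 0"
    "\<And>j x. j < Suc (Suc n) \<Longrightarrow> (D j has_real_derivative D (Suc j) x) (at x)"
    "\<And>j. j \<le> Suc (Suc n) \<Longrightarrow> periodic (b - a) (D j)"
    "\<And>j. j \<le> Suc (Suc n) \<Longrightarrow> continuous_on UNIV (D j)" by metis
  have D2: "continuous_on UNIV (D 2)" "periodic (b - a) (D 2)" by (rule D; simp)+
  obtain K where K: "K \<ge> 0" "\<And>x. \<bar>D 2 x\<bar> \<le> K"
    using periodic_bounded[OF ab D2(2,1)] by blast
  have D01: "(u 0 has_real_derivative D 1 x) (at x)" "(D 1 has_real_derivative D 2 x) (at x)" for x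
    using D(1) D(2)[of 0 x] D(2)[of 1 x] by (auto simp: numeral_2_eq_2)
  define w where "w t x = u t x - u 0 (x - t)" for t x
  define E where "E t = integral {a..b} (\<lambda>x. (w t x)\<^sup>2)" for t
  have wd: "(w t has_real_derivative d t x - D 1 (x - t)) (at x)" if "t \<in> {0..T}" for t x
  proof -
    have "((\<lambda>x. u 0 (x - t)) has_real_derivative D 1 (x - t)) (at x)"
      using DERIV_chain'[where f = "\<lambda>x. x - t" and g = "u 0" and E = "D 1 (x - t)" and D = 1 and x
          = x and s = UNIV] D01(1)
        DERIV_diff[OF DERIV_ident[of "at x"] DERIV_const[of t]]
      by simp
    then show ?thesis unfolding w_def[abs_def] by (auto intro!: derivative_eq_intros d that)
  qed
  have wc: "continuous_on X (w t)" if "t \<in> {0..T}" for t X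
    by (rule DERIV_continuous_on) (use wd[OF that] in \<open>auto intro: has_field_derivative_at_within\<close>)
  have w'c: "continuous_on X (\<lambda>x. d t x - D 1 (x - t))" if "t \<in> {0..T}" for t X
    by (intro continuous_intros continuous_on_compose2[OF D(4)[of 1]] continuous_on_subset[OF
        d(2)[OF that]]) auto
  have wp: "periodic (b - a) (w t)" if "t \<in> {0..T}" for t
    unfolding periodic_def
  proof
    fix x
    have "x + (b - a) - t = (x - t) + (b - a)" by simp
    then show "w t (x + (b - a)) = w t x"
      using uper[OF that] uper[OF 0] unfolding periodic_def w_def by (simp only:)
  qed
  have "(E has_real_derivative 0) (at t within {0..T})" if t: "t \<in> {0..T}" for t
  proof -
    \<comment> \<open>e is the amount by which the time quotient of w misses its limit - w'. Its
      first part tends to 0 in L^2 by \<open>C1_Hs_L2_derivative\<close>, its second one uniformly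
      by Taylor expansion of \<open>u 0\<close>.\<close>
    define e where "e r x = ((u r x - u t x) / (r - t) + d t x) - ((u 0 (x - r) - u 0 (x - t)) /
        (r - t) + D 1 (x - t))" for r x
    define w' where "w' x = d t x - D 1 (x - t)" for x
    have w'L: "w' \<in> L2 a b" "w t \<in> L2 a b"
      unfolding w'_def by (intro L2_continuous w'c t wc)+
    have w_e: "w r x - w t x = (r - t) * (e r x - w' x)" if "r \<noteq> t" for r x
    proof -
      have "e r x - w' x = ((u r x - u t x) - (u 0 (x - r) - u 0 (x - t))) / (r - t)"
        by (simp add: e_def w'_def diff_divide_distrib)
      then show ?thesis using that by (simp add: w_def)
    qed
    have eL: "e r \<in> L2 a b" if "r \<in> {0..T}" "r \<noteq> t" for r
    proof -
      have "e r = (\<lambda>x. 1 / (r - t) * (w r x - w t x) + w' x)" using w_e[OF that(2)] that by auto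
      then show ?thesis using w'L by (simp only:) (intro L2_add L2_scale L2_diff L2_continuous wc
          that(1) w'L)
    qed
    have elim: "((\<lambda>r. integral {a..b} (\<lambda>x. (e r x)\<^sup>2)) \<longlongrightarrow> 0) (at t within {0..T})"
    proof (rule tendsto_sandwich[OF _ _ tendsto_const])
      let ?B = "\<lambda>r. 2 * integral {a..b} (\<lambda>x. ((u r x - u t x) / (r - t) + d t x)\<^sup>2) + 2 *
          (integral {a..b} (\<lambda>x. (K * \<bar>r - t\<bar>)\<^sup>2))"
      have "(?B \<longlongrightarrow> 2 * 0 + 2 * ((b - a) * (K * \<bar>t - t\<bar>)\<^sup>2)) (at t within {0..T})"
        using C1_Hs_L2_derivative[OF ab T u t d(1)[OF t] d(2)[OF t]] ab by
            (auto intro!: tendsto_eq_intros)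
      then show "(?B \<longlongrightarrow> 0) (at t within {0..T})" by simp
      have "integral {a..b} (\<lambda>x. (e r x)\<^sup>2) \<le> ?B r" if r: "r \<in> {0..T}" "r \<noteq> t" for r
      proof -
        let ?f = "\<lambda>x. (u r x - u t x) / (r - t) + d t x" and ?g = "\<lambda>x. - ((u 0 (x - r) - u 0
            (x - t)) / (r - t) + D 1 (x - t))"
        have gc: "continuous_on {a..b} ?g"
          using r by (intro continuous_intros continuous_on_compose2[OF D(4)[of 1]]
              continuous_on_compose2[OF uc[OF 0]]) auto
        have fL: "?f \<in> L2 a b"
        proof -
          have "?f = (\<lambda>x. e r x - ?g x)" by (simp add: e_def)
          then show ?thesis using L2_diff[OF eL[OF r] L2_continuous[OF gc]] by simp
        qed
        have "integral {a..b} (\<lambda>x. (e r x)\<^sup>2) = integral {a..b} (\<lambda>x. (?f x + ?g x)\<^sup>2)"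
          by (simp only: e_def add_uminus_conv_diff)
        also have "\<dots> \<le> 2 * integral {a..b} (\<lambda>x. (?f x)\<^sup>2) + 2 * integral {a..b} (\<lambda>x. (?g x)\<^sup>2)"
          by (rule integral_power2_add_le[OF fL L2_continuous[OF gc]])
        also have "integral {a..b} (\<lambda>x. (?g x)\<^sup>2) \<le> integral {a..b} (\<lambda>x. (K * \<bar>r - t\<bar>)\<^sup>2)"
        proof (rule integral_le)
          show "(\<lambda>x. (?g x)\<^sup>2) integrable_on {a..b}" using L2_continuous[OF gc] by (simp add: L2_def)
          fix x
          have "\<bar>u 0 ((x - t) + (t - r)) - u 0 (x - t) - (t - r) * D 1 (x - t)\<bar> \<le> K * (t - r)\<^sup>2"
            by (rule taylor_remainder_bound[OF D01 K(2)])
          moreover have "(r - t) * ?g x = - ((r - t) * ((u 0 (x - r) - u 0 (x - t)) / (r - t)) +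
              (r - t) * D 1 (x - t))"
            by (simp only: mult_minus_right distrib_left)
          moreover have "(r - t) * ((u 0 (x - r) - u 0 (x - t)) / (r - t)) = u 0 (x - r) - u 0 (x - t)"
            using r by simp
          moreover have "- (u 0 (x - r) - u 0 (x - t) + (r - t) * D 1 (x - t))
              = - (u 0 ((x - t) + (t - r)) - u 0 (x - t) - (t - r) * D 1 (x - t))"
            by (simp add: algebra_simps)
          moreover have "K * (t - r)\<^sup>2 = K * \<bar>r - t\<bar> * \<bar>r - t\<bar>"
            unfolding mult.assoc abs_mult_self_eq by (simp add: power2_eq_square algebra_simps)
          ultimately have "\<bar>(r - t) * ?g x\<bar> \<le> K * \<bar>r - t\<bar> * \<bar>r - t\<bar>"
            by (simp only: abs_minus_cancel)
          then have "\<bar>?g x\<bar> \<le> K * \<bar>r - t\<bar>" using r by (simp add: abs_mult mult.commute[of "\<bar>r - t\<bar>"]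
              mult_le_cancel_right)
          then show "(?g x)\<^sup>2 \<le> (K * \<bar>r - t\<bar>)\<^sup>2"
            by (metis abs_ge_zero abs_le_square_iff abs_of_nonneg order_trans)
        qed auto
        finally show ?thesis by simp
      qed
      then show "\<forall>\<^sub>F r in at t within {0..T}. integral {a..b} (\<lambda>x. (e r x)\<^sup>2) \<le> ?B r"
        unfolding eventually_at by (intro exI[of _ 1]) auto
      show "\<forall>\<^sub>F r in at t within {0..T}. 0 \<le> integral {a..b} (\<lambda>x. (e r x)\<^sup>2)"
        unfolding eventually_at by (rule exI[of _ 1]) (use eL in \<open>auto intro!: integral_nonneg simp:
            L2_def\<close>)
    qed
    \<comment> \<open>Expand the square of w + (r - t) (e - w'). The term with w w' integrates to 0
      by periodicity, and what is left tends to 0 with r - t or with e.\<close>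
    have quot: "(E r - E t) / (r - t) = 2 * integral {a..b} (\<lambda>x. e r x * w t x) +
        (r - t) * integral {a..b} (\<lambda>x. (e r x + - w' x)\<^sup>2)"
      if r: "r \<in> {0..T}" "r \<noteq> t" for r
    proof -
      have i: "(\<lambda>x. e r x * w t x) integrable_on {a..b}" "(\<lambda>x. w' x * w t x) integrable_on {a..b}"
        "(\<lambda>x. (e r x + - w' x)\<^sup>2) integrable_on {a..b}" "(\<lambda>x. (w t x)\<^sup>2) integrable_on {a..b}"
        using L2_mult_integrable'[OF eL[OF r] w'L(2)] L2_mult_integrable'[OF w'L] L2_diff[OF eL[OF
            r] w'L(1)] w'L(2)
        by (auto simp: L2_def)
      have "(\<lambda>x. (w r x)\<^sup>2) = (\<lambda>x. (w t x)\<^sup>2 + (r - t) * (2 * (e r x * w t x) - 2 * (w' x * w t x) +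
          (r - t) * (e r x + - w' x)\<^sup>2))"
      proof
        fix x
        have "w r x = w t x + (r - t) * (e r x - w' x)" using w_e[OF r(2), of x] by simp
        then show "(w r x)\<^sup>2 = (w t x)\<^sup>2 + (r - t) * (2 * (e r x * w t x) - 2 * (w' x * w t x) +
            (r - t) * (e r x + - w' x)\<^sup>2)"
          by (simp only:) (simp add: power2_eq_square algebra_simps)
      qed
      then have "E r = E t + (r - t) * (2 * integral {a..b} (\<lambda>x. e r x * w t x) - 2 * integral
          {a..b} (\<lambda>x. w' x * w t x)
          + (r - t) * integral {a..b} (\<lambda>x. (e r x + - w' x)\<^sup>2))"
        unfolding E_def
        by (simp only:) (intro integral_unique has_integral_add has_integral_diff
            has_integral_mult_right integrable_integral i)
      moreover have "integral {a..b} (\<lambda>x. w' x * w t x) = 0"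
        using periodic_deriv_mult_integral[OF _ wp[OF t] wd[OF t]] ab by (simp add: w'_def mult.commute)
      ultimately show ?thesis using r by simp
    qed
    show ?thesis
      unfolding has_field_derivative_iff
    proof (rule Lim_null_comparison)
      let ?e = "\<lambda>r. integral {a..b} (\<lambda>x. (e r x)\<^sup>2)"
      let ?B = "\<lambda>r. 2 * sqrt (?e r * E t) + \<bar>r - t\<bar> * (2 * ?e r + 2 * integral {a..b} (\<lambda>x. (- w' x)\<^sup>2))"
      have "\<bar>(E r - E t) / (r - t)\<bar> \<le> ?B r" if r: "r \<in> {0..T}" "r \<noteq> t" for r
      proof -
        have "(integral {a..b} (\<lambda>x. e r x * w t x))\<^sup>2 \<le> ?e r * E t"
          unfolding E_def by (rule L2_Cauchy_Schwarz[OF eL[OF r] w'L(2)])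
        then have 1: "\<bar>integral {a..b} (\<lambda>x. e r x * w t x)\<bar> \<le> sqrt (?e r * E t)" by
            (simp add: real_le_rsqrt)
        have w'm: "(\<lambda>x. - w' x) \<in> L2 a b" using L2_scale[OF w'L(1), of "-1"] by simp
        have "0 \<le> integral {a..b} (\<lambda>x. (e r x + - w' x)\<^sup>2)"
          by (rule integral_nonneg) (use L2_add[OF eL[OF r] w'm] in \<open>auto simp: L2_def\<close>)
        then have "\<bar>(r - t) * integral {a..b} (\<lambda>x. (e r x + - w' x)\<^sup>2)\<bar>
            \<le> \<bar>r - t\<bar> * (2 * ?e r + 2 * integral {a..b} (\<lambda>x. (- w' x)\<^sup>2))"
          unfolding abs_mult using integral_power2_add_le[OF eL[OF r] w'm] by (intro mult_left_mono) auto
        then show ?thesis unfolding quot[OF r] using 1 by linarith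
      qed
      then show "\<forall>\<^sub>F r in at t within {0..T}. norm ((E r - E t) / (r - t)) \<le> ?B r"
        unfolding eventually_at by (intro exI[of _ 1]) auto
      have "(?B \<longlongrightarrow> 2 * sqrt (0 * E t) + \<bar>t - t\<bar> * (2 * 0 + 2 * integral {a..b} (\<lambda>x. (- w' x)\<^sup>2)))
          (at t within {0..T})"
        by (intro tendsto_intros elim)
      then show "(?B \<longlongrightarrow> 0) (at t within {0..T})" by simp
    qed
  qed
  then obtain c where "\<And>t. t \<in> {0..T} \<Longrightarrow> E t = c"
    using has_field_derivative_zero_constant[of "{0..T}" E] by auto
  then have "E t = E 0" using t 0 by metis
  also have "E 0 = 0" by (simp add: E_def w_def)
  finally have "\<forall>x\<in>{a..b}. (w t x)\<^sup>2 = 0"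
    unfolding E_def by (subst integral_eq_0_iff[symmetric]) (use wc[OF t] ab in \<open>auto intro!:
        continuous_intros\<close>)
  then have "w t = (\<lambda>x. 0)"
    by (intro eq_of_periodic[OF ab wp[OF t]]) (auto simp: periodic_def)
  then show ?thesis by (metis w_def eq_iff_diff_eq_0)
qed

lemma continuous_on_poly' [continuous_intros]: "continuous_on X (poly (p :: real poly))"
  by (intro continuous_intros)

lemma poly_integrable: "(poly (p :: real poly)) integrable_on {a..b}"
  by (intro integrable_continuous_interval continuous_intros)

lemma poly_eq_0_on_interval:
  fixes p :: "real poly"
  assumes "a < b" "\<And>x. x \<in> {a..b} \<Longrightarrow> poly p x = 0"
  shows "p = 0"
proof (rule ccontr)
  assume "p \<noteq> 0"
  then have "finite {x. poly p x = 0}" by (rule poly_roots_finite)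
  moreover have "{a..b} \<subseteq> {x. poly p x = 0}" using assms(2) by auto
  ultimately have "finite {a..b}" by (rule rev_finite_subset)
  then show False using assms(1) by (simp add: infinite_Icc)
qed

section \<open>Linear functionals on polynomials\<close>

definition plin :: "(real poly \<Rightarrow> real) \<Rightarrow> bool" where
  "plin F \<longleftrightarrow> (\<forall>p q. F (p + q) = F p + F q) \<and> (\<forall>c p. F (smult c p) = c * F p)"

lemma plinI: "(\<And>p q. F (p + q) = F p + F q) \<Longrightarrow> (\<And>c p. F (smult c p) = c * F p) \<Longrightarrow> plin F"
  by (simp add: plin_def)

lemma plin_add: "plin F \<Longrightarrow> F (p + q) = F p + F q" by (simp add: plin_def)
lemma plin_smult: "plin F \<Longrightarrow> F (smult c p) = c * F p" by (simp add: plin_def)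
lemma plin_0: "plin F \<Longrightarrow> F 0 = 0" using plin_smult[of F 0 0] by simp
lemma plin_minus: "plin F \<Longrightarrow> F (- p) = - F p" using plin_smult[of F "-1" p] by simp
lemma plin_diff: "plin F \<Longrightarrow> F (p - q) = F p - F q"
  using plin_add[of F p "- q"] plin_minus[of F q] by simp
lemma plin_sum: "plin F \<Longrightarrow> F (sum f A) = (\<Sum>i\<in>A. F (f i))"
  by (induction A rule: infinite_finite_induct) (auto simp: plin_0 plin_add)

lemma plin_expand:
  assumes "plin F" "degree q \<le> k" shows "F q = (\<Sum>j\<le>k. coeff q j * F (monom 1 j))"
proof -
  have "q = (\<Sum>j\<le>k. smult (coeff q j) (monom 1 j))"
    using poly_as_sum_of_monoms'[OF assms(2)] by (simp add: smult_monom)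
  then have "F q = F (\<Sum>j\<le>k. smult (coeff q j) (monom 1 j))" by (rule arg_cong)
  also have "\<dots> = (\<Sum>j\<le>k. coeff q j * F (monom 1 j))"
    by (simp add: plin_sum[OF assms(1)] plin_smult[OF assms(1)])
  finally show ?thesis .
qed

lemma plin_coeff: "plin (\<lambda>q. coeff q j)" by (rule plinI) auto
lemma plin_poly: "plin (\<lambda>q. poly q x)" by (rule plinI) auto
lemma plin_plus: "plin F \<Longrightarrow> plin G \<Longrightarrow> plin (\<lambda>q. F q + G q)" by (auto simp: plin_def algebra_simps)
lemma plin_cmult: "plin F \<Longrightarrow> plin (\<lambda>q. c * F q)" by (auto simp: plin_def algebra_simps)
lemma plin_divide: "plin F \<Longrightarrow> plin (\<lambda>q. F q / c)" by (auto simp: plin_def add_divide_distrib)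
lemma plin_minus': "plin F \<Longrightarrow> plin G \<Longrightarrow> plin (\<lambda>q. F q - G q)" by (auto simp: plin_def algebra_simps)
lemma plin_mult_const: "plin F \<Longrightarrow> plin (\<lambda>q. F q * c)" by (auto simp: plin_def algebra_simps)
lemma plin_pderiv: "plin F \<Longrightarrow> plin (\<lambda>q. F (pderiv q))"
  by (auto simp: plin_def pderiv_add pderiv_smult)

lemma plin_integral:
  fixes w :: "real poly \<Rightarrow> real \<Rightarrow> real"
  assumes "\<And>x. plin (\<lambda>q. w q x)" "\<And>q. (w q) integrable_on S"
  shows "plin (\<lambda>q. integral S (w q))"
proof (rule plinI)
  fix p q
  have "w (p + q) = (\<lambda>x. w p x + w q x)" using plin_add[OF assms(1)] by auto
  then show "integral S (w (p + q)) = integral S (w p) + integral S (w q)"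
    using integral_add[OF assms(2) assms(2)] by simp
next
  fix c p
  have "w (smult c p) = (\<lambda>x. c * w p x)" using plin_smult[OF assms(1)] by auto
  then show "integral S (w (smult c p)) = c * integral S (w p)" by simp
qed

text \<open>Induction on the dimension, as in Gram-Schmidt but for a form that may be nonsymmetric,
  as \<open>aform\<close> is. The new direction e is left-orthogonal to the smaller space, and
  definiteness makes B e e nonzero. Counting vanishing coefficients instead of degrees lets the
  induction start at dimension 0.\<close>

lemma definite_form_represents:
  fixes B :: "real poly \<Rightarrow> real poly \<Rightarrow> real"
  assumes l: "\<And>q. plin (\<lambda>p. B p q)" and r: "\<And>p. plin (B p)"
    and def: "\<And>p. \<forall>i\<ge>n. coeff p i = 0 \<Longrightarrow> B p p = 0 \<Longrightarrow> p = 0" and F: "plin F"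
  shows "\<exists>p. (\<forall>i\<ge>n. coeff p i = 0) \<and> (\<forall>q. (\<forall>i\<ge>n. coeff q i = 0) \<longrightarrow> B p q = F q)"
  using def F
proof (induction n arbitrary: F)
  case 0
  have "q = 0" if "\<forall>i\<ge>0. coeff q i = 0" for q :: "real poly" using that by (intro poly_eqI) simp
  then show ?case using plin_0[OF r] plin_0[OF 0(2)] by (intro exI[of _ 0]) (metis coeff_0)
next
  case (Suc n)
  have IH: "plin F \<Longrightarrow> \<exists>p. (\<forall>i\<ge>n. coeff p i = 0) \<and> (\<forall>q. (\<forall>i\<ge>n. coeff q i = 0) \<longrightarrow> B p q = F q)" for F
    by (rule Suc.IH) (auto intro: Suc.prems(1))
  obtain w where w: "\<forall>i\<ge>n. coeff w i = 0" "\<And>q. \<forall>i\<ge>n. coeff q i = 0 \<Longrightarrow> B w q = B (monom 1 n) q"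
    using IH[OF r] by blast
  obtain p0 where p0: "\<forall>i\<ge>n. coeff p0 i = 0" "\<And>q. \<forall>i\<ge>n. coeff q i = 0 \<Longrightarrow> B p0 q = F q"
    using IH[OF Suc.prems(2)] by blast
  define e where "e = monom 1 n - w"
  have e: "coeff e n = 1" "\<forall>i\<ge>Suc n. coeff e i = 0" using w(1) by (auto simp: e_def)
  have eB: "B e q = 0" if "\<forall>i\<ge>n. coeff q i = 0" for q
    using w(2)[OF that] by (simp add: e_def plin_diff[OF l])
  have "e \<noteq> 0" using e(1) by auto
  then have ee: "B e e \<noteq> 0" using Suc.prems(1) e by blast
  \<comment> \<open>Adding t e changes nothing on the smaller space, and this t corrects the value
    at e.\<close>
  define t where "t = (F e - B p0 e) / B e e"
  define p where "p = p0 + smult t e"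
  have "B p q = F q" if q: "\<forall>i\<ge>Suc n. coeff q i = 0" for q
  proof -
    define q' where "q' = q - smult (coeff q n) e"
    have q': "\<forall>i\<ge>n. coeff q' i = 0"
    proof (intro allI impI)
      fix i assume "i \<ge> n"
      then show "coeff q' i = 0" using q e by (cases "i = n") (auto simp: q'_def)
    qed
    have qq: "q = smult (coeff q n) e + q'" by (simp add: q'_def)
    have "B p q = B p (smult (coeff q n) e + q')" using qq by simp
    also have "\<dots> = coeff q n * (B p0 e + t * B e e) + (B p0 q' + t * B e q')"
      by (simp add: plin_add[OF r] plin_smult[OF r] p_def plin_add[OF l] plin_smult[OF l])
    also have "\<dots> = coeff q n * F e + F q'" using ee p0(2)[OF q'] eB[OF q'] by (simp add: t_def)
    also have "\<dots> = F (smult (coeff q n) e + q')"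
      by (simp add: plin_add[OF Suc.prems(2)] plin_smult[OF Suc.prems(2)])
    finally show ?thesis using qq by simp
  qed
  moreover have "\<forall>i\<ge>Suc n. coeff p i = 0" using p0(1) e(2) by (auto simp: p_def)
  ultimately show ?case by blast
qed

lemma degree_le_iff_coeff: "degree p \<le> k \<longleftrightarrow> (\<forall>i\<ge>Suc k. coeff p i = 0)"
proof
  assume "degree p \<le> k"
  then show "\<forall>i\<ge>Suc k. coeff p i = 0" by (auto intro: coeff_eq_0)
next
  assume "\<forall>i\<ge>Suc k. coeff p i = 0"
  then show "degree p \<le> k" by (intro degree_le) (auto simp: Suc_le_eq)
qed

text \<open>Used for three forms: \<open>aform\<close> yields the solution operator
  \<open>solve\<close>, \<open>ip\<close> bounds coefficients by the L^2 norm, and a sum over nodes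
  expresses coefficients through point values.\<close>

lemma dual_basis_exists:
  fixes B :: "real poly \<Rightarrow> real poly \<Rightarrow> real"
  assumes "\<And>q. plin (\<lambda>p. B p q)" "\<And>p. plin (B p)"
    and "\<And>p. degree p \<le> k \<Longrightarrow> B p p = 0 \<Longrightarrow> p = 0"
  shows "\<exists>\<xi>. \<forall>j. degree (\<xi> j) \<le> k \<and> (\<forall>q. degree q \<le> k \<longrightarrow> B (\<xi> j) q = coeff q j)"
proof -
  have "\<exists>p. degree p \<le> k \<and> (\<forall>q. degree q \<le> k \<longrightarrow> B p q = coeff q j)" for j
    unfolding degree_le_iff_coeff
    by (rule definite_form_represents[OF assms(1,2) _ plin_coeff])
      (rule assms(3), simp_all add: degree_le_iff_coeff)
  then show ?thesis by (intro choice allI)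
qed

section \<open>Bounded linear functionals on the reference cell\<close>

definition rcell :: "real set" where "rcell = {-1/2..1/2}"

text \<open>The bounded linear functionals on the continuous functions on \<open>rcell\<close> with
  the maximum norm, written for functions on the whole line.\<close>

definition cellfun :: "((real \<Rightarrow> real) \<Rightarrow> real) \<Rightarrow> bool" where
  "cellfun \<Lambda> \<longleftrightarrow>
     (\<forall>f g. continuous_on rcell f \<longrightarrow> continuous_on rcell g \<longrightarrow> \<Lambda> (\<lambda>s. f s + g s) = \<Lambda> f + \<Lambda> g) \<and>
     (\<forall>c (f :: real \<Rightarrow> real). continuous_on rcell f \<longrightarrow> \<Lambda> (\<lambda>s. c * f s) = c * \<Lambda> f) \<and>
     (\<exists>K\<ge>0. \<forall>(f :: real \<Rightarrow> real) A. continuous_on rcell f \<longrightarrow> (\<forall>s\<in>rcell. \<bar>f s\<bar> \<le> A) \<longrightarrow> \<bar>\<Lambda> f\<bar> \<le> K * A)"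

lemma cellfun_add: "cellfun \<Lambda> \<Longrightarrow> continuous_on rcell f \<Longrightarrow> continuous_on rcell g \<Longrightarrow> \<Lambda> (\<lambda>s. f s + g s)
    = \<Lambda> f + \<Lambda> g"
  by (simp add: cellfun_def)
lemma cellfun_scale: "cellfun \<Lambda> \<Longrightarrow> continuous_on rcell f \<Longrightarrow> \<Lambda> (\<lambda>s. c * f s) = c * \<Lambda> f"
  by (simp add: cellfun_def)
lemma cellfun_bound: "cellfun \<Lambda> \<Longrightarrow> \<exists>K\<ge>0. \<forall>(f :: real \<Rightarrow> real) A. continuous_on rcell f \<longrightarrow>
    (\<forall>s\<in>rcell. \<bar>f s\<bar> \<le> A) \<longrightarrow> \<bar>\<Lambda> f\<bar> \<le> K * A"
  by (simp add: cellfun_def)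
lemma cellfun_diff:
  assumes "cellfun \<Lambda>" "continuous_on rcell f" "continuous_on rcell g"
  shows "\<Lambda> (\<lambda>s. f s - g s) = \<Lambda> f - \<Lambda> g"
  using cellfun_add[OF assms(1,2), of "\<lambda>s. -1 * g s"] cellfun_scale[OF assms(1,3), of "-1"] assms(3)
  by (simp add: continuous_on_minus)

lemma cellfun_cong:
  assumes \<Lambda>: "cellfun \<Lambda>" and f: "continuous_on rcell f" and eq: "\<And>s. s \<in> rcell \<Longrightarrow> f s = g s"
  shows "\<Lambda> f = \<Lambda> g"
proof -
  have g: "continuous_on rcell g" using f continuous_on_cong[of rcell rcell f g] eq by auto
  obtain K where "\<forall>(f :: real \<Rightarrow> real) A. continuous_on rcell f \<longrightarrow> (\<forall>s\<in>rcell. \<bar>f s\<bar> \<le> A) \<longrightarrow> \<bar>\<Lambda> f\<bar> \<le> K * A"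
    using cellfun_bound[OF \<Lambda>] by blast
  moreover have "continuous_on rcell (\<lambda>s. f s - g s)" by (intro continuous_intros f g)
  \<comment> \<open>The bound with A = 0 annihilates a difference that vanishes on the cell,
    whatever it does outside.\<close>
  moreover have "\<forall>s\<in>rcell. \<bar>f s - g s\<bar> \<le> 0" using eq by auto
  ultimately have "\<bar>\<Lambda> (\<lambda>s. f s - g s)\<bar> \<le> K * 0" by blast
  then show ?thesis using cellfun_diff[OF \<Lambda> f g] by simp
qed

lemma cellfun_0: "cellfun \<Lambda> \<Longrightarrow> \<Lambda> (\<lambda>s. 0) = 0"
  using cellfun_scale[of \<Lambda> "\<lambda>s. 0" 0] by simp

lemma cellfun_eq_0: "cellfun \<Lambda> \<Longrightarrow> (\<And>s. s \<in> rcell \<Longrightarrow> f s = 0) \<Longrightarrow> \<Lambda> f = 0"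
  using cellfun_cong[of \<Lambda> "\<lambda>_. 0" f] cellfun_0[of \<Lambda>] by simp

lemma cellfun_plus:
  assumes "cellfun \<Lambda>" "cellfun \<Lambda>'" shows "cellfun (\<lambda>f. \<Lambda> f + \<Lambda>' f)"
proof -
  obtain K where K: "K \<ge> 0" "\<forall>(f :: real \<Rightarrow> real) A. continuous_on rcell f \<longrightarrow> (\<forall>s\<in>rcell. \<bar>f s\<bar> \<le> A)
      \<longrightarrow> \<bar>\<Lambda> f\<bar> \<le> K * A"
    using cellfun_bound[OF assms(1)] by blast
  obtain K' where K': "K' \<ge> 0" "\<forall>(f :: real \<Rightarrow> real) A. continuous_on rcell f \<longrightarrow> (\<forall>s\<in>rcell. \<bar>f s\<bar> \<le> A)
      \<longrightarrow> \<bar>\<Lambda>' f\<bar> \<le> K' * A"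
    using cellfun_bound[OF assms(2)] by blast
  have "\<exists>K\<ge>0. \<forall>(f :: real \<Rightarrow> real) A. continuous_on rcell f \<longrightarrow> (\<forall>s\<in>rcell. \<bar>f s\<bar> \<le> A) \<longrightarrow> \<bar>\<Lambda> f + \<Lambda>' f\<bar>
      \<le> K * A"
  proof (intro exI[of _ "K + K'"] conjI allI impI)
    fix f :: "real \<Rightarrow> real" and A assume "continuous_on rcell f" "\<forall>s\<in>rcell. \<bar>f s\<bar> \<le> A"
    then have "\<bar>\<Lambda> f\<bar> \<le> K * A" "\<bar>\<Lambda>' f\<bar> \<le> K' * A" using K K' by auto
    then show "\<bar>\<Lambda> f + \<Lambda>' f\<bar> \<le> (K + K') * A" unfolding distrib_right by linarith
  qed (use K K' in auto)
  then show ?thesis using assms unfolding cellfun_def by (simp add: algebra_simps)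
qed

lemma cellfun_cmult:
  assumes "cellfun \<Lambda>" shows "cellfun (\<lambda>f. c * \<Lambda> f)"
proof -
  obtain K where K: "K \<ge> 0" "\<forall>(f :: real \<Rightarrow> real) A. continuous_on rcell f \<longrightarrow> (\<forall>s\<in>rcell. \<bar>f s\<bar> \<le> A)
      \<longrightarrow> \<bar>\<Lambda> f\<bar> \<le> K * A"
    using cellfun_bound[OF assms(1)] by blast
  have "\<exists>K\<ge>0. \<forall>(f :: real \<Rightarrow> real) A. continuous_on rcell f \<longrightarrow> (\<forall>s\<in>rcell. \<bar>f s\<bar> \<le> A) \<longrightarrow> \<bar>c * \<Lambda> f\<bar> \<le> K * A"
    by (intro exI[of _ "\<bar>c\<bar> * K"]) (use K in \<open>auto simp: abs_mult mult.assoc intro!: mult_left_mono\<close>)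
  then show ?thesis using assms unfolding cellfun_def by (simp add: algebra_simps)
qed

lemma cellfun_minus: "cellfun \<Lambda> \<Longrightarrow> cellfun \<Lambda>' \<Longrightarrow> cellfun (\<lambda>f. \<Lambda> f - \<Lambda>' f)"
  using cellfun_plus[OF _ cellfun_cmult[of \<Lambda>' "-1"], of \<Lambda>] by simp

lemma cellfun_eval: "x \<in> rcell \<Longrightarrow> cellfun (\<lambda>f. f x)"
  unfolding cellfun_def by (auto intro!: exI[of _ 1])

lemma cellfun_eval_mult: "x \<in> rcell \<Longrightarrow> cellfun (\<lambda>f. f x * c)"
  using cellfun_cmult[OF cellfun_eval, of x c] by (simp add: mult.commute)

lemma cellfun_integral:
  fixes w :: "real \<Rightarrow> real"
  assumes "\<alpha> \<le> \<beta>" "{\<alpha>..\<beta>} \<subseteq> rcell" and w: "continuous_on {\<alpha>..\<beta>} w"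
  shows "cellfun (\<lambda>f. integral {\<alpha>..\<beta>} (\<lambda>y. f y * w y))"
proof -
  have i: "(\<lambda>y. f y * w y) integrable_on {\<alpha>..\<beta>}" if "continuous_on rcell f" for f :: "real \<Rightarrow> real"
    by (intro integrable_continuous_interval continuous_on_mult w continuous_on_subset[OF that assms(2)])
  have wi: "(\<lambda>y. \<bar>w y\<bar>) integrable_on {\<alpha>..\<beta>}"
    by (intro integrable_continuous_interval continuous_intros w)
  have "\<exists>K\<ge>0. \<forall>(f :: real \<Rightarrow> real) A. continuous_on rcell f \<longrightarrow> (\<forall>s\<in>rcell. \<bar>f s\<bar> \<le> A)
      \<longrightarrow> \<bar>integral {\<alpha>..\<beta>} (\<lambda>y. f y * w y)\<bar> \<le> K * A"
  proof (intro exI[of _ "integral {\<alpha>..\<beta>} (\<lambda>y. \<bar>w y\<bar>)"] conjI allI impI)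
    show "0 \<le> integral {\<alpha>..\<beta>} (\<lambda>y. \<bar>w y\<bar>)" by (rule integral_nonneg[OF wi]) auto
    fix f :: "real \<Rightarrow> real" and A assume f: "continuous_on rcell f" "\<forall>s\<in>rcell. \<bar>f s\<bar> \<le> A"
    have "norm (integral {\<alpha>..\<beta>} (\<lambda>y. f y * w y)) \<le> integral {\<alpha>..\<beta>} (\<lambda>y. A * \<bar>w y\<bar>)"
      by (rule integral_norm_bound_integral[OF i[OF f(1)] integrable_on_mult_right[OF wi]])
        (use f(2) assms(2) in \<open>auto simp: abs_mult intro!: mult_right_mono\<close>)
    then show "\<bar>integral {\<alpha>..\<beta>} (\<lambda>y. f y * w y)\<bar> \<le> integral {\<alpha>..\<beta>} (\<lambda>y. \<bar>w y\<bar>) * A"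
      by (simp add: mult.commute)
  qed
  moreover have "integral {\<alpha>..\<beta>} (\<lambda>y. c * f y * w y) = c * integral {\<alpha>..\<beta>} (\<lambda>y. f y * w y)" for c f
    by (simp add: mult.assoc)
  ultimately show ?thesis unfolding cellfun_def by (simp add: distrib_right integral_add i)
qed

section \<open>The forms on the reference cell\<close>

definition ip :: "(real \<Rightarrow> real) \<Rightarrow> real poly \<Rightarrow> real" where
  "ip f \<phi> = integral {-1/2..1/2} (\<lambda>s. f s * poly \<phi> s)"

text \<open>
  $\hat B_i$ with $h = 1$ is the sum of contributions of the left neighbour, which covers the left
  half of the cell, and of the right neighbour, each written in the coordinates of that
  neighbour, and of the own part \<open>- ip f \<phi> / C\<close>.
\<close>

definition flux_left :: "real \<Rightarrow> real poly \<Rightarrow> (real \<Rightarrow> real) \<Rightarrow> real" where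
  "flux_left C \<phi> f = integral {0..1/2} (\<lambda>y. f y * (poly \<phi> (y - 1/2) / C + poly (pderiv \<phi>) (y - 1/2)))
     + f 0 * poly \<phi> (-1/2)"

definition flux_right :: "real \<Rightarrow> real poly \<Rightarrow> (real \<Rightarrow> real) \<Rightarrow> real" where
  "flux_right C \<phi> f = integral {-1/2..0} (\<lambda>y. f y * (poly \<phi> (y + 1/2) / C + poly (pderiv \<phi>) (y + 1/2)))
     - f 0 * poly \<phi> (1/2)"

text \<open>This is the projection form with h = 1. It is the form of the method when both
  neighbours carry, in their own coordinates, the same function f as the cell itself.\<close>

definition pform :: "real \<Rightarrow> real poly \<Rightarrow> (real \<Rightarrow> real) \<Rightarrow> real" where
  "pform C \<phi> f = flux_left C \<phi> f + flux_right C \<phi> f - ip f \<phi> / C"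

lemma cellfun_ip: "cellfun (\<lambda>f. ip f \<phi>)"
  unfolding ip_def by (rule cellfun_integral) (auto simp: rcell_def intro!: continuous_intros)

lemma cellfun_flux_left: "cellfun (flux_left C \<phi>)"
  unfolding flux_left_def[abs_def] divide_inverse
  by (intro cellfun_plus cellfun_integral cellfun_eval_mult) (auto simp: rcell_def intro!:
      continuous_intros)

lemma cellfun_flux_right: "cellfun (flux_right C \<phi>)"
  unfolding flux_right_def[abs_def] divide_inverse
  by (intro cellfun_minus cellfun_integral cellfun_eval_mult)
      (auto simp: rcell_def intro!: continuous_intros)

lemma cellfun_pform: "cellfun (pform C \<phi>)"
  using cellfun_minus[OF cellfun_plus[OF cellfun_flux_left cellfun_flux_right] cellfun_cmult[OF
      cellfun_ip], of C \<phi> C \<phi> "1/C" \<phi>]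
  by (simp add: pform_def[abs_def])

lemma integrable_mult_cell:
  fixes f w :: "real \<Rightarrow> real"
  assumes "continuous_on rcell f" "\<alpha> \<ge> -1/2" "\<beta> \<le> 1/2" "continuous_on {\<alpha>..\<beta>} w"
  shows "(\<lambda>y. f y * w y) integrable_on {\<alpha>..\<beta>}"
proof -
  have "{\<alpha>..\<beta>} \<subseteq> rcell" using assms by (auto simp: rcell_def)
  then show ?thesis
    by (intro integrable_continuous_interval continuous_on_mult assms(4) continuous_on_subset[OF
        assms(1)])
qed

lemma plin_ip: "continuous_on rcell f \<Longrightarrow> plin (ip f)"
  unfolding ip_def[abs_def]
  by (rule plin_integral) (auto intro!: plin_cmult plin_poly integrable_mult_cell continuous_intros)

lemma plin_flux_weight: "plin (\<lambda>\<phi>. a * (poly \<phi> x / C + poly (pderiv \<phi>) x))"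
  by (intro plin_cmult plin_plus plin_divide plin_poly plin_pderiv[OF plin_poly])

lemma continuous_on_flux_weight: "continuous_on X (\<lambda>y. poly \<phi> (y + d) / C + poly (pderiv \<phi>) (y
    + d) :: real)"
  unfolding divide_inverse by (intro continuous_intros)

lemma plin_flux_left: "continuous_on rcell f \<Longrightarrow> plin (\<lambda>\<phi>. flux_left C \<phi> f)"
  unfolding flux_left_def
  by (intro plin_plus plin_cmult plin_poly plin_integral plin_flux_weight)
    (use continuous_on_flux_weight[where d = "-1/2"] in \<open>auto intro!: integrable_mult_cell\<close>)

lemma plin_flux_right: "continuous_on rcell f \<Longrightarrow> plin (\<lambda>\<phi>. flux_right C \<phi> f)"
  unfolding flux_right_def
  by (intro plin_minus' plin_cmult plin_poly plin_integral plin_flux_weight)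
    (auto intro!: integrable_mult_cell continuous_on_flux_weight)

lemma plin_pform: "continuous_on rcell f \<Longrightarrow> plin (\<lambda>\<phi>. pform C \<phi> f)"
  unfolding pform_def by (intro plin_minus' plin_plus plin_divide plin_flux_left plin_flux_right plin_ip)

lemma plin_cellfun_poly: "cellfun \<Lambda> \<Longrightarrow> plin (\<lambda>p. \<Lambda> (poly p))"
proof (rule plinI)
  fix p q assume "cellfun \<Lambda>"
  then show "\<Lambda> (poly (p + q)) = \<Lambda> (poly p) + \<Lambda> (poly q)"
    using cellfun_add[of \<Lambda> "poly p" "poly q"] by (simp add: poly_add[abs_def] continuous_intros)
next
  fix c p assume "cellfun \<Lambda>"
  then show "\<Lambda> (poly (smult c p)) = c * \<Lambda> (poly p)"
    using cellfun_scale[of \<Lambda> "poly p" c] by (simp add: poly_smult[abs_def] continuous_intros)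
qed

lemma integral_shift_poly:
  "integral {a..b} (\<lambda>x. poly p (x + c)) = integral {a + c..b + c} (poly (p :: real poly))"
  using integral_shift[of a c b "poly p"] by (simp add: o_def continuous_intros)

lemma poly_ftc:
  assumes "a \<le> b" shows "integral {a..b} (poly (pderiv p)) = poly p b - poly (p :: real poly) a"
  by (rule integral_unique, rule fundamental_theorem_of_calculus[OF assms])
    (simp add: has_real_derivative_iff_has_vector_derivative[symmetric]
        has_field_derivative_at_within[OF poly_DERIV])

text \<open>The terms of the energy that involve only the overlap of the right half of the cell of
  \<open>p\<close> with the left half of the cell of \<open>q\<close>.\<close>

lemma half_cell_energy:
  fixes p q :: "real poly"
  shows "flux_right C p (poly q) - integral {0..1/2} (\<lambda>s. (poly p s)\<^sup>2) / C
       + flux_left C q (poly p) - integral {-1/2..0} (\<lambda>s. (poly q s)\<^sup>2) / C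
     = - (integral {0..1/2} (\<lambda>s. (poly p s - poly q (s - 1/2))\<^sup>2) / C)"
proof -
  define r where "r = pcompose q [:-1/2, 1:]"
  have r: "poly r s = poly q (s - 1/2)" for s by (simp add: r_def poly_pcompose)
  have r': "poly (pderiv r) s = poly (pderiv q) (s - 1/2)" for s
    by (simp add: r_def pderiv_pcompose poly_pcompose pderiv_pCons)
  have 1: "integral {-1/2..0} (\<lambda>y. poly q y * (poly p (y + 1/2) / C + poly (pderiv p) (y + 1/2)))
      = integral {0..1/2} (poly (r * (smult (1/C) p + pderiv p)))"
    using integral_shift_poly[of "-1/2" 0 "r * (smult (1/C) p + pderiv p)" "1/2"] by (simp add: r)
  have 2: "integral {0..1/2} (\<lambda>y. poly p y * (poly q (y - 1/2) / C + poly (pderiv q) (y - 1/2)))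
      = integral {0..1/2} (poly (p * (smult (1/C) r + pderiv r)))"
    by (rule integral_cong) (simp add: r r')
  have 3: "integral {-1/2..0} (\<lambda>s. (poly q s)\<^sup>2) = integral {0..1/2} (poly (r * r))"
    using integral_shift_poly[of "-1/2" 0 "r * r" "1/2"] by (simp add: r power2_eq_square)
  have 4: "integral {0..1/2} (\<lambda>s. (poly p s)\<^sup>2) = integral {0..1/2} (poly (p * p))"
    by (rule integral_cong) (simp add: power2_eq_square)
  have 5: "integral {0..1/2} (\<lambda>s. (poly p s - poly q (s - 1/2))\<^sup>2) = integral {0..1/2} (poly
      ((p - r) * (p - r)))"
    by (rule integral_cong) (simp add: r power2_eq_square)
  have 6: "integral {0..1/2} (poly (pderiv (p * r))) = poly p (1/2) * poly q 0 - poly p 0 * poly q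
      (-1/2)"
    using poly_ftc[of 0 "1/2" "p * r"] by (simp add: r)
  have P: "plin (\<lambda>p. integral {0..1/2} (poly p))"
    by (rule plin_integral) (auto intro: plin_poly poly_integrable)
  \<comment> \<open>The two derivative terms combine to the derivative of p * r, whose integral
    cancels the point values in the two fluxes.\<close>
  have "r * (smult (1/C) p + pderiv p) + p * (smult (1/C) r + pderiv r)
      = smult (2/C) (p * r) + pderiv (p * r)"
    by (rule poly_eq_poly_eq_iff[THEN iffD1], rule ext) (simp add: pderiv_mult algebra_simps)
  then have "integral {0..1/2} (poly (r * (smult (1/C) p + pderiv p) + p * (smult (1/C) r + pderiv r)))
     = integral {0..1/2} (poly (smult (2/C) (p * r) + pderiv (p * r)))" by (rule arg_cong)
  then have 7: "integral {0..1/2} (poly (r * (smult (1/C) p + pderiv p))) + integral {0..1/2} (poly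
      (p * (smult (1/C) r + pderiv r)))
     = 2 / C * integral {0..1/2} (poly (p * r)) + integral {0..1/2} (poly (pderiv (p * r)))"
    unfolding plin_add[OF P] plin_smult[OF P] .
  have "(p - r) * (p - r) = p * p + r * r - smult 2 (p * r)"
    by (rule poly_eq_poly_eq_iff[THEN iffD1], rule ext) (simp add: algebra_simps)
  then have 8: "integral {0..1/2} (poly ((p - r) * (p - r))) = integral {0..1/2} (poly (p * p))
      + integral {0..1/2} (poly (r * r)) - 2 * integral {0..1/2} (poly (p * r))"
    by (simp only: plin_add[OF P] plin_smult[OF P] plin_diff[OF P])
  show ?thesis unfolding flux_right_def flux_left_def 1 2 3 4 5 8
    using 6 7 by (simp add: add_divide_distrib diff_divide_distrib mult.commute[of "poly q 0"])
qed

lemma ip_self_split: "ip (poly p) p = integral {-1/2..0} (\<lambda>s. (poly p s)\<^sup>2) + integral {0..1/2} (\<lambda>s.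
    (poly p s)\<^sup>2)"
  unfolding ip_def
  by (subst Henstock_Kurzweil_Integration.integral_combine[of "-1/2" 0 "1/2", symmetric])
    (auto simp: power2_eq_square intro!: integrable_continuous_interval continuous_intros)

text \<open>If all cells carry p, then a single overlap already contains both fluxes and both halves
  of \<open>ip (poly p) p\<close>.\<close>

lemma pform_self:
  "pform C p (poly p) = - (integral {0..1/2} (\<lambda>s. (poly p s - poly p (s - 1/2))\<^sup>2) / C)"
  using half_cell_energy[of C p p] unfolding pform_def ip_self_split by (simp add: add_divide_distrib)

lemma pform_1: "continuous_on rcell f \<Longrightarrow> pform C 1 f = 0"
  unfolding pform_def flux_left_def flux_right_def ip_def
  using Henstock_Kurzweil_Integration.integral_combine[of "-1/2" 0 "1/2" f]
    integrable_mult_cell[of f "-1/2" "1/2" "\<lambda>_. 1"]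
  by (simp add: pderiv_1 add_divide_distrib[symmetric])

section \<open>Translation-equivariant local functionals\<close>

definition shiftD :: "(nat \<Rightarrow> real \<Rightarrow> real) \<Rightarrow> nat \<Rightarrow> real \<Rightarrow> real" where
  "shiftD D j = D (Suc j)"

definition contD :: "(nat \<Rightarrow> real \<Rightarrow> real) \<Rightarrow> bool" where
  "contD D \<longleftrightarrow> (\<forall>j. continuous_on UNIV (D j))"

text \<open>One index counts derivatives and reach together. A correction step applies
  \<open>shiftD\<close>, which costs one derivative, and looks half a cell to either side, so
  raising n by 1 pays for both.\<close>

definition small_near :: "nat \<Rightarrow> (nat \<Rightarrow> real \<Rightarrow> real) \<Rightarrow> real \<Rightarrow> real \<Rightarrow> bool" where
  "small_near n D c A \<longleftrightarrow> (\<forall>j\<le>n. \<forall>y. \<bar>y - c\<bar> \<le> real n + 1 \<longrightarrow> \<bar>D j y\<bar> \<le> A)"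

text \<open>D is any sequence of continuous functions, not only the derivatives of
  \<open>D 0\<close>. The operations on D are thus those of a plain vector space, and a function
  with finitely many derivatives fits in after padding with zeros.\<close>

definition locmap :: "nat \<Rightarrow> ((nat \<Rightarrow> real \<Rightarrow> real) \<Rightarrow> real \<Rightarrow> real \<Rightarrow> real) \<Rightarrow> bool" where
  "locmap n H \<longleftrightarrow>
     (\<forall>D c. contD D \<longrightarrow> continuous_on rcell (H D c)) \<and>
     (\<forall>D D' c. contD D \<longrightarrow> contD D' \<longrightarrow> H (\<lambda>j y. D j y + D' j y) c = (\<lambda>s. H D c s + H D' c s)) \<and>
     (\<forall>D \<alpha> c. contD D \<longrightarrow> H (\<lambda>j y. \<alpha> * D j y) c = (\<lambda>s. \<alpha> * H D c s)) \<and>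
     (\<forall>D c d. contD D \<longrightarrow> H (\<lambda>j y. D j (y + d)) c = H D (c + d)) \<and>
     (\<exists>K\<ge>0. \<forall>D c A. contD D \<longrightarrow> small_near n D c A \<longrightarrow> (\<forall>s\<in>rcell. \<bar>H D c s\<bar> \<le> K * A))"

definition locfun :: "nat \<Rightarrow> ((nat \<Rightarrow> real \<Rightarrow> real) \<Rightarrow> real \<Rightarrow> real) \<Rightarrow> bool" where
  "locfun n \<Phi> \<longleftrightarrow> locmap n (\<lambda>D c s. \<Phi> D c)"

lemma contD_shiftD: "contD D \<Longrightarrow> contD (shiftD D)" by (simp add: contD_def shiftD_def)
lemma contD_scale: "contD D \<Longrightarrow> contD (\<lambda>j y. \<alpha> * D j y)"
  by (auto simp: contD_def intro!: continuous_intros)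
lemma continuous_on_translate:
  fixes f :: "real \<Rightarrow> real"
  assumes "continuous_on UNIV f" shows "continuous_on X (\<lambda>y. f (y + d))"
  by (rule continuous_on_compose2[OF assms, of X "\<lambda>y. y + d"]) (auto intro!: continuous_intros)
lemma contD_translate: "contD D \<Longrightarrow> contD (\<lambda>j y. D j (y + d))"
  unfolding contD_def by (simp add: continuous_on_translate)
lemma contD_diff: "contD D \<Longrightarrow> contD D' \<Longrightarrow> contD (\<lambda>j y. D j y - D' j y)"
  by (auto simp: contD_def intro!: continuous_intros)

lemma rcell_abs: "s \<in> rcell \<Longrightarrow> \<bar>s\<bar> \<le> 1" by (auto simp: rcell_def)

lemma zero_in_rcell: "0 \<in> rcell" by (simp add: rcell_def)

lemma locfunI:
  assumes "\<And>D D' c. contD D \<Longrightarrow> contD D' \<Longrightarrow> \<Phi> (\<lambda>j y. D j y + D' j y) c = \<Phi> D c + \<Phi> D' c"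
    and "\<And>D \<alpha> c. contD D \<Longrightarrow> \<Phi> (\<lambda>j y. \<alpha> * D j y) c = \<alpha> * \<Phi> D c"
    and "\<And>D c d. contD D \<Longrightarrow> \<Phi> (\<lambda>j y. D j (y + d)) c = \<Phi> D (c + d)"
    and "\<exists>K\<ge>0. \<forall>D c A. contD D \<longrightarrow> small_near n D c A \<longrightarrow> \<bar>\<Phi> D c\<bar> \<le> K * A"
  shows "locfun n \<Phi>"
proof -
  obtain K where "K \<ge> 0" "\<forall>D c A. contD D \<longrightarrow> small_near n D c A \<longrightarrow> \<bar>\<Phi> D c\<bar> \<le> K * A"
    using assms(4) by blast
  then have "\<exists>K\<ge>0. \<forall>D c A. contD D \<longrightarrow> small_near n D c A \<longrightarrow> (\<forall>s\<in>rcell. \<bar>\<Phi> D c\<bar> \<le> K * A)" by blast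
  then show ?thesis unfolding locfun_def locmap_def by (simp add: assms(1-3))
qed

lemma locfunD:
  assumes "locfun n \<Phi>"
  shows "\<And>D D' c. contD D \<Longrightarrow> contD D' \<Longrightarrow> \<Phi> (\<lambda>j y. D j y + D' j y) c = \<Phi> D c + \<Phi> D' c"
    and "\<And>D \<alpha> c. contD D \<Longrightarrow> \<Phi> (\<lambda>j y. \<alpha> * D j y) c = \<alpha> * \<Phi> D c"
    and "\<And>D c d. contD D \<Longrightarrow> \<Phi> (\<lambda>j y. D j (y + d)) c = \<Phi> D (c + d)"
    and "\<exists>K\<ge>0. \<forall>D c A. contD D \<longrightarrow> small_near n D c A \<longrightarrow> \<bar>\<Phi> D c\<bar> \<le> K * A"
proof -
  note a = assms[unfolded locfun_def locmap_def, THEN conjunct2]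
  show "\<And>D D' c. contD D \<Longrightarrow> contD D' \<Longrightarrow> \<Phi> (\<lambda>j y. D j y + D' j y) c = \<Phi> D c + \<Phi> D' c"
    using fun_cong[OF a[THEN conjunct1, rule_format]] by simp
  show "\<And>D \<alpha> c. contD D \<Longrightarrow> \<Phi> (\<lambda>j y. \<alpha> * D j y) c = \<alpha> * \<Phi> D c"
    using fun_cong[OF a[THEN conjunct2, THEN conjunct1, rule_format]] by simp
  show "\<And>D c d. contD D \<Longrightarrow> \<Phi> (\<lambda>j y. D j (y + d)) c = \<Phi> D (c + d)"
    using fun_cong[OF a[THEN conjunct2, THEN conjunct2, THEN conjunct1, rule_format]] by simp
  show "\<exists>K\<ge>0. \<forall>D c A. contD D \<longrightarrow> small_near n D c A \<longrightarrow> \<bar>\<Phi> D c\<bar> \<le> K * A"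
    using a[THEN conjunct2, THEN conjunct2, THEN conjunct2] zero_in_rcell by blast
qed

lemma locmapD:
  assumes "locmap n H"
  shows "\<And>D c. contD D \<Longrightarrow> continuous_on rcell (H D c)"
    and "\<And>D D' c. contD D \<Longrightarrow> contD D' \<Longrightarrow> H (\<lambda>j y. D j y + D' j y) c = (\<lambda>s. H D c s + H D' c s)"
    and "\<And>D \<alpha> c. contD D \<Longrightarrow> H (\<lambda>j y. \<alpha> * D j y) c = (\<lambda>s. \<alpha> * H D c s)"
    and "\<And>D c d. contD D \<Longrightarrow> H (\<lambda>j y. D j (y + d)) c = H D (c + d)"
    and "\<exists>K\<ge>0. \<forall>D c A. contD D \<longrightarrow> small_near n D c A \<longrightarrow> (\<forall>s\<in>rcell. \<bar>H D c s\<bar> \<le> K * A)"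
  using assms unfolding locmap_def by blast+

lemma locfun_cellfun:
  assumes H: "locmap n H" and \<Lambda>: "cellfun \<Lambda>"
  shows "locfun n (\<lambda>D c. \<Lambda> (H D c))"
proof (rule locfunI)
  note h = locmapD[OF H]
  fix D D' c assume "contD D" "contD D'"
  then show "\<Lambda> (H (\<lambda>j y. D j y + D' j y) c) = \<Lambda> (H D c) + \<Lambda> (H D' c)"
    by (simp add: h cellfun_add[OF \<Lambda>])
next
  note h = locmapD[OF H]
  fix D \<alpha> c assume "contD D"
  then show "\<Lambda> (H (\<lambda>j y. \<alpha> * D j y) c) = \<alpha> * \<Lambda> (H D c)" by (simp add: h cellfun_scale[OF \<Lambda>])
next
  show "\<Lambda> (H (\<lambda>j y. D j (y + d)) c) = \<Lambda> (H D (c + d))" if "contD D" for D c d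
    using that by (simp add: locmapD[OF H])
next
  obtain K where K: "K \<ge> 0" "\<forall>D c A. contD D \<longrightarrow> small_near n D c A \<longrightarrow> (\<forall>s\<in>rcell. \<bar>H D c s\<bar> \<le> K * A)"
    using locmapD(5)[OF H] by blast
  obtain K' where K': "K' \<ge> 0" "\<forall>f A. continuous_on rcell f \<longrightarrow> (\<forall>s\<in>rcell. \<bar>f s\<bar> \<le> A) \<longrightarrow> \<bar>\<Lambda> f\<bar> \<le> K' * A"
    using cellfun_bound[OF \<Lambda>] by blast
  show "\<exists>K\<ge>0. \<forall>D c A. contD D \<longrightarrow> small_near n D c A \<longrightarrow> \<bar>\<Lambda> (H D c)\<bar> \<le> K * A"
  proof (intro exI[of _ "K' * K"] conjI allI impI)
    fix D c A assume "contD D" "small_near n D c A"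
    then show "\<bar>\<Lambda> (H D c)\<bar> \<le> K' * K * A"
      using K(2) K'(2)[rule_format, OF locmapD(1)[OF H], of D c "K * A"] by (simp add: mult.assoc)
  qed (use K K' in auto)
qed

lemma locfun_eval: "locmap n H \<Longrightarrow> s \<in> rcell \<Longrightarrow> locfun n (\<lambda>D c. H D c s)"
  using locfun_cellfun[OF _ cellfun_eval] by blast

lemma small_near_mono: "small_near n D c A \<Longrightarrow> m \<le> n \<Longrightarrow> small_near m D c A"
  unfolding small_near_def by (meson add_right_mono le_trans of_nat_mono order_trans)

lemma locmap_mono: "locmap m H \<Longrightarrow> m \<le> n \<Longrightarrow> locmap n H"
proof -
  assume H: "locmap m H" and mn: "m \<le> n"
  obtain K where "K \<ge> 0" "\<forall>D c A. contD D \<longrightarrow> small_near m D c A \<longrightarrow> (\<forall>s\<in>rcell. \<bar>H D c s\<bar> \<le> K * A)"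
    using locmapD(5)[OF H] by blast
  then have "\<exists>K\<ge>0. \<forall>D c A. contD D \<longrightarrow> small_near n D c A \<longrightarrow> (\<forall>s\<in>rcell. \<bar>H D c s\<bar> \<le> K * A)"
    using small_near_mono[OF _ mn] by blast
  then show ?thesis unfolding locmap_def by (simp add: locmapD(1-4)[OF H])
qed

lemma locfun_mono: "locfun m H \<Longrightarrow> m \<le> n \<Longrightarrow> locfun n H"
  unfolding locfun_def by (rule locmap_mono)

lemma locfun_add:
  assumes "locfun n \<Phi>" "locfun n \<Psi>" shows "locfun n (\<lambda>D c. \<Phi> D c + \<Psi> D c)"
proof (rule locfunI)
  obtain K where K: "K \<ge> 0" "\<forall>D c A. contD D \<longrightarrow> small_near n D c A \<longrightarrow> \<bar>\<Phi> D c\<bar> \<le> K * A"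
    using locfunD(4)[OF assms(1)] by blast
  obtain K' where K': "K' \<ge> 0" "\<forall>D c A. contD D \<longrightarrow> small_near n D c A \<longrightarrow> \<bar>\<Psi> D c\<bar> \<le> K' * A"
    using locfunD(4)[OF assms(2)] by blast
  show "\<exists>K\<ge>0. \<forall>D c A. contD D \<longrightarrow> small_near n D c A \<longrightarrow> \<bar>\<Phi> D c + \<Psi> D c\<bar> \<le> K * A"
  proof (intro exI[of _ "K + K'"] conjI allI impI)
    fix D c A assume "contD D" "small_near n D c A"
    then have "\<bar>\<Phi> D c\<bar> \<le> K * A" "\<bar>\<Psi> D c\<bar> \<le> K' * A" using K K' by auto
    then show "\<bar>\<Phi> D c + \<Psi> D c\<bar> \<le> (K + K') * A" unfolding distrib_right by linarith
  qed (use K K' in auto)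
qed (simp_all add: locfunD(1-3)[OF assms(1)] locfunD(1-3)[OF assms(2)] distrib_left)

lemma locfun_cmult:
  assumes "locfun n \<Phi>" shows "locfun n (\<lambda>D c. \<alpha> * \<Phi> D c)"
proof (rule locfunI)
  obtain K where K: "K \<ge> 0" "\<forall>D c A. contD D \<longrightarrow> small_near n D c A \<longrightarrow> \<bar>\<Phi> D c\<bar> \<le> K * A"
    using locfunD(4)[OF assms(1)] by blast
  show "\<exists>K\<ge>0. \<forall>D c A. contD D \<longrightarrow> small_near n D c A \<longrightarrow> \<bar>\<alpha> * \<Phi> D c\<bar> \<le> K * A"
    by (intro exI[of _ "\<bar>\<alpha>\<bar> * K"]) (use K in \<open>auto simp: abs_mult mult.assoc intro!: mult_left_mono\<close>)
qed (simp_all add: locfunD(1-3)[OF assms(1)] distrib_left)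

lemma locfun_diff: "locfun n \<Phi> \<Longrightarrow> locfun n \<Psi> \<Longrightarrow> locfun n (\<lambda>D c. \<Phi> D c - \<Psi> D c)"
  using locfun_add[OF _ locfun_cmult[of n \<Psi> "-1"], of \<Phi>] by simp

lemma locfun_0: "locfun n (\<lambda>D c. 0)"
  by (rule locfunI) auto

lemma locfun_sum: "(\<And>i. i \<in> A \<Longrightarrow> locfun n (\<Phi> i)) \<Longrightarrow> locfun n (\<lambda>D c. \<Sum>i\<in>A. \<Phi> i D c)"
  by (induction A rule: infinite_finite_induct) (auto intro: locfun_0 locfun_add)

lemma locfun_translate:
  assumes "locfun n \<Phi>" "\<bar>d\<bar> \<le> 1" shows "locfun (Suc n) (\<lambda>D c. \<Phi> D (c + d))"
proof (rule locfunI)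
  obtain K where K: "K \<ge> 0" "\<forall>D c A. contD D \<longrightarrow> small_near n D c A \<longrightarrow> \<bar>\<Phi> D c\<bar> \<le> K * A"
    using locfunD(4)[OF assms(1)] by blast
  have "small_near n D (c + d) A" if "small_near (Suc n) D c A" for D c A
    unfolding small_near_def
  proof (intro allI impI)
    fix j y assume "j \<le> n" "\<bar>y - (c + d)\<bar> \<le> real n + 1"
    moreover from this have "\<bar>y - c\<bar> \<le> real (Suc n) + 1" using assms(2) by auto
    ultimately show "\<bar>D j y\<bar> \<le> A" using that unfolding small_near_def by auto
  qed
  then show "\<exists>K\<ge>0. \<forall>D c A. contD D \<longrightarrow> small_near (Suc n) D c A \<longrightarrow> \<bar>\<Phi> D (c + d)\<bar> \<le> K * A"
    using K by blast
  show "\<Phi> (\<lambda>j y. D j (y + d')) (c + d) = \<Phi> D (c + d' + d)" if "contD D" for D c d'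
    using locfunD(3)[OF assms(1) that, of d' "c + d"] by (simp add: add_ac)
qed (simp_all add: locfunD(1-3)[OF assms(1)])

lemma locfun_shiftD:
  assumes "locfun n \<Phi>" shows "locfun (Suc n) (\<lambda>D c. \<Phi> (shiftD D) c)"
proof (rule locfunI)
  obtain K where K: "K \<ge> 0" "\<forall>D c A. contD D \<longrightarrow> small_near n D c A \<longrightarrow> \<bar>\<Phi> D c\<bar> \<le> K * A"
    using locfunD(4)[OF assms(1)] by blast
  have "small_near n (shiftD D) c A" if "small_near (Suc n) D c A" for D c A
    using that unfolding small_near_def shiftD_def by auto
  then show "\<exists>K\<ge>0. \<forall>D c A. contD D \<longrightarrow> small_near (Suc n) D c A \<longrightarrow> \<bar>\<Phi> (shiftD D) c\<bar> \<le> K * A"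
    using K contD_shiftD by blast
  fix D D' c assume "contD D" "contD D'"
  then show "\<Phi> (shiftD (\<lambda>j y. D j y + D' j y)) c = \<Phi> (shiftD D) c + \<Phi> (shiftD D') c"
    using locfunD(1)[OF assms(1), of "shiftD D" "shiftD D'" c] contD_shiftD by
        (simp add: shiftD_def[abs_def])
next
  fix D \<alpha> c assume "contD D"
  then show "\<Phi> (shiftD (\<lambda>j y. \<alpha> * D j y)) c = \<alpha> * \<Phi> (shiftD D) c"
    using locfunD(2)[OF assms(1), of "shiftD D" \<alpha> c] contD_shiftD by (simp add: shiftD_def[abs_def])
next
  fix D c d assume "contD D"
  then show "\<Phi> (shiftD (\<lambda>j y. D j (y + d))) c = \<Phi> (shiftD D) (c + d)"
    using locfunD(3)[OF assms(1), of "shiftD D" d c] contD_shiftD by (simp add: shiftD_def[abs_def])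
qed

lemma locfun_minus: "locfun n \<Phi> \<Longrightarrow> contD D \<Longrightarrow> contD D' \<Longrightarrow> \<Phi> (\<lambda>j y. D j y - D' j y) c = \<Phi> D c - \<Phi> D' c"
  using locfunD(1)[of n \<Phi> D "\<lambda>j y. -1 * D' j y" c] locfunD(2)[of n \<Phi> D' "-1" c] contD_scale[of D' "-1"]
  by simp

text \<open>The divided difference in the centre is the functional applied to the divided differences
  of \<open>D\<close>, which converge uniformly near \<open>c\<close>.\<close>

lemma locfun_has_derivative:
  assumes \<Phi>: "locfun n \<Phi>" and D: "contD D"
    and deriv: "\<And>j y. j \<le> n \<Longrightarrow> (D j has_real_derivative D (Suc j) y) (at y)"
  shows "((\<lambda>c. \<Phi> D c) has_real_derivative \<Phi> (shiftD D) c) (at c)"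
proof -
  obtain K where K: "K \<ge> 0" "\<And>D c A. contD D \<Longrightarrow> small_near n D c A \<Longrightarrow> \<bar>\<Phi> D c\<bar> \<le> K * A"
    using locfunD(4)[OF \<Phi>] by blast
  define W where "W d j y = 1 / d * (D j (y + d) - D j y) - D (Suc j) y" for d j y
  have contW: "contD (W d)" for d
    using contD_diff[OF contD_scale[OF contD_diff[OF contD_translate[OF D, of d] D], of "1/d"]
        contD_shiftD[OF D]]
    by (simp add: W_def[abs_def] shiftD_def)
  have \<Phi>W: "\<Phi> (W d) c = (\<Phi> D (c + d) - \<Phi> D c) / d - \<Phi> (shiftD D) c" for d
  proof -
    have "\<Phi> (\<lambda>j y. 1 / d * (D j (y + d) - D j y) - shiftD D j y) c
        = 1 / d * (\<Phi> D (c + d) - \<Phi> D c) - \<Phi> (shiftD D) c"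
      using D contD_shiftD[OF D] contD_translate[OF D, of d]
      by (simp only: locfun_minus[OF \<Phi>] locfunD[OF \<Phi>] contD_scale contD_diff)
    then show ?thesis by (simp add: W_def[abs_def] shiftD_def)
  qed
  have unif: "\<forall>\<^sub>F d in at 0. \<forall>y. \<bar>y - c\<bar> \<le> real n + 1 \<longrightarrow> \<bar>W d j y\<bar> \<le> \<epsilon>" if j: "j \<le> n" and \<epsilon>: "\<epsilon> > 0"
      for j \<epsilon>
  proof -
    \<comment> \<open>The radius n + 2 leaves room for a step \<bar>d\<bar> < 1 beyond the radius n
      + 1 of \<open>small_near\<close>.\<close>
    let ?S = "{c - real n - 2 .. c + real n + 2}"
    have "uniformly_continuous_on ?S (D (Suc j))"
      by (rule compact_uniformly_continuous) (use D in \<open>auto simp: contD_def intro: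
          continuous_on_subset\<close>)
    then obtain \<delta> where \<delta>: "\<delta> > 0" "\<And>x x'. x \<in> ?S \<Longrightarrow> x' \<in> ?S \<Longrightarrow> dist x' x < \<delta> \<Longrightarrow> dist (D (Suc j) x') (D
        (Suc j) x) < \<epsilon>"
      unfolding uniformly_continuous_on_def using \<epsilon> by meson
    have "\<bar>W d j y\<bar> \<le> \<epsilon>" if d: "d \<noteq> 0" "\<bar>d\<bar> < min \<delta> 1" and y: "\<bar>y - c\<bar> \<le> real n + 1" for d y
    proof -
      have "norm ((\<lambda>z. D j z - D (Suc j) y * z) (y + d) - (\<lambda>z. D j z - D (Suc j) y * z) y)
          \<le> \<epsilon> * norm ((y + d) - y)"
      proof (rule field_differentiable_bound[of "closed_segment y (y + d)" _ "\<lambda>z. D (Suc j) z - D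
          (Suc j) y"])
        fix z assume z: "z \<in> closed_segment y (y + d)"
        show "((\<lambda>z. D j z - D (Suc j) y * z) has_field_derivative D (Suc j) z - D (Suc j) y)
            (at z within closed_segment y (y + d))"
          by (auto intro!: derivative_eq_intros has_field_derivative_at_within[OF deriv[OF j]])
        have zy: "\<bar>z - y\<bar> \<le> \<bar>d\<bar>" using z by (auto simp: closed_segment_eq_real_ivl split: if_splits)
        have "dist (D (Suc j) z) (D (Suc j) y) < \<epsilon>"
          by (rule \<delta>(2)) (use zy d y in \<open>auto simp: dist_real_def\<close>)
        then show "norm (D (Suc j) z - D (Suc j) y) \<le> \<epsilon>" by (simp add: dist_real_def)
      qed auto
      moreover have "d * W d j y = D j (y + d) - D (Suc j) y * (y + d) - (D j y - D (Suc j) y * y)"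
        using d by (simp add: W_def algebra_simps)
      ultimately have "\<bar>d\<bar> * \<bar>W d j y\<bar> \<le> \<bar>d\<bar> * \<epsilon>" by (simp add: abs_mult[symmetric] mult.commute)
      then show ?thesis using d by simp
    qed
    then show ?thesis unfolding eventually_at using \<delta>(1) by (intro exI[of _ "min \<delta> 1"]) auto
  qed
  have "((\<lambda>d. \<Phi> (W d) c) \<longlongrightarrow> 0) (at 0)"
  proof (rule tendstoI)
    fix \<epsilon> :: real assume "\<epsilon> > 0"
    define \<eta> where "\<eta> = \<epsilon> / (K + 1)"
    have \<eta>: "\<eta> > 0" "K * \<eta> < \<epsilon>" using \<open>\<epsilon> > 0\<close> K(1) by (auto simp: \<eta>_def field_simps)
    have "\<forall>\<^sub>F d in at 0. \<forall>j\<in>{..n}. \<forall>y. \<bar>y - c\<bar> \<le> real n + 1 \<longrightarrow> \<bar>W d j y\<bar> \<le> \<eta>"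
      by (rule eventually_ball_finite) (use unif \<eta> in auto)
    then show "\<forall>\<^sub>F d in at 0. dist (\<Phi> (W d) c) 0 < \<epsilon>"
    proof eventually_elim
      case (elim d)
      then have "small_near n (W d) c \<eta>" by (auto simp: small_near_def)
      then have "\<bar>\<Phi> (W d) c\<bar> \<le> K * \<eta>" by (rule K(2)[OF contW])
      then show ?case using \<eta> by simp
    qed
  qed
  then have "((\<lambda>d. (\<Phi> D (c + d) - \<Phi> D c) / d) \<longlongrightarrow> \<Phi> (shiftD D) c) (at 0)"
    unfolding \<Phi>W by (simp add: LIM_zero_iff)
  then show ?thesis by (simp add: DERIV_def)
qed

text \<open>The slope in the centre is m at every point. On polynomials this turns a shift by half a
  cell into exactly half of the functional of the derivative.\<close>

lemma locfun_const:
  assumes "locfun n \<Phi>" "contD D" "\<And>j y. (D j has_real_derivative D (Suc j) y) (at y)"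
    and "\<And>c. \<Phi> (shiftD D) c = m"
  shows "\<Phi> D (c + d) = \<Phi> D c + d * m"
proof -
  have "((\<lambda>c. \<Phi> D c - m * c) has_real_derivative 0) (at x)" for x
    using locfun_has_derivative[OF assms(1,2,3), of x] assms(4)
    by (auto intro!: derivative_eq_intros)
  then have "\<Phi> D (c + d) - m * (c + d) = \<Phi> D c - m * c"
    using DERIV_isconst_all[of "\<lambda>c. \<Phi> D c - m * c"] by blast
  then show ?thesis by (simp add: algebra_simps)
qed

definition dpoly :: "real poly \<Rightarrow> nat \<Rightarrow> real \<Rightarrow> real" where
  "dpoly p j = poly ((pderiv ^^ j) p)"

lemma contD_dpoly: "contD (dpoly p)"
  by (simp add: contD_def dpoly_def continuous_intros)

lemma shiftD_dpoly: "shiftD (dpoly p) = dpoly (pderiv p)"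
  by (rule ext) (simp add: shiftD_def dpoly_def funpow_Suc_right del: funpow.simps)

lemma dpoly_has_derivative: "(dpoly p j has_real_derivative dpoly p (Suc j) y) (at y)"
  unfolding dpoly_def by (simp add: poly_DERIV)

lemma locfun_dpoly_const:
  assumes "locfun n \<Phi>" "\<And>c. \<Phi> (dpoly (pderiv p)) c = m"
  shows "\<Phi> (dpoly p) (c + d) = \<Phi> (dpoly p) c + d * m"
  using locfun_const[OF assms(1) contD_dpoly dpoly_has_derivative, of p m] assms(2)
  by (simp add: shiftD_dpoly)

text \<open>Antidifferentiate a polynomial with the shifted data and adjust the constant term; no
  explicit Taylor coefficients occur.\<close>

lemma taylor_poly_exists:
  fixes v :: "nat \<Rightarrow> real"
  shows "\<exists>p. degree p \<le> n \<and> (\<forall>j\<le>n. dpoly p j c = v j)"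
proof (induction n arbitrary: v)
  case 0
  show ?case by (rule exI[of _ "[:v 0:]"]) (simp add: dpoly_def)
next
  case (Suc n)
  obtain q where q: "degree q \<le> n" "\<And>j. j \<le> n \<Longrightarrow> dpoly q j c = v (Suc j)"
    using Suc[of "\<lambda>j. v (Suc j)"] by blast
  define r where "r = (\<Sum>i\<le>n. monom (coeff q i / real (Suc i)) (Suc i))"
  have r: "pderiv r = q"
  proof -
    have "pderiv r = (\<Sum>i\<le>n. pderiv (monom (coeff q i / real (Suc i)) (Suc i)))"
      unfolding r_def by (rule higher_pderiv_sum[of 1, simplified])
    also have "\<dots> = (\<Sum>i\<le>n. monom (coeff q i) i)"
      by (intro sum.cong refl) (simp add: pderiv_monom)
    finally show ?thesis using poly_as_sum_of_monoms'[OF q(1)] by simp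
  qed
  have dr: "degree r \<le> Suc n"
    unfolding r_def by (intro degree_sum_le) (auto intro!: order_trans[OF degree_monom_le])
  define p where "p = r + [:v 0 - poly r c:]"
  have pd: "pderiv p = q" by (simp add: p_def pderiv_add r pderiv_pCons)
  have "dpoly p j c = v j" if "j \<le> Suc n" for j
  proof (cases j)
    case 0 then show ?thesis by (simp add: dpoly_def p_def)
  next
    case (Suc i)
    then have "dpoly p j c = dpoly q i c"
      using shiftD_dpoly[of p] pd by (metis shiftD_def)
    then show ?thesis using q(2)[of i] that Suc by simp
  qed
  moreover have "degree p \<le> Suc n" unfolding p_def by (rule degree_add_le) (use dr in auto)
  ultimately show ?case by blast
qed

section \<open>Projection and correction operators on the reference cell\<close>

locale cdg_cell =
  fixes k :: nat and C :: real
  assumes k: "1 \<le> k" and C: "0 < C"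
begin

text \<open>
  \<open>pform\<close> annihilates constants in both arguments; the product of the means restores definiteness and
  encodes the condition on the cell means.
\<close>

definition aform :: "real poly \<Rightarrow> real poly \<Rightarrow> real" where
  "aform p q = ip (poly p) 1 * ip (poly q) 1 - pform C q (poly p)"

lemma plin_aform_l: "plin (\<lambda>p. aform p q)"
  unfolding aform_def
  by (intro plin_minus' plin_mult_const plin_cellfun_poly cellfun_ip cellfun_pform)

lemma plin_aform_r: "plin (aform p)"
  unfolding aform_def[abs_def]
  by (intro plin_minus' plin_cmult plin_cellfun_poly cellfun_ip plin_pform continuous_intros)

text \<open>Both parts of the energy are nonnegative. If the second vanishes, p equals its translate
  by 1/2 on an interval and hence everywhere, so p takes the value p(0) at all multiples of 1/2 and
  is constant; the first part then makes it 0.\<close>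

lemma aform_definite:
  assumes "aform p p = 0" shows "p = 0"
proof -
  define r where "r = p - pcompose p [:-1/2, 1:]"
  have r: "poly r s = poly p s - poly p (s - 1/2)" for s by (simp add: r_def poly_pcompose)
  let ?I = "integral {0..1/2} (\<lambda>s. (poly r s)\<^sup>2)"
  have "0 \<le> ?I" by (rule integral_nonneg) (auto intro!: integrable_continuous_interval continuous_intros)
  have "aform p p = (ip (poly p) 1)\<^sup>2 + ?I / C"
    by (simp add: aform_def pform_self r power2_eq_square)
  moreover have "0 \<le> (ip (poly p) 1)\<^sup>2" "0 \<le> ?I / C" using \<open>0 \<le> ?I\<close> C by auto
  ultimately have "(ip (poly p) 1)\<^sup>2 = 0" "?I / C = 0" using assms by linarith+
  then have mean: "ip (poly p) 1 = 0" and "?I = 0" using C by auto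
  then have "\<forall>s\<in>{0..1/2}. (poly r s)\<^sup>2 = 0"
    by (subst integral_eq_0_iff[symmetric]) (auto intro!: continuous_intros)
  then have "r = 0" by (intro poly_eq_0_on_interval[of 0 "1/2"]) auto
  then have per: "poly p s = poly p (s - 1/2)" for s using r[of s] by simp
  have "poly p (real n / 2) = poly p 0" for n
  proof (induction n)
    case (Suc n) then show ?case using per[of "real (Suc n) / 2"] by (simp add: add_divide_distrib)
  qed simp
  then have "range (\<lambda>n. real n / 2) \<subseteq> {x. poly (p - [:poly p 0:]) x = 0}" by auto
  moreover have "infinite (range (\<lambda>n. real n / 2))" by (rule range_inj_infinite) (auto simp: inj_def)
  ultimately have "p - [:poly p 0:] = 0" using poly_roots_finite finite_subset by metis
  then have p: "p = [:poly p 0:]" by simp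
  have "ip (poly p) 1 = poly p 0" unfolding ip_def by (subst p) simp
  then show ?thesis using mean p by simp
qed

definition \<xi> :: "nat \<Rightarrow> real poly" where
  "\<xi> = (SOME \<xi>. \<forall>j. degree (\<xi> j) \<le> k \<and> (\<forall>q. degree q \<le> k \<longrightarrow> aform (\<xi> j) q = coeff q j))"

lemma \<xi>: "degree (\<xi> j) \<le> k" "degree q \<le> k \<Longrightarrow> aform (\<xi> j) q = coeff q j"
proof -
  have "\<exists>\<xi>. \<forall>j. degree (\<xi> j) \<le> k \<and> (\<forall>q. degree q \<le> k \<longrightarrow> aform (\<xi> j) q = coeff q j)"
    by (rule dual_basis_exists[OF plin_aform_l plin_aform_r]) (auto intro: aform_definite)
  then have "\<forall>j. degree (\<xi> j) \<le> k \<and> (\<forall>q. degree q \<le> k \<longrightarrow> aform (\<xi> j) q = coeff q j)"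
    unfolding \<xi>_def by (rule someI_ex)
  then show "degree (\<xi> j) \<le> k" "degree q \<le> k \<Longrightarrow> aform (\<xi> j) q = coeff q j" by blast+
qed

text \<open>Through the dual basis the coefficients of the solution are the values of F on
  monomials, so linearity, locality and bounds pass from F to the solution term by term.\<close>

definition solve :: "(real poly \<Rightarrow> real) \<Rightarrow> real poly" where
  "solve F = (\<Sum>j\<le>k. smult (F (monom 1 j)) (\<xi> j))"

lemma degree_solve: "degree (solve F) \<le> k"
  unfolding solve_def by (intro degree_sum_le) (auto intro: order_trans[OF degree_smult_le] \<xi>)

lemma poly_solve: "poly (solve F) s = (\<Sum>j\<le>k. F (monom 1 j) * poly (\<xi> j) s)"
  by (simp add: solve_def poly_sum)

lemma aform_solve: assumes "plin F" "degree q \<le> k" shows "aform (solve F) q = F q"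
proof -
  have "aform (solve F) q = (\<Sum>j\<le>k. F (monom 1 j) * coeff q j)"
    unfolding solve_def plin_sum[OF plin_aform_l] plin_smult[OF plin_aform_l]
        using \<xi>(2)[OF assms(2)] by simp
  then show ?thesis using plin_expand[OF assms] by (simp add: mult.commute)
qed

lemma solve_unique:
  assumes "plin F" "degree p \<le> k" "\<And>q. degree q \<le> k \<Longrightarrow> aform p q = F q"
  shows "p = solve F"
proof -
  have d: "degree (p - solve F) \<le> k" by (rule degree_diff_le[OF assms(2) degree_solve])
  have "aform (p - solve F) (p - solve F) = 0"
    using assms(3)[OF d] aform_solve[OF assms(1) d] by (simp add: plin_diff[OF plin_aform_l])
  then show ?thesis using aform_definite by fastforce
qed

text \<open>The correction step prescribes values on zero-mean tests only. Composing with
  \<open>mean0\<close> extends them by 0 to the constants, and testing with 1 then gives the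
  solution zero mean.\<close>

definition mean0 :: "real poly \<Rightarrow> real poly" where "mean0 q = q - [:ip (poly q) 1:]"

text \<open>The negative of the right-hand side of the correction step. The forms
  \<open>cdg_form\<close> and \<open>proj_form\<close> share their own part - ip / C, so only the
  differences of neighbour and own data remain: they measure how \<open>R^l\<close> varies with the
  centre.\<close>

definition corrF :: "((nat \<Rightarrow> real \<Rightarrow> real) \<Rightarrow> real \<Rightarrow> real \<Rightarrow> real) \<Rightarrow>
    (nat \<Rightarrow> real \<Rightarrow> real) \<Rightarrow> real \<Rightarrow> real poly \<Rightarrow> real" where
  "corrF H D c \<phi> = ip (H (shiftD D) c) \<phi>
     + (flux_left C \<phi> (H D (c - 1/2)) - flux_left C \<phi> (H D c))
     + (flux_right C \<phi> (H D (c + 1/2)) - flux_right C \<phi> (H D c))"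

definition projF :: "(real \<Rightarrow> real) \<Rightarrow> real poly \<Rightarrow> real" where
  "projF f q = ip f 1 * ip (poly q) 1 - pform C q f"

text \<open>
  \<open>Rcor l D c s\<close> is $R^l u$ at the point $h (c + s)$ of the cell centred at $h c$, for
  \<open>D j y\<close> $= h^j (\partial_x^j u)(h y)$.  In this scaling \<open>shiftD D\<close> stands for $h\, \partial_x u$.
\<close>

primrec Rcor :: "nat \<Rightarrow> (nat \<Rightarrow> real \<Rightarrow> real) \<Rightarrow> real \<Rightarrow> real \<Rightarrow> real" where
  "Rcor 0 = (\<lambda>D c s. D 0 (c + s) - poly (solve (projF (\<lambda>s. D 0 (c + s)))) s)"
| "Rcor (Suc l) = (\<lambda>D c s. poly (solve (\<lambda>q. corrF (Rcor l) D c (mean0 q))) s)"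

lemma locmap_solve:
  assumes F: "\<And>q. locfun n (\<lambda>D c. F D c q)"
  shows "locmap n (\<lambda>D c s. poly (solve (F D c)) s)"
proof -
  have "\<forall>j. \<exists>K. K \<ge> 0 \<and> (\<forall>D c A. contD D \<longrightarrow> small_near n D c A \<longrightarrow> \<bar>F D c (monom 1 j)\<bar> \<le> K * A)"
    using locfunD(4)[OF F] by blast
  from choice[OF this] obtain K where K: "\<And>j. K j \<ge> 0"
    "\<And>j D c A. contD D \<Longrightarrow> small_near n D c A \<Longrightarrow> \<bar>F D c (monom 1 j)\<bar> \<le> K j * A"
    by blast
  have "\<exists>m\<ge>0. \<forall>s\<in>rcell. \<bar>poly (\<xi> j) s\<bar> \<le> m" for j
  proof -
    have "bounded (poly (\<xi> j) ` rcell)"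
      by (rule compact_imp_bounded, rule compact_continuous_image)
          (auto intro: continuous_intros simp: rcell_def)
    then obtain m where "m > 0" "\<forall>y\<in>poly (\<xi> j) ` rcell. norm y \<le> m" unfolding bounded_pos by blast
    then show ?thesis by (intro exI[of _ m]) auto
  qed
  then obtain m where m: "\<And>j. m j \<ge> 0" "\<And>j s. s \<in> rcell \<Longrightarrow> \<bar>poly (\<xi> j) s\<bar> \<le> m j" by metis
  have "\<exists>K\<ge>0. \<forall>D c A. contD D \<longrightarrow> small_near n D c A \<longrightarrow> (\<forall>s\<in>rcell. \<bar>poly (solve (F D c)) s\<bar> \<le> K * A)"
  proof (intro exI[of _ "\<Sum>j\<le>k. K j * m j"] conjI allI impI ballI)
    show "0 \<le> (\<Sum>j\<le>k. K j * m j)" using K(1) m(1) by (intro sum_nonneg) auto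
    fix D c A s assume D: "contD D" "small_near n D c A" and s: "s \<in> rcell"
    have "\<bar>poly (solve (F D c)) s\<bar> \<le> (\<Sum>j\<le>k. \<bar>F D c (monom 1 j) * poly (\<xi> j) s\<bar>)"
      unfolding poly_solve by (rule sum_abs)
    also have "\<dots> \<le> (\<Sum>j\<le>k. K j * A * m j)"
      unfolding abs_mult using K(2)[OF D] m(2)[OF s]
      by (intro sum_mono mult_mono) (auto intro: order_trans[OF abs_ge_zero])
    also have "\<dots> = (\<Sum>j\<le>k. K j * m j) * A" unfolding sum_distrib_right by (simp add: mult_ac)
    finally show "\<bar>poly (solve (F D c)) s\<bar> \<le> (\<Sum>j\<le>k. K j * m j) * A" .
  qed
  moreover have "poly (solve (F (\<lambda>j y. D j y + D' j y) c)) = (\<lambda>s. poly (solve (F D c)) s + poly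
      (solve (F D' c)) s)"
    if "contD D" "contD D'" for D D' c
    unfolding poly_solve locfunD(1)[OF F that] by (simp add: distrib_right sum.distrib
        poly_solve[abs_def])
  moreover have "poly (solve (F (\<lambda>j y. \<alpha> * D j y) c)) = (\<lambda>s. \<alpha> * poly (solve (F D c)) s)"
    if "contD D" for D \<alpha> c
    by (rule ext) (simp add: poly_solve locfunD(2)[OF F that] sum_distrib_left mult.assoc)
  moreover have "solve (F (\<lambda>j y. D j (y + d)) c) = solve (F D (c + d))" if "contD D" for D c d
    unfolding solve_def locfunD(3)[OF F that] ..
  ultimately show ?thesis unfolding locmap_def by (simp add: continuous_intros)
qed

lemma locmap_diff:
  assumes G: "locmap n G" and H: "locmap n H"
  shows "locmap n (\<lambda>D c s. G D c s - H D c s)"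
proof -
  obtain K where K: "K \<ge> 0" "\<forall>D c A. contD D \<longrightarrow> small_near n D c A \<longrightarrow> (\<forall>s\<in>rcell. \<bar>G D c s\<bar> \<le> K * A)"
    using locmapD(5)[OF G] by blast
  obtain K' where K': "K' \<ge> 0" "\<forall>D c A. contD D \<longrightarrow> small_near n D c A \<longrightarrow> (\<forall>s\<in>rcell. \<bar>H D c s\<bar> \<le> K' * A)"
    using locmapD(5)[OF H] by blast
  have "\<exists>K\<ge>0. \<forall>D c A. contD D \<longrightarrow> small_near n D c A \<longrightarrow> (\<forall>s\<in>rcell. \<bar>G D c s - H D c s\<bar> \<le> K * A)"
  proof (intro exI[of _ "K + K'"] conjI allI impI ballI)
    fix D c A s assume "contD D" "small_near n D c A" "s \<in> rcell"
    then have "\<bar>G D c s\<bar> \<le> K * A" "\<bar>H D c s\<bar> \<le> K' * A" using K K' by auto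
    then show "\<bar>G D c s - H D c s\<bar> \<le> (K + K') * A" unfolding distrib_right by linarith
  qed (use K K' in auto)
  moreover have "continuous_on rcell (\<lambda>s. G D c s - H D c s)" if "contD D" for D c
    by (intro continuous_on_diff locmapD(1)[OF G that] locmapD(1)[OF H that])
  ultimately show ?thesis unfolding locmap_def
    by (simp add: locmapD(2-4)[OF G] locmapD(2-4)[OF H] right_diff_distrib fun_eq_iff)
qed

lemma locfun_corrF:
  assumes H: "locmap n H" shows "locfun (Suc n) (\<lambda>D c. corrF H D c q)"
proof -
  note ip = locfun_shiftD[OF locfun_cellfun[OF H cellfun_ip]]
  note fl = locfun_cellfun[OF H cellfun_flux_left] and fr = locfun_cellfun[OF H cellfun_flux_right]
  show ?thesis
    unfolding corrF_def
    using locfun_translate[OF fl, of "-1/2"] locfun_translate[OF fr, of "1/2"]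
    by (intro locfun_add locfun_diff ip locfun_mono[OF fl] locfun_mono[OF fr]) auto
qed

lemma locmap_Rcor: "locmap l (Rcor l)"
proof (induction l)
  case 0
  have c: "continuous_on rcell (\<lambda>s. D 0 (c + s))" if "contD D" for D c
    using that continuous_on_translate[of "D 0" rcell c] unfolding contD_def by (simp add: add.commute)
  have id: "locmap 0 (\<lambda>D c s. D 0 (c + s))"
    unfolding locmap_def
    by (auto simp: c small_near_def add_ac rcell_abs intro!: exI[of _ 1])
  have "locfun 0 (\<lambda>D c. ip (poly q) 1 * ip (\<lambda>s. D 0 (c + s)) 1 - pform C q (\<lambda>s. D 0 (c + s)))" for q
    by (intro locfun_diff locfun_cmult locfun_cellfun[OF id] cellfun_pform cellfun_ip)
  then have "locfun 0 (\<lambda>D c. projF (\<lambda>s. D 0 (c + s)) q)" for q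
    by (simp add: projF_def mult.commute)
  from locmap_diff[OF id locmap_solve[OF this]] show ?case by simp
next
  case (Suc l)
  show ?case unfolding Rcor.simps by (rule locmap_solve) (rule locfun_corrF[OF Suc])
qed

end

text \<open>With test functions of degree at most 2 all weights in the fluxes are quadratic, so each
  half cell is seen through three moments only.\<close>

lemma half_cell_moments:
  fixes f :: "real \<Rightarrow> real"
  assumes f: "continuous_on rcell f" and "-1/2 \<le> \<alpha>" "\<beta> \<le> 1/2"
    and w: "\<And>y. w y = a0 + a1 * y + a2 * y\<^sup>2"
  shows "integral {\<alpha>..\<beta>} (\<lambda>y. f y * w y) = a0 * integral {\<alpha>..\<beta>} f
     + a1 * integral {\<alpha>..\<beta>} (\<lambda>y. f y * y) + a2 * integral {\<alpha>..\<beta>} (\<lambda>y. f y * y\<^sup>2)"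
proof -
  have i: "(\<lambda>y. f y * 1) integrable_on {\<alpha>..\<beta>}" "(\<lambda>y. f y * y) integrable_on {\<alpha>..\<beta>}" "(\<lambda>y. f y * y\<^sup>2)
      integrable_on {\<alpha>..\<beta>}"
    by (rule integrable_mult_cell[OF f assms(2,3)]; intro continuous_intros)+
  then have i0: "f integrable_on {\<alpha>..\<beta>}" by simp
  have "((\<lambda>y. a0 * f y + a1 * (f y * y) + a2 * (f y * y\<^sup>2)) has_integral
     (a0 * integral {\<alpha>..\<beta>} f + a1 * integral {\<alpha>..\<beta>} (\<lambda>y. f y * y) + a2 * integral {\<alpha>..\<beta>}
         (\<lambda>y. f y * y\<^sup>2))) {\<alpha>..\<beta>}"
    by (intro has_integral_add has_integral_mult_right integrable_integral i i0)
  moreover have "(\<lambda>y. a0 * f y + a1 * (f y * y) + a2 * (f y * y\<^sup>2)) = (\<lambda>y. f y * w y)"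
    by (rule ext) (simp add: w algebra_simps)
  ultimately show ?thesis by (simp add: integral_unique)
qed

lemma ip_split_halves:
  assumes "continuous_on rcell f"
  shows "ip f \<phi> = integral {-1/2..0} (\<lambda>s. f s * poly \<phi> s) + integral {0..1/2} (\<lambda>s. f s * poly \<phi> s)"
  unfolding ip_def
  by (rule Henstock_Kurzweil_Integration.integral_combine[symmetric])
    (auto intro!: integrable_mult_cell assms continuous_intros)

text \<open>Testing with \<open>x\<close> controls the flux that drives the cell averages; \<open>x\<^sup>2\<close> does so one order
  higher.\<close>

lemma
  fixes f :: "real \<Rightarrow> real" and C :: real
  assumes f: "continuous_on rcell f" and mean: "ip f 1 = 0" and C: "C > 0"
  shows pform_X: "pform C [:0, 1:] f = flux_right C 1 f"
    and pform_X2: "pform C [:0, 0, 1:] f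
      = 2 * ip f [:0, 1:] - flux_left C [:0, 1:] f + flux_right C [:0, 1:] f"
proof -
  \<comment> \<open>Both claims are linear identities between these six moments and f 0, subject to
    the single relation R0 = - L0.\<close>
  define L0 where "L0 = integral {-1/2..0} f"
  define L1 where "L1 = integral {-1/2..0} (\<lambda>y. f y * y)"
  define L2 where "L2 = integral {-1/2..0} (\<lambda>y. f y * y\<^sup>2)"
  define R0 where "R0 = integral {0..1/2} f"
  define R1 where "R1 = integral {0..1/2} (\<lambda>y. f y * y)"
  define R2 where "R2 = integral {0..1/2} (\<lambda>y. f y * y\<^sup>2)"
  note defs = L0_def[symmetric] L1_def[symmetric] L2_def[symmetric] R0_def[symmetric]
      R1_def[symmetric] R2_def[symmetric]
  have L: "integral {-1/2..0} (\<lambda>y. f y * w y) = a0 * L0 + a1 * L1 + a2 * L2" if "\<And>y. w y = a0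
      + a1 * y + a2 * y\<^sup>2" for w a0 a1 a2
    using half_cell_moments[OF f _ _ that, of "-1/2" 0] unfolding defs by simp
  have R: "integral {0..1/2} (\<lambda>y. f y * w y) = a0 * R0 + a1 * R1 + a2 * R2" if "\<And>y. w y = a0
      + a1 * y + a2 * y\<^sup>2" for w a0 a1 a2
    using half_cell_moments[OF f _ _ that, of 0 "1/2"] unfolding defs by simp
  have m: "R0 = - L0" using mean unfolding ip_split_halves[OF f] by (simp add: L0_def R0_def)
  have X: "poly [:0, 1:] y = y" "poly (pderiv [:0, 1:]) y = 1" "poly [:0, 0, 1:] y = y\<^sup>2" "poly
      (pderiv [:0, 0, 1:]) y = 2 * y" for y :: real
    by (simp_all add: pderiv_pCons power2_eq_square)
  have ip1: "ip f [:0, 1:] = L1 + R1"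
    unfolding ip_split_halves[OF f] X defs ..
  have ip2: "ip f [:0, 0, 1:] = L2 + R2"
    unfolding ip_split_halves[OF f] X defs ..
  have fl1: "flux_left C [:0, 1:] f = (1 - 1/(2*C)) * R0 + R1 / C - f 0 / 2"
    unfolding flux_left_def X by (subst R[of _ "1 - 1/(2*C)" "1/C" 0])
        (use C in \<open>auto simp: field_simps\<close>)
  have fr1: "flux_right C [:0, 1:] f = (1 + 1/(2*C)) * L0 + L1 / C - f 0 / 2"
    unfolding flux_right_def X by (subst L[of _ "1 + 1/(2*C)" "1/C" 0])
        (use C in \<open>auto simp: field_simps\<close>)
  have fl2: "flux_left C [:0, 0, 1:] f = (1/(4*C) - 1) * R0 + (2 - 1/C) * R1 + R2 / C + f 0 / 4"
    unfolding flux_left_def X by (subst R[of _ "1/(4*C) - 1" "2 - 1/C" "1/C"])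
        (use C in \<open>auto simp: field_simps power2_eq_square\<close>)
  have fr2: "flux_right C [:0, 0, 1:] f = (1/(4*C) + 1) * L0 + (2 + 1/C) * L1 + L2 / C - f 0 / 4"
    unfolding flux_right_def X by (subst L[of _ "1/(4*C) + 1" "2 + 1/C" "1/C"])
        (use C in \<open>auto simp: field_simps power2_eq_square\<close>)
  have fr0: "flux_right C 1 f = L0 / C - f 0"
    unfolding flux_right_def by (subst L[of _ "1/C" 0 0]) (auto simp: pderiv_1)
  show "pform C [:0, 1:] f = flux_right C 1 f"
    unfolding pform_def fl1 fr1 fr0 ip1 m using C by (simp add: field_simps)
  show "pform C [:0, 0, 1:] f = 2 * ip f [:0, 1:] - flux_left C [:0, 1:] f + flux_right C [:0, 1:] f"
    unfolding pform_def fl1 fr1 fl2 fr2 ip1 ip2 m using C by (simp add: field_simps)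
qed

lemma ip_1_1: "ip (poly 1) 1 = 1" by (simp add: ip_def)

section \<open>Consistency of the corrections: telescoping, exactness on polynomials, residual
  bound\<close>

context cdg_cell
begin

declare Rcor.simps [simp del]

lemma continuous_Rcor: "contD D \<Longrightarrow> continuous_on rcell (Rcor l D c)"
  by (rule locmapD(1)[OF locmap_Rcor])

lemma continuous_D0: "contD D \<Longrightarrow> continuous_on rcell (\<lambda>s. D 0 (c + s))"
  using continuous_on_translate[of "D 0" rcell c] unfolding contD_def by (simp add: add.commute)

lemma plin_projF: "continuous_on rcell f \<Longrightarrow> plin (projF f)"
  unfolding projF_def[abs_def] by (intro plin_minus' plin_cmult plin_cellfun_poly cellfun_ip plin_pform)

lemma plin_corrF: "contD D \<Longrightarrow> plin (corrF (Rcor l) D c)"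
  unfolding corrF_def[abs_def]
  by (intro plin_plus plin_minus' plin_ip plin_flux_left plin_flux_right continuous_Rcor contD_shiftD)

lemma mean0_add: "mean0 (p + q) = mean0 p + mean0 q"
  using plin_add[OF plin_cellfun_poly[OF cellfun_ip]] by (simp add: mean0_def)

lemma mean0_smult: "mean0 (smult c p) = smult c (mean0 p)"
  using plin_smult[OF plin_cellfun_poly[OF cellfun_ip]] by (simp add: mean0_def smult_diff_right)

lemma plin_mean0: "plin F \<Longrightarrow> plin (\<lambda>q. F (mean0 q))"
  by (rule plinI) (simp_all add: mean0_add mean0_smult plin_add plin_smult)

lemma mean0_1: "mean0 1 = 0" unfolding mean0_def ip_1_1 by (simp add: one_pCons)

lemma mean0_id: "ip (poly q) 1 = 0 \<Longrightarrow> mean0 q = q" by (simp add: mean0_def)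

lemma ip_const: "ip (poly [:c:]) 1 = c" by (simp add: ip_def)

lemma ip_mean0: "ip (poly (mean0 q)) 1 = 0"
  unfolding mean0_def by (simp only: plin_diff[OF plin_cellfun_poly[OF cellfun_ip]] ip_const)

lemma degree_mean0: "degree q \<le> k \<Longrightarrow> degree (mean0 q) \<le> k"
  unfolding mean0_def by (rule degree_diff_le) auto

text \<open>Testing with 1 isolates the mean, because \<open>pform\<close> annihilates constants.
  Once the means agree, they cancel from \<open>aform\<close> and only \<open>pform\<close> is
  left.\<close>

lemma Rcor0_mean_pform:
  assumes D: "contD D"
  shows "ip (Rcor 0 D c) 1 = 0" "degree q \<le> k \<Longrightarrow> pform C q (Rcor 0 D c) = 0"
proof -
  let ?f = "\<lambda>s. D 0 (c + s)"
  let ?p = "solve (projF ?f)"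
  note f = continuous_D0[OF D, of c] and P = plin_projF[OF continuous_D0[OF D, of c]]
  have c: "continuous_on rcell (poly ?p)" by (intro continuous_intros)
  have m: "ip (poly ?p) 1 = ip ?f 1"
    using aform_solve[OF P, of 1] by (simp add: aform_def projF_def ip_1_1 pform_1[OF f] pform_1[OF c])
  show "ip (Rcor 0 D c) 1 = 0" using m cellfun_diff[OF cellfun_ip f c, of 1] by (simp add: Rcor.simps)
  assume "degree q \<le> k"
  then have "pform C q (poly ?p) = pform C q ?f"
    using aform_solve[OF P, of q] m by (simp add: aform_def projF_def)
  then show "pform C q (Rcor 0 D c) = 0" using cellfun_diff[OF cellfun_pform f c, of C q] by
      (simp add: Rcor.simps)
qed

lemma RcorSuc_mean_pform:
  assumes D: "contD D"
  shows "ip (Rcor (Suc l) D c) 1 = 0"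
    "degree q \<le> k \<Longrightarrow> ip (poly q) 1 = 0 \<Longrightarrow> pform C q (Rcor (Suc l) D c) = - corrF (Rcor l) D c q"
proof -
  let ?p = "solve (\<lambda>q. corrF (Rcor l) D c (mean0 q))"
  note P = plin_mean0[OF plin_corrF[OF D, of l c]]
  have c: "continuous_on rcell (poly ?p)" by (intro continuous_intros)
  show m: "ip (Rcor (Suc l) D c) 1 = 0"
    using aform_solve[OF P, of 1] by (simp add: Rcor.simps aform_def ip_1_1 pform_1[OF c] mean0_1
        plin_0[OF plin_corrF[OF D]])
  show "pform C q (Rcor (Suc l) D c) = - corrF (Rcor l) D c q" if "degree q \<le> k" "ip (poly q) 1 = 0"
    using aform_solve[OF P that(1)] m that(2) by (simp add: Rcor.simps aform_def mean0_id)
qed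

lemma Rcor_mean: "contD D \<Longrightarrow> ip (Rcor l D c) 1 = 0"
  using Rcor0_mean_pform(1) RcorSuc_mean_pform(1) by (cases l) blast+

lemma locfun_flux_right_Rcor: "locfun l (\<lambda>D c. flux_right C \<phi> (Rcor l D c))"
  and locfun_flux_left_Rcor: "locfun l (\<lambda>D c. flux_left C \<phi> (Rcor l D c))"
  by (rule locfun_cellfun[OF locmap_Rcor cellfun_flux_right] locfun_cellfun[OF locmap_Rcor
      cellfun_flux_left])+

lemma Rcor_dpoly_translate:
  assumes "\<And>c s. s \<in> rcell \<Longrightarrow> Rcor l (dpoly (pderiv p)) c s = 0" "s \<in> rcell"
  shows "Rcor l (dpoly p) (c + d) s = Rcor l (dpoly p) c s"
  using locfun_dpoly_const[OF locfun_eval[OF locmap_Rcor assms(2)], of l p 0 c d] assms by simp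

text \<open>If \<open>R^l\<close> kills the derivative of p, then \<open>R^l\<close> of p is the
  same for all centres, so neighbours and cell carry equal data and the flux differences
  cancel.\<close>

lemma corrF_dpoly:
  assumes "\<And>c s. s \<in> rcell \<Longrightarrow> Rcor l (dpoly (pderiv p)) c s = 0"
  shows "corrF (Rcor l) (dpoly p) c q = 0"
proof -
  have "flux_left C q (Rcor l (dpoly p) (c + -1/2)) = flux_left C q (Rcor l (dpoly p) c)"
    by (rule cellfun_cong[OF cellfun_flux_left continuous_Rcor[OF contD_dpoly]])
        (rule Rcor_dpoly_translate[OF assms])
  moreover have "flux_right C q (Rcor l (dpoly p) (c + 1/2)) = flux_right C q (Rcor l (dpoly p) c)"
    by (rule cellfun_cong[OF cellfun_flux_right continuous_Rcor[OF contD_dpoly]])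
        (rule Rcor_dpoly_translate[OF assms])
  moreover have "ip (Rcor l (dpoly (pderiv p)) c) q = 0"
    by (rule cellfun_eq_0[OF cellfun_ip]) (rule assms)
  ultimately show ?thesis by (simp add: corrF_def shiftD_dpoly)
qed

text \<open>The projection reproduces degree k. Each further level sees p only through
  \<open>corrF\<close>, which vanishes as soon as the previous level kills the derivative of p, and
  so gains one degree.\<close>

lemma Rcor_dpoly_zero:
  assumes "degree p \<le> k + l" "s \<in> rcell" shows "Rcor l (dpoly p) c s = 0"
  using assms
proof (induction l arbitrary: p c s)
  case 0
  define r where "r = pcompose p [:c, 1:]"
  have f: "(\<lambda>s. dpoly p 0 (c + s)) = poly r" by (auto simp: dpoly_def r_def poly_pcompose)
  have "r = solve (projF (poly r))"
  proof (rule solve_unique)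
    show "degree r \<le> k" using 0 unfolding r_def by (simp add: degree_pcompose)
  qed (auto intro!: plin_projF continuous_intros simp: projF_def aform_def)
  then show ?case unfolding Rcor.simps f by simp (metis f)
next
  case (Suc l)
  have "corrF (Rcor l) (dpoly p) c q = 0" for q
    by (rule corrF_dpoly, rule Suc.IH) (use Suc.prems in \<open>auto simp: degree_pderiv\<close>)
  then show ?case by (simp add: Rcor.simps poly_solve)
qed

text \<open>The share of \<open>R^l\<close> in the consistency error: \<partial>_t
  \<open>R^l\<close> u is minus \<open>R^l\<close> of \<partial>_x u, which gives the first term,
  and the others are the form of the method applied to \<open>R^l\<close> u.\<close>

definition resid :: "nat \<Rightarrow> (nat \<Rightarrow> real \<Rightarrow> real) \<Rightarrow> real \<Rightarrow> real poly \<Rightarrow> real" where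
  "resid l D c \<phi> = ip (Rcor l (shiftD D) c) \<phi> + flux_left C \<phi> (Rcor l D (c - 1/2))
     + flux_right C \<phi> (Rcor l D (c + 1/2)) - ip (Rcor l D c) \<phi> / C"

lemma resid_eq: "resid l D c \<phi> = pform C \<phi> (Rcor l D c) + corrF (Rcor l) D c \<phi>"
  by (simp add: resid_def pform_def corrF_def)

lemma plin_resid: "contD D \<Longrightarrow> plin (resid l D c)"
  unfolding resid_eq[abs_def] by (intro plin_plus plin_pform plin_corrF continuous_Rcor)

lemma locfun_resid: "locfun (Suc l) (\<lambda>D c. resid l D c \<phi>)"
  unfolding resid_eq
  by (intro locfun_add locfun_corrF locmap_Rcor locfun_mono[OF locfun_cellfun[OF locmap_Rcor
      cellfun_pform]]) auto

text \<open>By \<open>resid_eq\<close> each summand is \<open>pform\<close> plus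
  \<open>corrF\<close>. The \<open>pform\<close> part of level 0 vanishes and that of level l + 1
  cancels the \<open>corrF\<close> part of level l, so the last \<open>corrF\<close>
  survives.\<close>

lemma sum_resid:
  assumes "contD D" "degree \<phi> \<le> k" "ip (poly \<phi>) 1 = 0"
  shows "(\<Sum>l\<le>m. resid l D c \<phi>) = corrF (Rcor m) D c \<phi>"
proof (induction m)
  case 0 then show ?case using Rcor0_mean_pform(2)[OF assms(1,2)] by (simp add: resid_eq)
next
  case (Suc m) then show ?case using RcorSuc_mean_pform(2)[OF assms] by (simp add: resid_eq)
qed

lemma flux_left_1: "continuous_on rcell f \<Longrightarrow> ip f 1 = 0 \<Longrightarrow> flux_left C 1 f = - flux_right C 1 f"
  using pform_1[of f C] by (simp add: pform_def)

text \<open>Conservation: zero mean removes both inner products and makes the left flux the negative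
  of the right one.\<close>

lemma resid_1:
  assumes "contD D"
  shows "resid l D c 1 = flux_right C 1 (Rcor l D (c + 1/2)) - flux_right C 1 (Rcor l D (c - 1/2))"
  using assms by (simp add: resid_def Rcor_mean contD_shiftD flux_left_1 continuous_Rcor)

text \<open>By \<open>pform_X\<close> this flux is the projection error tested with x, which is
  admissible since k \<ge> 1.\<close>

lemma flux_right_Rcor0: "contD D \<Longrightarrow> flux_right C 1 (Rcor 0 D c) = 0"
  using pform_X[OF continuous_Rcor Rcor_mean C, of D 0 c] Rcor0_mean_pform(2)[of D "[:0, 1:]" c] k
      by simp

lemma ip_X: "ip (poly [:0, 1:]) 1 = 0"
proof -
  have "((\<lambda>y::real. y) has_integral ((1/2)\<^sup>2 / 2 - (-1/2)\<^sup>2 / 2)) {-1/2..1/2}"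
    by (rule fundamental_theorem_of_calculus)
      (auto intro!: derivative_eq_intros simp: has_real_derivative_iff_has_vector_derivative[symmetric])
  then show ?thesis by (simp add: ip_def integral_unique)
qed

text \<open>The flux is \<open>pform\<close> tested with x, hence minus \<open>corrF\<close> of
  level 0. Since the projection is exact on the second derivative of p, shifts by half a cell are
  exactly linear, and \<open>corrF\<close> becomes half the right-hand side of
  \<open>pform_X2\<close> for the derivative of p. That is the projection error tested with x^2,
  which vanishes because k \<ge> 2.\<close>

lemma flux_right_Rcor1_dpoly:
  assumes "k \<ge> 2" "degree p \<le> k + 2"
  shows "flux_right C 1 (Rcor 1 (dpoly p) c) = 0"
proof -
  let ?X = "[:0, 1:] :: real poly" and ?f = "Rcor 0 (dpoly (pderiv p)) c"
  note D = contD_dpoly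
  have z: "Rcor 0 (dpoly (pderiv (pderiv p))) c s = 0" if "s \<in> rcell" for c s
    by (rule Rcor_dpoly_zero[OF _ that]) (use assms in \<open>simp add: degree_pderiv\<close>)
  have "Rcor 0 (dpoly (pderiv p)) (c + d) s = ?f s" if "s \<in> rcell" for d s
    by (rule Rcor_dpoly_translate[OF z that])
  then have tr: "Rcor 0 (dpoly (pderiv p)) c' s = ?f s" if "s \<in> rcell" for c' s
    using that by (metis add.commute diff_add_cancel)
  have l: "flux_left C ?X (Rcor 0 (dpoly p) (c + -1/2)) = flux_left C ?X (Rcor 0 (dpoly p) c)
      + -1/2 * flux_left C ?X ?f"
    by (rule locfun_dpoly_const[OF locfun_flux_left_Rcor], rule cellfun_cong[OF cellfun_flux_left
        continuous_Rcor[OF D]]) (rule tr)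
  have r: "flux_right C ?X (Rcor 0 (dpoly p) (c + 1/2)) = flux_right C ?X (Rcor 0 (dpoly p) c)
      + 1/2 * flux_right C ?X ?f"
    by (rule locfun_dpoly_const[OF locfun_flux_right_Rcor], rule cellfun_cong[OF cellfun_flux_right
        continuous_Rcor[OF D]]) (rule tr)
  have "flux_right C 1 (Rcor 1 (dpoly p) c) = pform C ?X (Rcor (Suc 0) (dpoly p) c)"
    using pform_X[OF continuous_Rcor Rcor_mean C, OF D D] by simp
  also have "\<dots> = - corrF (Rcor 0) (dpoly p) c ?X"
    by (rule RcorSuc_mean_pform(2)[OF D]) (use k ip_X in auto)
  also have "corrF (Rcor 0) (dpoly p) c ?X = (2 * ip ?f ?X - flux_left C ?X ?f + flux_right C ?X ?f) / 2"
    using l r by (simp add: corrF_def shiftD_dpoly)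
  also have "2 * ip ?f ?X - flux_left C ?X ?f + flux_right C ?X ?f = pform C [:0, 0, 1:] ?f"
    by (rule pform_X2[OF continuous_Rcor[OF D] Rcor_mean[OF D] C, symmetric])
  also have "\<dots> = 0" by (rule Rcor0_mean_pform(2)[OF D]) (use assms in simp)
  finally show ?thesis by simp
qed

definition lmax :: nat where "lmax = min k 2"
text \<open>In terms of \<open>lmax\<close> this is k + lmax + 1.\<close>

definition conv_order :: nat where "conv_order = min (2 * k + 1) (k + 3)"

text \<open>Here degree p \<le> k + lmax, so level \<open>lmax\<close> vanishes altogether. Of the
  lower levels only 0, and 1 in the case k \<ge> 2, remain, and their fluxes were computed
  above.\<close>

lemma flux_right_Rcor_dpoly:
  assumes "l \<le> lmax" "degree p < conv_order" shows "flux_right C 1 (Rcor l (dpoly p) c) = 0"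
proof -
  consider "l = 0" | "l = 1" "k \<ge> 2" | "degree p \<le> k + l"
    using assms k unfolding lmax_def conv_order_def by linarith
  then show ?thesis
  proof cases
    case 1 then show ?thesis using flux_right_Rcor0[OF contD_dpoly] by simp
  next
    case 2 then show ?thesis using flux_right_Rcor1_dpoly[of p c] assms by (simp add: conv_order_def)
  next
    case 3 then show ?thesis by (intro cellfun_eq_0[OF cellfun_flux_right] Rcor_dpoly_zero)
  qed
qed

text \<open>The test splits into its zero-mean part, where the sum telescopes to the last
  \<open>corrF\<close> and degrees are counted, and its mean, where every level vanishes
  separately.\<close>

lemma sum_resid_dpoly:
  assumes T: "degree p \<le> conv_order" and \<phi>: "degree \<phi> \<le> k"
  shows "(\<Sum>l\<le>lmax. resid l (dpoly p) c \<phi>) = 0"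
proof -
  have dp: "degree (pderiv p) < conv_order" using T k by (cases "degree p = 0")
      (auto simp: degree_pderiv conv_order_def)
  \<comment> \<open>The derivative of p has degree below \<open>conv_order\<close>, so its flux is 0
    and the flux of p does not depend on the centre. Taking the flux difference thus gains one
    degree.\<close>
  have 1: "resid l (dpoly p) c 1 = 0" if "l \<le> lmax" for l
  proof -
    have "flux_right C 1 (Rcor l (dpoly p) (c' + d)) = flux_right C 1 (Rcor l (dpoly p) c') + d * 0"
        for c' d
      by (rule locfun_dpoly_const[OF locfun_flux_right_Rcor]) (rule flux_right_Rcor_dpoly[OF that dp])
    from this[of "c - 1/2" 1] show ?thesis unfolding resid_1[OF contD_dpoly] by (simp add: add.commute)
  qed
  have "corrF (Rcor lmax) (dpoly p) c (mean0 \<phi>) = 0"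
    by (rule corrF_dpoly, rule Rcor_dpoly_zero) (use T k in \<open>auto simp: degree_pderiv conv_order_def
        lmax_def\<close>)
  then have 2: "(\<Sum>l\<le>lmax. resid l (dpoly p) c (mean0 \<phi>)) = 0"
    using sum_resid[OF contD_dpoly degree_mean0[OF \<phi>] ip_mean0] by simp
  have "\<phi> = mean0 \<phi> + smult (ip (poly \<phi>) 1) 1" by (simp add: mean0_def)
  then have "resid l (dpoly p) c \<phi> = resid l (dpoly p) c (mean0 \<phi>) + ip (poly \<phi>) 1 * resid l
      (dpoly p) c 1" for l
    by (metis plin_add[OF plin_resid[OF contD_dpoly]] plin_smult[OF plin_resid[OF contD_dpoly]])
  then show ?thesis using 1 2 by (simp add: sum.distrib)
qed

lemma ip_self_nonneg: "0 \<le> ip (poly q) q"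
  unfolding ip_def by (rule integral_nonneg) (auto intro!: integrable_continuous_interval
      continuous_intros)

lemma ip_self_definite:
  assumes "ip (poly q) q = 0" shows "q = 0"
proof -
  have "\<forall>s\<in>{-1/2..1/2}. poly q s * poly q s = 0"
    by (subst integral_eq_0_iff[symmetric]) (use assms in \<open>auto simp: ip_def intro!: continuous_intros\<close>)
  then show ?thesis by (intro poly_eq_0_on_interval[of "-1/2" "1/2"]) auto
qed

lemma ip_Cauchy_Schwarz: "\<bar>ip (poly p) q\<bar> \<le> sqrt (ip (poly p) p) * sqrt (ip (poly q) q)"
proof -
  have "(ip (poly p) q)\<^sup>2 \<le> ip (poly p) p * ip (poly q) q"
    using L2_Cauchy_Schwarz[of "poly p" "-1/2" "1/2" "poly q"] L2_continuous[OF continuous_on_poly']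
    by (simp add: ip_def power2_eq_square)
  then show ?thesis unfolding real_sqrt_mult[symmetric] by (rule real_le_rsqrt[of "\<bar>_\<bar>", simplified])
qed

lemma coeff_le_L2:
  obtains N where "\<And>j. N j \<ge> 0" "\<And>q j. degree q \<le> k \<Longrightarrow> \<bar>coeff q j\<bar> \<le> N j * sqrt (ip (poly q) q)"
proof -
  have "\<exists>\<kappa>. \<forall>j. degree (\<kappa> j) \<le> k \<and> (\<forall>q. degree q \<le> k \<longrightarrow> ip (poly (\<kappa> j)) q = coeff q j)"
    by (rule dual_basis_exists[OF plin_cellfun_poly[OF cellfun_ip] plin_ip])
      (auto intro: ip_self_definite continuous_on_poly')
  then obtain \<kappa> where \<kappa>: "\<And>j q. degree q \<le> k \<Longrightarrow> ip (poly (\<kappa> j)) q = coeff q j" by blast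
  show ?thesis
  proof
    show "0 \<le> sqrt (ip (poly (\<kappa> j)) (\<kappa> j))" for j using ip_self_nonneg by simp
    show "\<bar>coeff q j\<bar> \<le> sqrt (ip (poly (\<kappa> j)) (\<kappa> j)) * sqrt (ip (poly q) q)" if "degree q \<le> k" for q j
      using ip_Cauchy_Schwarz[of "\<kappa> j" q] \<kappa>[OF that] by simp
  qed
qed

text \<open>Integrating from c costs a factor H per order, and H \<ge> 1 permits the common factor H
  ^ n.\<close>

lemma taylor_decay:
  fixes W :: "nat \<Rightarrow> real \<Rightarrow> real"
  assumes W: "\<And>j y. j < n \<Longrightarrow> (W j has_real_derivative W (Suc j) y) (at y)"
    and W0: "\<And>j. j < n \<Longrightarrow> W j c = 0" and A: "A \<ge> 0"
    and Wn: "\<And>y. \<bar>y - c\<bar> \<le> H \<Longrightarrow> \<bar>W n y\<bar> \<le> A" and H: "H \<ge> 1"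
    and j: "j \<le> n" and y: "\<bar>y - c\<bar> \<le> H"
  shows "\<bar>W j y\<bar> \<le> H ^ n * A"
proof -
  have "\<forall>y. \<bar>y - c\<bar> \<le> H \<longrightarrow> \<bar>W j y\<bar> \<le> H ^ (n - j) * A"
  proof (rule inc_induct[OF j])
    show "\<forall>y. \<bar>y - c\<bar> \<le> H \<longrightarrow> \<bar>W n y\<bar> \<le> H ^ (n - n) * A" using Wn by simp
    fix i assume i: "i < n" and IH: "\<forall>y. \<bar>y - c\<bar> \<le> H \<longrightarrow> \<bar>W (Suc i) y\<bar> \<le> H ^ (n - Suc i) * A"
    show "\<forall>y. \<bar>y - c\<bar> \<le> H \<longrightarrow> \<bar>W i y\<bar> \<le> H ^ (n - i) * A"
    proof (intro allI impI)
      fix y assume y: "\<bar>y - c\<bar> \<le> H"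
      have "norm (W i y - W i c) \<le> H ^ (n - Suc i) * A * norm (y - c)"
      proof (rule field_differentiable_bound[of "{c - H..c + H}" _ "W (Suc i)"])
        fix z assume "z \<in> {c - H..c + H}"
        then have "\<bar>z - c\<bar> \<le> H" by auto
        then show "norm (W (Suc i) z) \<le> H ^ (n - Suc i) * A" using IH by auto
      qed (use y H in \<open>auto intro: has_field_derivative_at_within[OF W[OF i]]\<close>)
      also have "\<dots> \<le> H ^ (n - Suc i) * A * H" using y A H by (intro mult_left_mono) auto
      also have "\<dots> = H ^ (n - i) * A" using i by (simp add: power_Suc[symmetric] Suc_diff_Suc
          mult_ac del: power_Suc)
      finally show "\<bar>W i y\<bar> \<le> H ^ (n - i) * A" using W0[OF i] by simp
    qed
  qed
  then have "\<bar>W j y\<bar> \<le> H ^ (n - j) * A" using y by blast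
  also have "\<dots> \<le> H ^ n * A" using H A by (intro mult_right_mono power_increasing) auto
  finally show ?thesis .
qed

text \<open>A Bramble-Hilbert argument. The Taylor polynomial p of degree \<open>conv_order\<close>
  at c contributes nothing, and the remainder is governed by the oscillation of the top derivative
  near c, as the top derivative of p is the constant D conv_order c. The radius 4 covers the reach
  Suc lmax + 1 of the functionals. The test is expanded in monomials, with coefficients bounded by
  its L^2 norm.\<close>

lemma residual_bound:
  obtains K where "K \<ge> 0"
    "\<And>D c A \<phi>. contD D \<Longrightarrow> (\<And>j y. j < conv_order \<Longrightarrow> (D j has_real_derivative D (Suc j) y) (at y)) \<Longrightarrow>
      (\<And>y. \<bar>y - c\<bar> \<le> 4 \<Longrightarrow> \<bar>D conv_order y - D conv_order c\<bar> \<le> A) \<Longrightarrow> degree \<phi> \<le> k \<Longrightarrow>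
      \<bar>\<Sum>l\<le>lmax. resid l D c \<phi>\<bar> \<le> K * A * sqrt (ip (poly \<phi>) \<phi>)"
proof -
  define \<Phi> where "\<Phi> j D c = (\<Sum>l\<le>lmax. resid l D c (monom 1 j))" for j D c
  have \<Phi>: "locfun (Suc lmax) (\<Phi> j)" for j
    unfolding \<Phi>_def[abs_def] by (intro locfun_sum locfun_mono[OF locfun_resid]) auto
  have "\<forall>j. \<exists>K. K \<ge> 0 \<and> (\<forall>D c A. contD D \<longrightarrow> small_near (Suc lmax) D c A \<longrightarrow> \<bar>\<Phi> j D c\<bar> \<le> K * A)"
    using locfunD(4)[OF \<Phi>] by blast
  from choice[OF this] obtain K where K: "\<And>j. K j \<ge> 0"
    "\<And>j D c A. contD D \<Longrightarrow> small_near (Suc lmax) D c A \<Longrightarrow> \<bar>\<Phi> j D c\<bar> \<le> K j * A" by blast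
  obtain N where N: "\<And>j. N j \<ge> 0" "\<And>q j. degree q \<le> k \<Longrightarrow> \<bar>coeff q j\<bar> \<le> N j * sqrt (ip (poly q) q)"
    using coeff_le_L2 by blast
  define K' where "K' = (\<Sum>j\<le>k. N j * (K j * 4 ^ conv_order))"
  show ?thesis
  proof
    show "K' \<ge> 0" unfolding K'_def using K N by (intro sum_nonneg) auto
    fix D :: "nat \<Rightarrow> real \<Rightarrow> real" and c A and \<phi> :: "real poly"
    assume D: "contD D" and deriv: "\<And>j y. j < conv_order \<Longrightarrow> (D j has_real_derivative D (Suc j) y) (at y)"
      and osc: "\<And>y. \<bar>y - c\<bar> \<le> 4 \<Longrightarrow> \<bar>D conv_order y - D conv_order c\<bar> \<le> A" and \<phi>: "degree \<phi> \<le> k"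
    have A: "A \<ge> 0" using osc[of c] by simp
    obtain p where p: "degree p \<le> conv_order" "\<And>j. j \<le> conv_order \<Longrightarrow> dpoly p j c = D j c"
      using taylor_poly_exists[of conv_order c "\<lambda>j. D j c"] by blast
    have "degree ((pderiv ^^ conv_order) p) = 0" using p(1) by (simp add: degree_higher_pderiv)
    then obtain m where "(pderiv ^^ conv_order) p = [:m:]" by (metis degree_eq_zeroE)
    then have dn: "dpoly p conv_order y = D conv_order c" for y using p(2)[of conv_order] by
        (simp add: dpoly_def)
    define W where "W j y = D j y - dpoly p j y" for j y
    have W: "contD W" unfolding W_def[abs_def] by (intro contD_diff D contD_dpoly)
    have small: "\<bar>W j y\<bar> \<le> 4 ^ conv_order * A" if "j \<le> conv_order" "\<bar>y - c\<bar> \<le> 4" for j y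
    proof (rule taylor_decay[OF _ _ A _ _ that])
      show "(W j has_real_derivative W (Suc j) y) (at y)" if "j < conv_order" for j y
        unfolding W_def[abs_def] by (intro DERIV_diff deriv[OF that] dpoly_has_derivative)
    qed (use p osc dn in \<open>auto simp: W_def\<close>)
    have "small_near (Suc lmax) W c (4 ^ conv_order * A)"
      unfolding small_near_def
    proof (intro allI impI)
      fix j y assume "j \<le> Suc lmax" "\<bar>y - c\<bar> \<le> real (Suc lmax) + 1"
      moreover have "Suc lmax \<le> conv_order" "real lmax \<le> 2" using k by
          (auto simp: lmax_def conv_order_def)
      ultimately show "\<bar>W j y\<bar> \<le> 4 ^ conv_order * A" by (intro small) auto
    qed
    then have WB: "\<bar>\<Phi> j W c\<bar> \<le> K j * (4 ^ conv_order * A)" for j by (rule K(2)[OF W])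
    have DW: "\<Phi> j D c = \<Phi> j W c" if "j \<le> k" for j
    proof -
      have "\<Phi> j W c = \<Phi> j D c - \<Phi> j (dpoly p) c"
        unfolding W_def[abs_def] by (rule locfun_minus[OF \<Phi> D contD_dpoly])
      moreover have "\<Phi> j (dpoly p) c = 0"
        unfolding \<Phi>_def by (rule sum_resid_dpoly[OF p(1)]) (use that in \<open>auto intro: order_trans[OF
            degree_monom_le]\<close>)
      ultimately show ?thesis by simp
    qed
    have "(\<Sum>l\<le>lmax. resid l D c \<phi>) = (\<Sum>l\<le>lmax. \<Sum>j\<le>k. coeff \<phi> j * resid l D c (monom 1 j))"
      by (intro sum.cong refl plin_expand[OF plin_resid[OF D] \<phi>])
    also have "\<dots> = (\<Sum>j\<le>k. coeff \<phi> j * \<Phi> j D c)"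
      unfolding \<Phi>_def sum_distrib_left by (rule sum.swap)
    finally have "\<bar>\<Sum>l\<le>lmax. resid l D c \<phi>\<bar> \<le> (\<Sum>j\<le>k. \<bar>coeff \<phi> j * \<Phi> j D c\<bar>)" by (simp add: sum_abs)
    also have "\<dots> \<le> (\<Sum>j\<le>k. (N j * sqrt (ip (poly \<phi>) \<phi>)) * (K j * (4 ^ conv_order * A)))"
      unfolding abs_mult using N K WB DW A ip_self_nonneg[of \<phi>]
      by (intro sum_mono mult_mono N(2)[OF \<phi>]) auto
    also have "\<dots> = K' * A * sqrt (ip (poly \<phi>) \<phi>)"
      unfolding K'_def sum_distrib_right by (simp add: mult_ac)
    finally show "\<bar>\<Sum>l\<le>lmax. resid l D c \<phi>\<bar> \<le> K' * A * sqrt (ip (poly \<phi>) \<phi>)" .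
  qed
qed

end

text \<open>The half-open range matches the right-continuous representatives: neighbouring cells do
  not compete for their common end point, and the centre s = 0, where fluxes are evaluated, is
  included.\<close>

definition cellrep :: "real \<Rightarrow> real \<Rightarrow> (real \<Rightarrow> real) \<Rightarrow> (real \<Rightarrow> real) \<Rightarrow> bool" where
  "cellrep h c f F \<longleftrightarrow> (\<forall>s. -1/2 \<le> s \<longrightarrow> s < 1/2 \<longrightarrow> f (c + h * s) = F s)"

lemma cellrepD: "cellrep h c f F \<Longrightarrow> -1/2 \<le> s \<Longrightarrow> s < 1/2 \<Longrightarrow> f (c + h * s) = F s"
  by (simp add: cellrep_def)

text \<open>Equality in the open interval suffices, so jumps of piecewise polynomials at the ends of
  a cell are harmless.\<close>

lemma has_integral_cell:
  fixes f G :: "real \<Rightarrow> real"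
  assumes h: "h > 0" and G: "(G has_integral I) {\<alpha>..\<beta>}"
    and eq: "\<And>s. \<alpha> < s \<Longrightarrow> s < \<beta> \<Longrightarrow> f (c + h * s) = G s"
  shows "(f has_integral h * I) {c + h * \<alpha>..c + h * \<beta>}"
proof -
  have 1: "((\<lambda>x. G ((1/h) *\<^sub>R x + - c / h)) has_integral (I /\<^sub>R (1/h) ^ DIM(real)))
           (cbox ((\<alpha> - - c / h) /\<^sub>R (1/h)) ((\<beta> - - c / h) /\<^sub>R (1/h)))"
    by (rule has_integral_affinity') (use G h in auto)
  have e: "(\<alpha> - - c / h) /\<^sub>R (1/h) = c + h * \<alpha>" "(\<beta> - - c / h) /\<^sub>R (1/h) = c + h * \<beta>" "I /\<^sub>R
      (1/h) ^ DIM(real) = h * I"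
    using h by (auto simp: field_simps)
  have "(f has_integral h * I) (cbox (c + h * \<alpha>) (c + h * \<beta>))"
  proof (rule has_integral_spike_interior[OF 1[unfolded e]])
    fix x assume "x \<in> box (c + h * \<alpha>) (c + h * \<beta>)"
    then have "\<alpha> < (x - c) / h" "(x - c) / h < \<beta>" using h by (auto simp: field_simps)
    moreover have "c + h * ((x - c) / h) = x" "(1/h) *\<^sub>R x + - c / h = (x - c) / h"
      using h by (simp, simp add: diff_divide_distrib)
    ultimately show "f x = G ((1/h) *\<^sub>R x + - c / h)" using eq by metis
  qed
  then show ?thesis by simp
qed

lemma cellrep_near:
  assumes h: "h > 0" and \<phi>: "cellrep h c \<phi> (poly q)" and x: "c - h/2 < x" "x < c + h/2"
  shows "\<phi> x = poly q ((x - c) / h)"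
  using cellrepD[OF \<phi>, of "(x - c) / h"] h x by (simp add: field_simps)

lemma cellrep_deriv:
  assumes h: "h > 0" and \<phi>: "cellrep h c \<phi> (poly q)" and s: "-1/2 < s" "s < 1/2"
  shows "deriv \<phi> (c + h * s) = poly (pderiv q) s / h"
proof (rule DERIV_imp_deriv)
  have "h * (-1/2) < h * s" "h * s < h * (1/2)" using s h by (intro mult_strict_left_mono; simp)+
  then have x: "c + h * s \<in> {c - h/2<..<c + h/2}" by auto
  have "((\<lambda>x. poly q ((x - c) / h)) has_field_derivative poly (pderiv q) s / h) (at (c + h * s))"
    using h by (auto intro!: derivative_eq_intros DERIV_chain2[OF poly_DERIV] simp: field_simps)
  then show "(\<phi> has_field_derivative poly (pderiv q) s / h) (at (c + h * s))"
    by (rule has_field_derivative_transform_within_open[OF _ open_greaterThanLessThan x])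
      (use cellrep_near[OF h \<phi>] in auto)
qed

lemma cellrep_traces:
  assumes h: "h > 0" and \<phi>: "cellrep h c \<phi> (poly q)"
  shows "trace_left \<phi> (c + h/2) = poly q (1/2)" "trace_right \<phi> (c - h/2) = poly q (-1/2)"
proof -
  have lim: "((\<lambda>x. poly q ((x - c) / h)) \<longlongrightarrow> poly q ((y - c) / h)) (at y within S)" for y S
    using h by (intro tendsto_intros) auto
  have e: "(c + h/2 - c) / h = 1/2" "(c - h/2 - c) / h = -1/2" using h by auto
  have "(\<phi> \<longlongrightarrow> poly q (1/2)) (at_left (c + h/2))"
  proof (rule Lim_transform_eventually[OF lim[of "c + h/2" "{..<c + h/2}", unfolded e]])
    show "\<forall>\<^sub>F x in at_left (c + h/2). poly q ((x - c) / h) = \<phi> x"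
      unfolding eventually_at_left_field using cellrep_near[OF h \<phi>] h by (intro exI[of _ c]) auto
  qed
  then show "trace_left \<phi> (c + h/2) = poly q (1/2)" by (intro tendsto_Lim) auto
  have "(\<phi> \<longlongrightarrow> poly q (-1/2)) (at_right (c - h/2))"
  proof (rule Lim_transform_eventually[OF lim[of "c - h/2" "{c - h/2<..}", unfolded e]])
    show "\<forall>\<^sub>F x in at_right (c - h/2). poly q ((x - c) / h) = \<phi> x"
      unfolding eventually_at_right_field using cellrep_near[OF h \<phi>] h by (intro exI[of _ c]) auto
  qed
  then show "trace_right \<phi> (c - h/2) = poly q (-1/2)" by (intro tendsto_Lim) auto
qed

lemma integral_shift_cell:
  fixes f w :: "real \<Rightarrow> real"
  assumes "continuous_on {a + d..b + d} f" "continuous_on {a + d..b + d} (\<lambda>y. w (y - d))"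
  shows "integral {a..b} (\<lambda>s. f (s + d) * w s) = integral {a + d..b + d} (\<lambda>y. f y * w (y - d))"
  using integral_shift[of a d b "\<lambda>y. f y * w (y - d)"] assms by (simp add: o_def continuous_on_mult)

lemma flux_left_eq:
  assumes "continuous_on rcell f"
  shows "flux_left C q f = integral {0..1/2} (\<lambda>y. f y * poly q (y - 1/2)) / C
    + integral {0..1/2} (\<lambda>y. f y * poly (pderiv q) (y - 1/2)) + f 0 * poly q (-1/2)"
proof -
  have i: "(\<lambda>y. f y * poly q (y - 1/2)) integrable_on {0..1/2}" "(\<lambda>y. f y * poly (pderiv q)
      (y - 1/2)) integrable_on {0..1/2}"
    by (rule integrable_mult_cell[OF assms]; (intro continuous_intros)?; simp)+
  have "((\<lambda>y. 1/C * (f y * poly q (y - 1/2)) + f y * poly (pderiv q) (y - 1/2)) has_integral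
     (1/C * integral {0..1/2} (\<lambda>y. f y * poly q (y - 1/2)) + integral {0..1/2} (\<lambda>y. f y * poly
         (pderiv q) (y - 1/2)))) {0..1/2}"
    by (intro has_integral_add has_integral_mult_right integrable_integral i)
  moreover have "(\<lambda>y. 1/C * (f y * poly q (y - 1/2)) + f y * poly (pderiv q) (y - 1/2))
     = (\<lambda>y. f y * (poly q (y - 1/2) / C + poly (pderiv q) (y - 1/2)))" by (rule ext)
         (simp add: distrib_left)
  ultimately show ?thesis unfolding flux_left_def by (simp add: integral_unique)
qed

lemma flux_right_eq:
  assumes "continuous_on rcell f"
  shows "flux_right C q f = integral {-1/2..0} (\<lambda>y. f y * poly q (y + 1/2)) / C
    + integral {-1/2..0} (\<lambda>y. f y * poly (pderiv q) (y + 1/2)) - f 0 * poly q (1/2)"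
proof -
  have i: "(\<lambda>y. f y * poly q (y + 1/2)) integrable_on {-1/2..0}" "(\<lambda>y. f y * poly (pderiv q) (y
      + 1/2)) integrable_on {-1/2..0}"
    by (rule integrable_mult_cell[OF assms]; (intro continuous_intros)?; simp)+
  have "((\<lambda>y. 1/C * (f y * poly q (y + 1/2)) + f y * poly (pderiv q) (y + 1/2)) has_integral
     (1/C * integral {-1/2..0} (\<lambda>y. f y * poly q (y + 1/2)) + integral {-1/2..0} (\<lambda>y. f y * poly
         (pderiv q) (y + 1/2)))) {-1/2..0}"
    by (intro has_integral_add has_integral_mult_right integrable_integral i)
  moreover have "(\<lambda>y. 1/C * (f y * poly q (y + 1/2)) + f y * poly (pderiv q) (y + 1/2))
     = (\<lambda>y. f y * (poly q (y + 1/2) / C + poly (pderiv q) (y + 1/2)))" by (rule ext)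
         (simp add: distrib_left)
  ultimately show ?thesis unfolding flux_right_def by (simp add: integral_unique)
qed

text \<open>Serves both forms: gl and gr are the other component in \<open>cdg_form\<close> and the
  shifted copies of \<omega> in \<open>proj_form\<close>. In the last two integrals the factor h of
  the substitution cancels against 1 / h from the derivative of \<phi>.\<close>

lemma half_cell_has_integral:
  fixes gl gr own \<phi> :: "real \<Rightarrow> real"
  assumes h: "h > 0" and cont: "continuous_on rcell F0" "continuous_on rcell FL" "continuous_on rcell FR"
    and gl: "\<forall>s. -1/2 < s \<longrightarrow> s < 0 \<longrightarrow> gl (c + h * s) = FL (s + 1/2)"
    and gr: "\<forall>s. 0 < s \<longrightarrow> s < 1/2 \<longrightarrow> gr (c + h * s) = FR (s - 1/2)"
    and own: "cellrep h c own F0" and \<phi>: "cellrep h c \<phi> (poly q)"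
  shows
    "((\<lambda>x. (gl x - own x) * \<phi> x) has_integral h * (integral {0..1/2} (\<lambda>y. FL y * poly q (y - 1/2))
       - integral {-1/2..0} (\<lambda>s. F0 s * poly q s))) {c - h/2..c}"
    "((\<lambda>x. (gr x - own x) * \<phi> x) has_integral h * (integral {-1/2..0} (\<lambda>y. FR y * poly q (y + 1/2))
       - integral {0..1/2} (\<lambda>s. F0 s * poly q s))) {c..c + h/2}"
    "((\<lambda>x. gl x * deriv \<phi> x) has_integral integral {0..1/2} (\<lambda>y. FL y * poly (pderiv q)
        (y - 1/2))) {c - h/2..c}"
    "((\<lambda>x. gr x * deriv \<phi> x) has_integral integral {-1/2..0} (\<lambda>y. FR y * poly (pderiv q) (y
        + 1/2))) {c..c + h/2}"
proof -
  have sub: "{0..1/2} \<subseteq> rcell" "{-1/2..0} \<subseteq> rcell" by (auto simp: rcell_def)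
  have L: "((\<lambda>s. FL (s + 1/2) * poly p s) has_integral integral {0..1/2} (\<lambda>y. FL y * poly p
      (y - 1/2))) {-1/2..0}" for p
  proof -
    have "(\<lambda>s. FL (s + 1/2) * poly p s) integrable_on {-1/2..0}"
      by (intro integrable_continuous_interval continuous_on_mult continuous_on_poly'
          continuous_on_compose2[OF cont(2)] continuous_intros)
        (auto simp: rcell_def)
    moreover have "integral {-1/2..0} (\<lambda>s. FL (s + 1/2) * poly p s) = integral {0..1/2}
        (\<lambda>y. FL y * poly p (y - 1/2))"
      using integral_shift_cell[of "-1/2" "1/2" 0 FL "poly p"] continuous_on_subset[OF cont(2) sub(1)]
      by (simp add: continuous_intros)
    ultimately show ?thesis by (simp only: has_integral_integrable_integral)
  qed
  have R: "((\<lambda>s. FR (s - 1/2) * poly p s) has_integral integral {-1/2..0} (\<lambda>y. FR y * poly p (y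
      + 1/2))) {0..1/2}" for p
  proof -
    have "(\<lambda>s. FR (s - 1/2) * poly p s) integrable_on {0..1/2}"
      by (intro integrable_continuous_interval continuous_on_mult continuous_on_poly'
          continuous_on_compose2[OF cont(3)] continuous_intros)
        (auto simp: rcell_def)
    moreover have "integral {0..1/2} (\<lambda>s. FR (s - 1/2) * poly p s) = integral {-1/2..0}
        (\<lambda>y. FR y * poly p (y + 1/2))"
      using integral_shift_cell[of 0 "-1/2" "1/2" FR "poly p"] continuous_on_subset[OF cont(3) sub(2)]
      by (simp add: continuous_intros)
    ultimately show ?thesis by (simp only: has_integral_integrable_integral)
  qed
  have O: "(\<lambda>s. F0 s * poly q s) integrable_on {-1/2..0}" "(\<lambda>s. F0 s * poly q s) integrable_on {0..1/2}"
    by (rule integrable_mult_cell[OF cont(1)]; (intro continuous_intros)?; simp)+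
  have ends: "c + h * (-1/2) = c - h/2" "c + h * 0 = c" "c + h * (1/2) = c + h/2" by auto
  note oD = cellrepD[OF own] and pD = cellrepD[OF \<phi>]
  have "((\<lambda>x. (gl x - own x) * \<phi> x) has_integral h * (integral {0..1/2} (\<lambda>y. FL y * poly q (y - 1/2))
       - integral {-1/2..0} (\<lambda>s. F0 s * poly q s))) {c + h * (-1/2)..c + h * 0}"
    by (rule has_integral_cell[OF h has_integral_diff[OF L[of q] integrable_integral[OF O(1)]]])
      (simp add: gl oD pD left_diff_distrib)
  then show "((\<lambda>x. (gl x - own x) * \<phi> x) has_integral h * (integral {0..1/2} (\<lambda>y. FL y * poly q
      (y - 1/2))
       - integral {-1/2..0} (\<lambda>s. F0 s * poly q s))) {c - h/2..c}" unfolding ends .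
  have "((\<lambda>x. (gr x - own x) * \<phi> x) has_integral h * (integral {-1/2..0} (\<lambda>y. FR y * poly q (y + 1/2))
       - integral {0..1/2} (\<lambda>s. F0 s * poly q s))) {c + h * 0..c + h * (1/2)}"
    by (rule has_integral_cell[OF h has_integral_diff[OF R[of q] integrable_integral[OF O(2)]]])
      (simp add: gr oD pD left_diff_distrib)
  then show "((\<lambda>x. (gr x - own x) * \<phi> x) has_integral h * (integral {-1/2..0} (\<lambda>y. FR y * poly q (y
      + 1/2))
       - integral {0..1/2} (\<lambda>s. F0 s * poly q s))) {c..c + h/2}" unfolding ends .
  have "((\<lambda>x. gl x * deriv \<phi> x) has_integral h * (1/h * integral {0..1/2} (\<lambda>y. FL y * poly
      (pderiv q) (y - 1/2)))) {c + h * (-1/2)..c + h * 0}"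
    by (rule has_integral_cell[OF h has_integral_mult_right[OF L[of "pderiv q"], of "1/h"]])
      (simp add: gl cellrep_deriv[OF h \<phi>])
  then show "((\<lambda>x. gl x * deriv \<phi> x) has_integral integral {0..1/2} (\<lambda>y. FL y * poly (pderiv q)
      (y - 1/2))) {c - h/2..c}"
    unfolding ends using h by simp
  have "((\<lambda>x. gr x * deriv \<phi> x) has_integral h * (1/h * integral {-1/2..0} (\<lambda>y. FR y * poly
      (pderiv q) (y + 1/2)))) {c + h * 0..c + h * (1/2)}"
    by (rule has_integral_cell[OF h has_integral_mult_right[OF R[of "pderiv q"], of "1/h"]])
      (simp add: gr cellrep_deriv[OF h \<phi>])
  then show "((\<lambda>x. gr x * deriv \<phi> x) has_integral integral {-1/2..0} (\<lambda>y. FR y * poly (pderiv q) (y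
      + 1/2))) {c..c + h/2}"
    unfolding ends using h by simp
qed

lemma cdg_form_eq:
  assumes h: "h > 0" and C: "C > 0" and cont: "continuous_on rcell F0" "continuous_on rcell FL"
      "continuous_on rcell FR"
    and own: "cellrep h c own F0" and L: "cellrep h (c - h/2) oth FL" and R: "cellrep h (c + h/2) oth FR"
    and \<phi>: "cellrep h c \<phi> (poly q)"
  shows "cdg_form C h c own oth \<phi> = flux_left C q FL + flux_right C q FR - ip F0 q / C"
proof -
  have l: "\<forall>s. -1/2 < s \<longrightarrow> s < 0 \<longrightarrow> oth (c + h * s) = FL (s + 1/2)"
  proof (intro allI impI)
    fix s :: real assume "-1/2 < s" "s < 0"
    then show "oth (c + h * s) = FL (s + 1/2)" using cellrepD[OF L, of "s + 1/2"] by
        (simp add: algebra_simps)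
  qed
  have r: "\<forall>s. 0 < s \<longrightarrow> s < 1/2 \<longrightarrow> oth (c + h * s) = FR (s - 1/2)"
  proof (intro allI impI)
    fix s :: real assume "0 < s" "s < 1/2"
    then show "oth (c + h * s) = FR (s - 1/2)" using cellrepD[OF R, of "s - 1/2"] by
        (simp add: algebra_simps)
  qed
  have o: "oth (c + h/2) = FR 0" "oth (c - h/2) = FL 0" using cellrepD[OF R, of 0] cellrepD[OF L, of
      0] by auto
  note I = half_cell_has_integral[where gl = oth and gr = oth, OF h cont l r own \<phi>]
  have cl: "c - h/2 \<le> c" "c \<le> c + h/2" using h by auto
  note e = integral_unique[OF has_integral_combine[OF cl I(1,2)]] integral_unique[OF
      has_integral_combine[OF cl I(3,4)]]
  have a: "1 / (C * h) * (h * X + h * Y) = (X + Y) / C" for X Y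
    using h C by (simp add: field_simps)
  show ?thesis
    unfolding cdg_form_def cell_def e a cellrep_traces[OF h \<phi>] o
      flux_left_eq[OF cont(2)] flux_right_eq[OF cont(3)] ip_split_halves[OF cont(1)]
    by (simp add: add_divide_distrib diff_divide_distrib)
qed

lemma proj_form_eq:
  assumes h: "h > 0" and C: "C > 0" and F: "continuous_on rcell F"
    and \<omega>: "cellrep h c \<omega> F" and \<phi>: "cellrep h c \<phi> (poly q)"
  shows "proj_form C h c \<omega> \<phi> = pform C q F"
proof -
  have l: "\<forall>s. -1/2 < s \<longrightarrow> s < 0 \<longrightarrow> \<omega> (c + h * s + h/2) = F (s + 1/2)"
  proof (intro allI impI)
    fix s :: real assume "-1/2 < s" "s < 0"
    then show "\<omega> (c + h * s + h/2) = F (s + 1/2)" using cellrepD[OF \<omega>, of "s + 1/2"] by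
        (simp add: algebra_simps)
  qed
  have r: "\<forall>s. 0 < s \<longrightarrow> s < 1/2 \<longrightarrow> \<omega> (c + h * s - h/2) = F (s - 1/2)"
  proof (intro allI impI)
    fix s :: real assume "0 < s" "s < 1/2"
    then show "\<omega> (c + h * s - h/2) = F (s - 1/2)" using cellrepD[OF \<omega>, of "s - 1/2"] by
        (simp add: algebra_simps)
  qed
  have o: "\<omega> c = F 0" using cellrepD[OF \<omega>, of 0] by auto
  note I = half_cell_has_integral[where gl = "\<lambda>x. \<omega> (x + h/2)" and gr = "\<lambda>x. \<omega>
      (x - h/2)", OF h F F F l r \<omega> \<phi>]
  have a: "1 / (C * h) * (h * X + h * Y) = (X + Y) / C" for X Y
    using h C by (simp add: field_simps)
  show ?thesis
    unfolding proj_form_def I[THEN integral_unique] a cellrep_traces[OF h \<phi>] o pform_def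
      flux_left_eq[OF F] flux_right_eq[OF F] ip_split_halves[OF F]
    by (simp add: add_divide_distrib diff_divide_distrib right_diff_distrib)
qed

lemma cell_has_integral:
  assumes h: "h > 0" and F: "continuous_on rcell F" and f: "cellrep h c f F" and \<phi>: "cellrep h c \<phi>
      (poly q)"
  shows "((\<lambda>x. f x * \<phi> x) has_integral h * ip F q) (cell h c)"
proof -
  have "((\<lambda>s. F s * poly q s) has_integral ip F q) {-1/2..1/2}"
    unfolding ip_def by (rule integrable_integral, rule integrable_mult_cell[OF F])
        (auto intro: continuous_intros)
  from has_integral_cell[OF h this, of "\<lambda>x. f x * \<phi> x" c] cellrepD[OF f] cellrepD[OF \<phi>]
  show ?thesis by (simp add: cell_def)
qed

lemma cell_integral_mean:
  assumes h: "h > 0" and F: "continuous_on rcell F" and f: "cellrep h c f F"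
  shows "integral (cell h c) f = h * ip F 1"
  using integral_unique[OF cell_has_integral[OF h F f, of "\<lambda>_. 1" 1]] by (simp add: cellrep_def)

section \<open>Piecewise polynomials\<close>

locale cdg_mesh = cdg_cell +
  fixes h L :: real and N :: nat
  assumes h: "h > 0" and N: "N \<ge> 1" and L: "L = real N * h"
begin

definition ctr :: "real \<Rightarrow> int \<Rightarrow> real" where "ctr c0 i = c0 + of_int i * h"

definition pwf :: "real \<Rightarrow> (int \<Rightarrow> real poly) \<Rightarrow> real \<Rightarrow> real" where
  "pwf c0 P x = (let i = \<lfloor>(x - c0) / h + 1/2\<rfloor> in poly (P i) ((x - ctr c0 i) / h))"

lemma cell_exists:
  obtains i s where "x = ctr c0 i + h * s" "-1/2 \<le> s" "s < 1/2"
proof -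
  define i where "i = \<lfloor>(x - c0) / h + 1/2\<rfloor>"
  define s where "s = (x - ctr c0 i) / h"
  have s: "s = (x - c0) / h - of_int i" using h by (simp add: s_def ctr_def field_simps)
  show ?thesis
  proof
    show "x = ctr c0 i + h * s" using h by (simp add: s_def)
    show "-1/2 \<le> s" "s < 1/2" unfolding s i_def by linarith+
  qed
qed

lemma cellrep_pwf: "cellrep h (ctr c0 i) (pwf c0 P) (poly (P i))"
  unfolding cellrep_def
proof (intro allI impI)
  fix s :: real assume s: "-1/2 \<le> s" "s < 1/2"
  have "(ctr c0 i + h * s - c0) / h + 1/2 = of_int i + (s + 1/2)" using h by
      (simp add: ctr_def field_simps)
  then have "\<lfloor>(ctr c0 i + h * s - c0) / h + 1/2\<rfloor> = i" using s by (simp add: floor_unique)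
  then show "pwf c0 P (ctr c0 i + h * s) = poly (P i) s" using h by (simp add: pwf_def)
qed

lemma ctr_add_N: "ctr c0 (i + int N) = ctr c0 i + L"
  by (simp add: ctr_def L algebra_simps)

lemma pwf_in_pw_poly:
  assumes "\<And>i. degree (P i) \<le> k" "\<And>i. P (i + int N) = P i"
  shows "pwf c0 P \<in> pw_poly k L h (ctr c0)"
proof -
  have "pwf c0 P (x + L) = pwf c0 P x" for x
  proof -
    obtain i s where x: "x = ctr c0 i + h * s" "-1/2 \<le> s" "s < 1/2" using cell_exists by blast
    have "x + L = ctr c0 (i + int N) + h * s" using x by (simp add: ctr_add_N)
    then show ?thesis using cellrepD[OF cellrep_pwf[of c0 "i + int N" P] x(2,3)] cellrepD[OF
        cellrep_pwf[of c0 i P] x(2,3)]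
      \<open>x + L = _\<close> x(1) assms(2) by (simp only:)
  qed
  moreover have "\<exists>p. degree p \<le> k \<and> (\<forall>x\<in>{ctr c0 i - h/2..<ctr c0 i + h/2}. pwf c0 P x = poly p x)" for i
  proof (intro exI[of _ "pcompose (P i) [:- ctr c0 i / h, 1/h:]"] conjI ballI)
    show "degree (pcompose (P i) [:- ctr c0 i / h, 1/h:]) \<le> k" using assms(1)[of i] h by
        (simp add: degree_pcompose)
    fix x assume x: "x \<in> {ctr c0 i - h/2..<ctr c0 i + h/2}"
    have "ctr c0 i + h * ((x - ctr c0 i) / h) = x" using h by simp
    then have "pwf c0 P x = poly (P i) ((x - ctr c0 i) / h)"
      using cellrepD[OF cellrep_pwf[of c0 i P], of "(x - ctr c0 i) / h"] x h by (simp add: field_simps)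
    then show "pwf c0 P x = poly (pcompose (P i) [:- ctr c0 i / h, 1/h:]) x"
      by (simp add: poly_pcompose diff_divide_distrib)
  qed
  ultimately show ?thesis by (simp add: pw_poly_def periodic_def)
qed

lemma pw_poly_cellrep:
  assumes "f \<in> pw_poly k L h (ctr c0)"
  obtains p where "degree p \<le> k" "cellrep h (ctr c0 i) f (poly p)"
proof -
  obtain p where p: "degree p \<le> k" "\<forall>x\<in>{ctr c0 i - h/2..<ctr c0 i + h/2}. f x = poly p x"
    using assms unfolding pw_poly_def by blast
  show ?thesis
  proof
    show "degree (pcompose p [:ctr c0 i, h:]) \<le> k" using p(1) h by (simp add: degree_pcompose)
    show "cellrep h (ctr c0 i) f (poly (pcompose p [:ctr c0 i, h:]))"
      unfolding cellrep_def poly_pcompose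
    proof (intro allI impI)
      fix s :: real assume s: "- 1/2 \<le> s" "s < 1/2"
      have "h * (-1/2) \<le> h * s" using s h by (intro mult_left_mono) auto
      moreover have "h * s < h * (1/2)" using s h by (intro mult_strict_left_mono) auto
      ultimately have "ctr c0 i + h * s \<in> {ctr c0 i - h/2..<ctr c0 i + h/2}" by auto
      then show "f (ctr c0 i + h * s) = poly p (poly [:ctr c0 i, h:] s)" using p(2) by
          (simp add: mult.commute)
    qed
  qed
qed

lemma cellrep_poly: "cellrep h c (poly q) (poly (pcompose q [:c, h:]))"
  by (simp add: cellrep_def poly_pcompose mult.commute)

lemma cellrep_ext:
  assumes "\<And>i. cellrep h (ctr c0 i) f (F i)" "\<And>i. cellrep h (ctr c0 i) g (F i)"
  shows "f = g"
proof
  fix x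
  obtain i s where "x = ctr c0 i + h * s" "-1/2 \<le> s" "s < 1/2" using cell_exists by blast
  then show "f x = g x" using cellrepD[OF assms(1)] cellrepD[OF assms(2)] by metis
qed

text \<open>Resolves the \<open>THE\<close> in the projection. Equal means and equal
  \<open>pform\<close> on a cell together say that \<open>aform\<close> agrees with
  \<open>projF\<close>, which has exactly one solution of degree at most k; existence glues these
  cell by cell.\<close>

lemma cdg_proj_eq:
  assumes u: "continuous_on UNIV u" "periodic L u"
  shows "cellrep h (ctr c0 i) (cdg_proj k L C h (ctr c0) u) (poly (solve (projF (\<lambda>s. u (ctr c0 i
      + h * s)))))"
proof -
  define U where "U i s = u (ctr c0 i + h * s)" for i s
  define P where "P i = solve (projF (U i))" for i
  have Uc: "continuous_on rcell (U i)" for i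
    unfolding U_def by (rule continuous_on_compose2[OF u(1)]) (auto intro!: continuous_intros)
  have Urep: "cellrep h (ctr c0 i) u (U i)" for i by (simp add: cellrep_def U_def)
  have Pc: "continuous_on rcell (poly (P i))" for i by (rule continuous_on_poly')
  have Pa: "aform (P i) q = projF (U i) q" if "degree q \<le> k" for i q
    unfolding P_def by (rule aform_solve[OF plin_projF[OF Uc] that])
  have Pm: "ip (poly (P i)) 1 = ip (U i) 1" for i
    using Pa[of 1 i] by (simp add: aform_def projF_def ip_1_1 pform_1[OF Pc] pform_1[OF Uc])
  have Pp: "pform C q (poly (P i)) = pform C q (U i)" if "degree q \<le> k" for i q
    using Pa[OF that, of i] Pm[of i] by (simp add: aform_def projF_def)
  have "cdg_proj k L C h (ctr c0) u = pwf c0 P"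
    unfolding cdg_proj_def
  proof (rule the_equality)
    show "pwf c0 P \<in> pw_poly k L h (ctr c0) \<and>
      (\<forall>i. integral (cell h (ctr c0 i)) (pwf c0 P) = integral (cell h (ctr c0 i)) u \<and>
        (\<forall>q. degree q \<le> k \<longrightarrow> proj_form C h (ctr c0 i) (pwf c0 P) (poly q) = proj_form C h
            (ctr c0 i) u (poly q)))"
    proof (intro conjI allI impI)
      show "pwf c0 P \<in> pw_poly k L h (ctr c0)"
      proof (rule pwf_in_pw_poly)
        show "degree (P i) \<le> k" for i unfolding P_def by (rule degree_solve)
        have "U (i + int N) = U i" for i
        proof
          fix s
          have "ctr c0 (i + int N) + h * s = (ctr c0 i + h * s) + L" by (simp add: ctr_add_N)
          then show "U (i + int N) s = U i s" using u(2) unfolding U_def periodic_def by (simp only:)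
        qed
        then show "P (i + int N) = P i" for i by (simp add: P_def)
      qed
      fix i
      show "integral (cell h (ctr c0 i)) (pwf c0 P) = integral (cell h (ctr c0 i)) u"
        unfolding cell_integral_mean[OF h Pc cellrep_pwf] cell_integral_mean[OF h Uc Urep] Pm ..
      fix q :: "real poly" assume "degree q \<le> k"
      then have "degree (pcompose q [:ctr c0 i, h:]) \<le> k" using h by (simp add: degree_pcompose)
      then show "proj_form C h (ctr c0 i) (pwf c0 P) (poly q) = proj_form C h (ctr c0 i) u (poly q)"
        unfolding proj_form_eq[OF h C Pc cellrep_pwf cellrep_poly] proj_form_eq[OF h C Uc Urep
            cellrep_poly]
        by (rule Pp)
    qed
  next
    fix g assume g: "g \<in> pw_poly k L h (ctr c0) \<and>
      (\<forall>i. integral (cell h (ctr c0 i)) g = integral (cell h (ctr c0 i)) u \<and>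
        (\<forall>q. degree q \<le> k \<longrightarrow> proj_form C h (ctr c0 i) g (poly q) = proj_form C h (ctr c0 i) u (poly q)))"
    have "cellrep h (ctr c0 i) g (poly (P i))" for i
    proof -
      obtain p where p: "degree p \<le> k" "cellrep h (ctr c0 i) g (poly p)" using pw_poly_cellrep g by blast
      have pc: "continuous_on rcell (poly p)" by (rule continuous_on_poly')
      have "h * ip (poly p) 1 = h * ip (U i) 1"
        using g unfolding cell_integral_mean[OF h pc p(2), symmetric] cell_integral_mean[OF h Uc
            Urep, symmetric] by blast
      then have m: "ip (poly p) 1 = ip (U i) 1" using h by simp
      have "pform C q (poly p) = pform C q (U i)" if q: "degree q \<le> k" for q
      proof -
        \<comment> \<open>The definition tests with polynomials in the global variable, so q is
          pulled back to it.\<close>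
        define q' where "q' = pcompose q [:- ctr c0 i / h, 1/h:]"
        have "degree q' \<le> k" using q h by (simp add: q'_def degree_pcompose)
        moreover have "pcompose q' [:ctr c0 i, h:] = q"
          by (rule poly_eq_poly_eq_iff[THEN iffD1], rule ext)
              (use h in \<open>simp add: q'_def poly_pcompose field_simps\<close>)
        ultimately show ?thesis
          using g proj_form_eq[OF h C pc p(2) cellrep_poly, of q'] proj_form_eq[OF h C Uc Urep
              cellrep_poly, of i q'] by auto
      qed
      then have "p = P i" unfolding P_def
        by (intro solve_unique[OF plin_projF[OF Uc] p(1)]) (simp add: aform_def projF_def m)
      then show ?thesis using p(2) by simp
    qed
    then show "g = pwf c0 P" by (rule cellrep_ext) (rule cellrep_pwf)
  qed
  then show ?thesis using cellrep_pwf[of c0 i P] by (simp add: P_def U_def[abs_def])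
qed

text \<open>Resolves the \<open>THE\<close> in the correction step. The factor 1 / h in front of
  \<open>Rcor l (shiftD D)\<close> appears because \<open>shiftD\<close> stands for h \<partial>_x,
  and it cancels against the length of the cell.\<close>

lemma corr_step_eq:
  assumes D: "contD D" and per: "\<And>j y. D j (y + real N) = D j y"
    and d: "\<And>i. cellrep h (ctr c0 i) d (\<lambda>s. 1 / h * Rcor l (shiftD D) (ctr c0 i / h) s)"
    and own: "\<And>i. cellrep h (ctr c0 i) own (Rcor l D (ctr c0 i / h))"
    and othL: "\<And>i. cellrep h (ctr c0 i - h/2) oth (Rcor l D (ctr c0 i / h - 1/2))"
    and othR: "\<And>i. cellrep h (ctr c0 i + h/2) oth (Rcor l D (ctr c0 i / h + 1/2))"
  shows "cellrep h (ctr c0 i) (corr_step k L C h (ctr c0) d own oth) (Rcor (Suc l) D (ctr c0 i / h))"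
proof -
  define P where "P i = solve (\<lambda>q. corrF (Rcor l) D (ctr c0 i / h) (mean0 q))" for i
  have Ec: "continuous_on rcell (Rcor l D c)" for c by (rule continuous_Rcor[OF D])
  have dc: "continuous_on rcell (\<lambda>s. 1 / h * Rcor l (shiftD D) c s)" for c
    by (intro continuous_intros continuous_Rcor contD_shiftD D)
  have Pc: "continuous_on rcell (poly (P i))" for i by (rule continuous_on_poly')
  have PE: "poly (P i) = Rcor (Suc l) D (ctr c0 i / h)" for i by (simp add: P_def Rcor.simps)
  have mean: "ip (poly (P i)) 1 = 0" for i unfolding PE by (rule Rcor_mean[OF D])
  have rhs: "- integral (cell h (ctr c0 i)) (\<lambda>x. d x * \<phi> x) - cdg_form C h (ctr c0 i) own oth \<phi>
      + proj_form C h (ctr c0 i) own \<phi> = - corrF (Rcor l) D (ctr c0 i / h) q"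
    if \<phi>: "cellrep h (ctr c0 i) \<phi> (poly q)" for i \<phi> q
  proof -
    have "integral (cell h (ctr c0 i)) (\<lambda>x. d x * \<phi> x) = h * ip (\<lambda>s. 1 / h * Rcor l (shiftD D)
        (ctr c0 i / h) s) q"
      by (rule integral_unique[OF cell_has_integral[OF h dc d \<phi>]])
    also have "\<dots> = ip (Rcor l (shiftD D) (ctr c0 i / h)) q"
      unfolding cellfun_scale[OF cellfun_ip continuous_Rcor[OF contD_shiftD[OF D]]] using h by simp
    finally show ?thesis
      unfolding cdg_form_eq[OF h C Ec Ec Ec own othL othR \<phi>] proj_form_eq[OF h C Ec own \<phi>]
      by (simp add: corrF_def pform_def)
  qed
  have "corr_step k L C h (ctr c0) d own oth = pwf c0 P"
    unfolding corr_step_def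
  proof (rule the_equality)
    show "pwf c0 P \<in> pw_poly0 k L h (ctr c0) \<and> (\<forall>\<phi>\<in>pw_poly0 k L h (ctr c0). \<forall>i.
           proj_form C h (ctr c0 i) (pwf c0 P) \<phi> = - integral (cell h (ctr c0 i)) (\<lambda>x. d x * \<phi> x)
             - cdg_form C h (ctr c0 i) own oth \<phi> + proj_form C h (ctr c0 i) own \<phi>)"
    proof (intro conjI ballI allI)
      have "pwf c0 P \<in> pw_poly k L h (ctr c0)"
      proof (rule pwf_in_pw_poly)
        show "degree (P i) \<le> k" for i unfolding P_def by (rule degree_solve)
        fix i
        have c: "ctr c0 (i + int N) / h = ctr c0 i / h + real N" using h by
            (simp add: ctr_add_N L add_divide_distrib)
        have "poly (P (i + int N)) s = poly (P i) s" if s: "s \<in> rcell" for s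
        proof -
          have "Rcor (Suc l) D (ctr c0 i / h + real N) s = Rcor (Suc l) (\<lambda>j y. D j (y + real N))
              (ctr c0 i / h) s"
            using locfunD(3)[OF locfun_eval[OF locmap_Rcor s] D] by simp
          then show ?thesis unfolding PE c by (simp add: per)
        qed
        then have "P (i + int N) - P i = 0"
          by (intro poly_eq_0_on_interval[of "-1/2" "1/2"]) (auto simp: rcell_def)
        then show "P (i + int N) = P i" by simp
      qed
      then show "pwf c0 P \<in> pw_poly0 k L h (ctr c0)"
        unfolding pw_poly0_def by (simp add: cell_integral_mean[OF h Pc cellrep_pwf] mean)
      fix \<phi> i assume \<phi>: "\<phi> \<in> pw_poly0 k L h (ctr c0)"
      then obtain q where q: "degree q \<le> k" "cellrep h (ctr c0 i) \<phi> (poly q)"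
        using pw_poly_cellrep unfolding pw_poly0_def by blast
      have "integral (cell h (ctr c0 i)) \<phi> = 0" using \<phi> unfolding pw_poly0_def by blast
      then have "ip (poly q) 1 = 0" using cell_integral_mean[OF h continuous_on_poly' q(2)] h by simp
      then show "proj_form C h (ctr c0 i) (pwf c0 P) \<phi> = - integral (cell h (ctr c0 i)) (\<lambda>x. d x * \<phi> x)
             - cdg_form C h (ctr c0 i) own oth \<phi> + proj_form C h (ctr c0 i) own \<phi>"
        unfolding proj_form_eq[OF h C Pc cellrep_pwf q(2)] rhs[OF q(2)] PE by
            (rule RcorSuc_mean_pform(2)[OF D q(1)])
    qed
  next
    fix g assume g: "g \<in> pw_poly0 k L h (ctr c0) \<and> (\<forall>\<phi>\<in>pw_poly0 k L h (ctr c0). \<forall>i.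
           proj_form C h (ctr c0 i) g \<phi> = - integral (cell h (ctr c0 i)) (\<lambda>x. d x * \<phi> x)
             - cdg_form C h (ctr c0 i) own oth \<phi> + proj_form C h (ctr c0 i) own \<phi>)"
    have "cellrep h (ctr c0 i) g (poly (P i))" for i
    proof -
      obtain p where p: "degree p \<le> k" "cellrep h (ctr c0 i) g (poly p)"
        using pw_poly_cellrep g unfolding pw_poly0_def by blast
      have pc: "continuous_on rcell (poly p)" by (rule continuous_on_poly')
      have "integral (cell h (ctr c0 i)) g = 0" using g unfolding pw_poly0_def by blast
      then have m: "ip (poly p) 1 = 0" using cell_integral_mean[OF h pc p(2)] h by simp
      have "pform C q (poly p) = - corrF (Rcor l) D (ctr c0 i / h) q" if q: "degree q \<le> k" "ip
          (poly q) 1 = 0" for q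
      proof -
        \<comment> \<open>A zero-mean polynomial on one cell becomes an admissible test function by
          copying it to all cells.\<close>
        have "pwf c0 (\<lambda>_. q) \<in> pw_poly0 k L h (ctr c0)"
          unfolding pw_poly0_def using pwf_in_pw_poly[of "\<lambda>_. q" c0] q
          by (simp add: cell_integral_mean[OF h continuous_on_poly' cellrep_pwf])
        then show ?thesis
          using g rhs[OF cellrep_pwf, of i "\<lambda>_. q"] proj_form_eq[OF h C pc p(2) cellrep_pwf, of "\<lambda>_.
              q"] by auto
      qed
      note P0 = this
      have "p = P i" unfolding P_def
      proof (rule solve_unique[OF plin_mean0[OF plin_corrF[OF D]] p(1)])
        fix q :: "real poly" assume q: "degree q \<le> k"
        \<comment> \<open>Information is available on zero-mean tests only; the constant part of q
          is annihilated by \<open>pform\<close>, and p has mean zero.\<close>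
        have "q = mean0 q + smult (ip (poly q) 1) 1" by (simp add: mean0_def)
        then have "pform C q (poly p) = pform C (mean0 q) (poly p) + ip (poly q) 1 * pform C 1 (poly p)"
          by (metis plin_add[OF plin_pform[OF pc]] plin_smult[OF plin_pform[OF pc]])
        then show "aform p q = corrF (Rcor l) D (ctr c0 i / h) (mean0 q)"
          using P0[OF degree_mean0[OF q] ip_mean0] m by (simp add: aform_def pform_1[OF pc])
      qed
      then show ?thesis using p(2) by simp
    qed
    then show "g = pwf c0 P" by (rule cellrep_ext) (rule cellrep_pwf)
  qed
  then show ?thesis using cellrep_pwf[of c0 i P] by (simp add: PE)
qed

end

section \<open>Error equation and energy estimate\<close>

lemma cellfun_sum:
  assumes "cellfun \<Lambda>" "\<And>i. i \<in> A \<Longrightarrow> continuous_on rcell (f i)"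
  shows "\<Lambda> (\<lambda>s. \<Sum>i\<in>A. f i s) = (\<Sum>i\<in>A. \<Lambda> (f i))"
  using assms(2)
proof (induction A rule: infinite_finite_induct)
  case (insert x F)
  then show ?case by (simp add: cellfun_add[OF assms(1)] continuous_on_sum)
qed (simp_all add: cellfun_0[OF assms(1)])

lemma sum_cyclic_shift:
  fixes g :: "int \<Rightarrow> 'a :: ab_group_add"
  assumes "g (int N) = g 0" shows "(\<Sum>i<N. g (int i + 1)) = (\<Sum>i<N. g (int i))"
proof -
  have "(\<Sum>i<N. g (int i + 1)) + g 0 = (\<Sum>i<Suc N. g (int i))"
    by (subst sum.lessThan_Suc_shift) (simp add: add.commute)
  then show ?thesis using assms by simp
qed

lemma periodic_has_integral:
  fixes f :: "real \<Rightarrow> real"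
  assumes f: "(f has_integral I) {c..c + L}" and per: "\<And>x. f (x + L) = f x" and a: "c \<le> a" "a \<le> c + L"
  shows "(f has_integral I) {a..a + L}"
proof -
  have i: "f integrable_on {c..a}" "f integrable_on {a..c + L}"
    using integrable_on_subinterval[OF has_integral_integrable[OF f]] a by auto
  have 1: "(f has_integral (integral {c..a} f + integral {a..c + L} f)) {c..c + L}"
    by (rule has_integral_combine[OF a]) (use i in \<open>auto intro: integrable_integral\<close>)
  have "(f has_integral 1 * integral {c..a} f) {L + 1 * c..L + 1 * a}"
    by (rule has_integral_cell) (use i per in \<open>auto intro: integrable_integral simp: add.commute\<close>)
  then have "(f has_integral integral {c..a} f) {c + L..a + L}" by (simp add: add.commute)
  from has_integral_combine[OF _ _ integrable_integral[OF i(2)] this] a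
  have "(f has_integral (integral {a..c + L} f + integral {c..a} f)) {a..a + L}" by auto
  moreover have "I = integral {a..c + L} f + integral {c..a} f"
    using has_integral_unique[OF f 1] by simp
  ultimately show ?thesis by simp
qed

lemma has_real_derivative_within_unique:
  assumes "(f has_real_derivative d) (at t within {a..b})" "(f has_real_derivative d')
      (at t within {a..b})"
    and "a < b" "t \<in> {a..b}"
  shows "d = d'"
  using assms(1,2) tendsto_unique[OF at_within_Icc_neq_bot[OF assms(3,4)]]
  unfolding has_field_derivative_iff by blast

text \<open>Evaluation at \<open>k + 1\<close> nodes turns pointwise differentiability of a family of polynomials into
  differentiability of its coefficients.\<close>

lemma poly_family_derivative:
  fixes P :: "real \<Rightarrow> real poly"
  assumes T: "(T :: real) > 0" and t: "t \<in> {0..T}" and deg: "\<And>r. r \<in> {0..T} \<Longrightarrow> degree (P r) \<le> k"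
    and d: "\<And>s. -1/2 \<le> s \<Longrightarrow> s < 1/2 \<Longrightarrow> ((\<lambda>r. poly (P r) s) has_real_derivative d s) (at t within {0..T})"
  shows "\<exists>q. degree q \<le> k \<and> (\<forall>s. -1/2 \<le> s \<longrightarrow> s < 1/2 \<longrightarrow> d s = poly q s) \<and>
    ((\<lambda>r. ip (poly (P r)) (P r)) has_real_derivative 2 * ip (poly q) (P t)) (at t within {0..T})"
proof -
  \<comment> \<open>These k + 1 equidistant nodes start at -1/2 and stop short of 1/2, where
    differentiability is not given.\<close>
  define node where "node n = -1/2 + real n / real (Suc k)" for n
  have node: "-1/2 \<le> node n" "node n < 1/2" if "n \<le> k" for n
    using that by (auto simp: node_def field_simps)
  have nodeinj: "inj_on node {..k}" by (auto simp: inj_on_def node_def)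
  define B where "B p q = (\<Sum>n\<le>k. poly p (node n) * poly q (node n))" for p q :: "real poly"
  have "\<exists>\<kappa>. \<forall>j. degree (\<kappa> j) \<le> k \<and> (\<forall>q. degree q \<le> k \<longrightarrow> B (\<kappa> j) q = coeff q j)"
  proof (rule dual_basis_exists)
    show "plin (\<lambda>p. B p q)" "plin (B p)" for p q
      unfolding B_def[abs_def] by (auto intro!: plinI simp: algebra_simps sum.distrib sum_distrib_left)
    fix p :: "real poly" assume p: "degree p \<le> k" "B p p = 0"
    then have "\<forall>n\<in>{..k}. poly p (node n) * poly p (node n) = 0"
      unfolding B_def by (subst (asm) sum_nonneg_eq_0_iff) auto
    then have "node ` {..k} \<subseteq> {x. poly p x = 0}" by auto
    show "p = 0"
    proof (rule ccontr)
      assume "p \<noteq> 0"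
      then have "card (node ` {..k}) \<le> card {x. poly p x = 0}"
        using \<open>node ` {..k} \<subseteq> _\<close> by (intro card_mono poly_roots_finite)
      also have "\<dots> \<le> degree p" by (rule card_poly_roots_bound[OF \<open>p \<noteq> 0\<close>])
      finally show False using p(1) by (simp add: card_image[OF nodeinj])
    qed
  qed
  then obtain \<kappa> where \<kappa>: "\<And>j q. degree q \<le> k \<Longrightarrow> B (\<kappa> j) q = coeff q j" by blast
  define F where "F j r = (\<Sum>n\<le>k. poly (\<kappa> j) (node n) * poly (P r) (node n))" for j r
  define e where "e j = (\<Sum>n\<le>k. poly (\<kappa> j) (node n) * d (node n))" for j
  have F: "(F j has_real_derivative e j) (at t within {0..T})" for j
    unfolding F_def[abs_def] e_def by (intro DERIV_sum DERIV_cmult d node) auto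
  have Fc: "F j r = coeff (P r) j" if "r \<in> {0..T}" for j r
    using \<kappa>[OF deg[OF that], of j] by (simp add: F_def B_def)
  define q where "q = (\<Sum>j\<le>k. monom (e j) j)"
  have Pr: "P r = (\<Sum>j\<le>k. smult (F j r) (monom 1 j))" if "r \<in> {0..T}" for r
    using poly_as_sum_of_monoms'[OF deg[OF that]] by (simp add: Fc[OF that] smult_monom)
  have q: "q = (\<Sum>j\<le>k. smult (e j) (monom 1 j))" by (simp add: q_def smult_monom)
  have dq: "degree q \<le> k" unfolding q_def by (intro degree_sum_le)
      (auto intro: order_trans[OF degree_monom_le])
  have ds: "d s = poly q s" if s: "-1/2 \<le> s" "s < 1/2" for s
  proof (rule has_real_derivative_within_unique[OF d[OF s] _ T t])
    have "((\<lambda>r. \<Sum>j\<le>k. F j r * s ^ j) has_real_derivative (\<Sum>j\<le>k. e j * s ^ j)) (at t within {0..T})"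
      by (intro DERIV_sum DERIV_cmult_right F)
    moreover have "(\<Sum>j\<le>k. e j * s ^ j) = poly q s" by (simp add: q_def poly_sum poly_monom)
    moreover have "(\<Sum>j\<le>k. F j r * s ^ j) = poly (P r) s" if "r \<in> {0..T}" for r
      by (subst Pr[OF that]) (simp add: poly_sum poly_monom)
    ultimately show "((\<lambda>r. poly (P r) s) has_real_derivative poly q s) (at t within {0..T})"
      by (auto intro: has_field_derivative_transform_within[OF _ zero_less_one t])
  qed
  \<comment> \<open>The Gram matrix of the monomials turns the squared norm into a fixed quadratic
    form in the coefficients F, which can be differentiated termwise.\<close>
  define G where "G i j = ip (poly (monom 1 i)) (monom 1 j)" for i j :: nat
  have Gsym: "G i j = G j i" for i j by (simp add: G_def ip_def mult.commute)
  have pl: "plin (ip (poly p))" "plin (\<lambda>p. ip (poly p) q)" for p q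
    by (intro plin_ip plin_cellfun_poly cellfun_ip continuous_on_poly')+
  have expand: "ip (poly (\<Sum>i\<le>k. smult (x i) (monom 1 i))) (\<Sum>j\<le>k. smult (y j) (monom 1 j))
      = (\<Sum>i\<le>k. \<Sum>j\<le>k. x i * y j * G i j)" for x y :: "nat \<Rightarrow> real"
    by (simp add: plin_sum[OF pl(1)] plin_smult[OF pl(1)] plin_sum[OF pl(2)] plin_smult[OF pl(2)]
      G_def sum_distrib_left mult_ac) (rule sum.swap)
  have "((\<lambda>r. \<Sum>i\<le>k. \<Sum>j\<le>k. F i r * F j r * G i j) has_real_derivative
      (\<Sum>i\<le>k. \<Sum>j\<le>k. (e i * F j t + e j * F i t) * G i j)) (at t within {0..T})"
    by (intro DERIV_sum DERIV_cmult_right DERIV_mult' F[THEN DERIV_cong]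
        DERIV_mult[OF F F, THEN DERIV_cong]) (auto simp: mult_ac)
  moreover have "(\<Sum>i\<le>k. \<Sum>j\<le>k. (e i * F j t + e j * F i t) * G i j) = 2 * ip (poly q) (P t)"
  proof -
    have "(\<Sum>i\<le>k. \<Sum>j\<le>k. e j * F i t * G i j) = (\<Sum>i\<le>k. \<Sum>j\<le>k. e i * F j t * G i j)"
      by (subst sum.swap) (simp add: Gsym mult_ac)
    moreover have "ip (poly q) (P t) = (\<Sum>i\<le>k. \<Sum>j\<le>k. e i * F j t * G i j)"
      unfolding q Pr[OF t] by (rule expand)
    ultimately show ?thesis by (simp add: distrib_right sum.distrib)
  qed
  moreover have "(\<Sum>i\<le>k. \<Sum>j\<le>k. F i r * F j r * G i j) = ip (poly (P r)) (P r)" if "r \<in> {0..T}" for r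
    by (subst (1 2) Pr[OF that]) (rule expand[symmetric])
  ultimately have "((\<lambda>r. ip (poly (P r)) (P r)) has_real_derivative 2 * ip (poly q) (P t))
      (at t within {0..T})"
    by (auto intro: has_field_derivative_transform_within[OF _ zero_less_one t])
  then show ?thesis using dq ds by blast
qed

text \<open>A smooth function satisfies the scheme exactly: both neighbours and the cell see the
  same U, so the 1 / C terms cancel, and integration by parts absorbs the end values.\<close>

lemma cdg_consistency:
  fixes U U' :: "real \<Rightarrow> real"
  assumes U: "\<And>y. (U has_real_derivative U' y) (at y)" and U': "continuous_on UNIV U'"
  shows "flux_left C \<phi> (\<lambda>s. U (c - 1/2 + s)) + flux_right C \<phi> (\<lambda>s. U (c + 1/2 + s))
     - ip (\<lambda>s. U (c + s)) \<phi> / C = - ip (\<lambda>s. U' (c + s)) \<phi>"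
proof -
  have Uc: "continuous_on UNIV U"
    by (rule DERIV_continuous_on) (use U in \<open>auto intro: has_field_derivative_at_within\<close>)
  have comp: "continuous_on X (\<lambda>s. U (d + s))" "continuous_on X (\<lambda>s. U' (d + s))" for X d
    using continuous_on_translate[OF Uc, of X d] continuous_on_translate[OF U', of X d] by
        (simp_all add: add.commute)
  have l: "integral {0..1/2} (\<lambda>y. U (c - 1/2 + y) * poly p (y - 1/2)) = integral {-1/2..0} (\<lambda>s. U (c
      + s) * poly p s)" for p
    using integral_shift_cell[of "-1/2" "1/2" 0 "\<lambda>y. U (c - 1/2 + y)" "poly p"] comp(1)[of _ "c - 1/2"]
    by (simp add: continuous_intros)
  have r: "integral {-1/2..0} (\<lambda>y. U (c + 1/2 + y) * poly p (y + 1/2)) = integral {0..1/2} (\<lambda>s. U (c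
      + s) * poly p s)" for p
    using integral_shift_cell[of 0 "-1/2" "1/2" "\<lambda>y. U (c + 1/2 + y)" "poly p"] comp(1)[of _ "c + 1/2"]
    by (simp add: continuous_intros)
  have i: "(\<lambda>s. U (c + s) * poly (pderiv \<phi>) s) integrable_on {-1/2..1/2}" "(\<lambda>s. U' (c
      + s) * poly \<phi> s) integrable_on {-1/2..1/2}"
    by (intro integrable_continuous_interval continuous_on_mult comp continuous_on_poly')+
  have "((\<lambda>s. U (c + s) * poly (pderiv \<phi>) s + U' (c + s) * poly \<phi> s) has_integral
     (U (c + 1/2) * poly \<phi> (1/2) - U (c + -1/2) * poly \<phi> (-1/2))) {-1/2..1/2}"
  proof (rule fundamental_theorem_of_calculus)
    fix s
    have "((\<lambda>s. U (c + s)) has_real_derivative U' (c + s)) (at s)"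
      using DERIV_shift[of U "U' (c + s)" s c] U[of "s + c"] by (simp add: add.commute)
    then have "((\<lambda>s. U (c + s) * poly \<phi> s) has_real_derivative (U (c + s) * poly (pderiv \<phi>) s + U'
        (c + s) * poly \<phi> s)) (at s)"
      by (auto intro!: derivative_eq_intros)
    then show "((\<lambda>s. U (c + s) * poly \<phi> s) has_vector_derivative (U (c + s) * poly (pderiv \<phi>) s + U'
        (c + s) * poly \<phi> s)) (at s within {-1/2..1/2})"
      by (simp add: has_real_derivative_iff_has_vector_derivative[symmetric]
          has_field_derivative_at_within)
  qed simp
  from integral_unique[OF this]
  have ibp: "ip (\<lambda>s. U (c + s)) (pderiv \<phi>) + ip (\<lambda>s. U' (c + s)) \<phi> = U (c + 1/2) * poly \<phi> (1/2) - U
      (c - 1/2) * poly \<phi> (-1/2)"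
    using i by (simp add: integral_add ip_def)
  show ?thesis
    unfolding flux_left_eq[OF comp(1)] flux_right_eq[OF comp(1)] l r
    using ibp unfolding ip_split_halves[OF comp(1)]
    by (simp add: add_divide_distrib)
qed

section \<open>The correction functions on the two meshes\<close>

context cdg_mesh
begin

lemma primal_ctr_eq: "primal_ctr a h = ctr (a - h/2)"
  by (rule ext) (simp add: primal_ctr_def mesh_pt_def ctr_def algebra_simps)

lemma dual_ctr_eq: "dual_ctr a h = ctr a"
  by (rule ext) (simp add: dual_ctr_def mesh_pt_def ctr_def)

lemma ctr_neighbours:
  "ctr (a - h/2) i - h/2 = ctr a (i - 1)" "ctr (a - h/2) i + h/2 = ctr a i"
  "ctr a i - h/2 = ctr (a - h/2) i" "ctr a i + h/2 = ctr (a - h/2) (i + 1)"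
  by (simp_all add: ctr_def algebra_simps)

lemma ctr_neighbours':
  "ctr (a - h/2) i / h - 1/2 = ctr a (i - 1) / h" "ctr (a - h/2) i / h + 1/2 = ctr a i / h"
  "ctr a i / h - 1/2 = ctr (a - h/2) i / h" "ctr a i / h + 1/2 = ctr (a - h/2) (i + 1) / h"
  using h by (simp_all add: ctr_def field_simps)

definition scaled :: "(nat \<Rightarrow> real \<Rightarrow> real) \<Rightarrow> nat \<Rightarrow> real \<Rightarrow> real" where
  "scaled w j y = h ^ j * w j (h * y)"

lemma contD_scaled: "(\<And>j. continuous_on UNIV (w j)) \<Longrightarrow> contD (scaled w)"
  unfolding contD_def scaled_def
  by (auto intro!: continuous_on_mult continuous_on_const continuous_on_compose2[of UNIV "w _" UNIV
      "\<lambda>y. h * y"] continuous_on_id)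

text \<open>The step from l to l + 1 applies level l to u and to its derivative, so the induction
  runs over all sequences w and uses w together with its shift. Just l differentiations are
  demanded, since the exact solution has finitely many classical derivatives.\<close>

lemma corr_eq:
  assumes "\<And>j. continuous_on UNIV (w j)" "\<And>j. periodic L (w j)" "\<And>j. j < l \<Longrightarrow> deriv (w j) = w (Suc j)"
    and ab: "b - a = L"
  shows "(\<forall>i. cellrep h (ctr (a - h/2) i) (fst (corr k a b C h l (w 0))) (Rcor l (scaled w) (ctr
      (a - h/2) i / h))) \<and>
    (\<forall>i. cellrep h (ctr a i) (snd (corr k a b C h l (w 0))) (Rcor l (scaled w) (ctr a i / h)))"
  using assms(1-3)
proof (induction l arbitrary: w)
  case 0
  have "cellrep h (ctr c0 i) (\<lambda>x. w 0 x - cdg_proj k L C h (ctr c0) (w 0) x) (Rcor 0 (scaled w)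
      (ctr c0 i / h))" for c0 i
  proof -
    have "(\<lambda>s. w 0 (ctr c0 i + h * s)) = (\<lambda>s. scaled w 0 (ctr c0 i / h + s))"
      using h by (simp add: scaled_def distrib_left)
    then show ?thesis
      using cdg_proj_eq[OF 0(1,2), of c0 i 0] unfolding cellrep_def Rcor.simps
      by (simp add: fun_eq_iff)
  qed
  then show ?case by (simp add: proj_C_def proj_D_def ab primal_ctr_eq dual_ctr_eq)
next
  case (Suc l)
  define w' where "w' j = w (Suc j)" for j
  have IH': "(\<forall>i. cellrep h (ctr (a - h/2) i) (fst (corr k a b C h l (w' 0))) (Rcor l (scaled w')
      (ctr (a - h/2) i / h))) \<and>
    (\<forall>i. cellrep h (ctr a i) (snd (corr k a b C h l (w' 0))) (Rcor l (scaled w') (ctr a i / h)))"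
    by (rule Suc.IH) (use Suc.prems in \<open>auto simp: w'_def\<close>)
  have IH: "(\<forall>i. cellrep h (ctr (a - h/2) i) (fst (corr k a b C h l (w 0))) (Rcor l (scaled w) (ctr
      (a - h/2) i / h))) \<and>
    (\<forall>i. cellrep h (ctr a i) (snd (corr k a b C h l (w 0))) (Rcor l (scaled w) (ctr a i / h)))"
    by (rule Suc.IH) (use Suc.prems in auto)
  have w'0: "w' 0 = deriv (w 0)" using Suc.prems(3)[of 0] by (simp add: w'_def)
  have D: "contD (scaled w)" "contD (scaled w')" using Suc.prems(1) by
      (auto intro!: contD_scaled simp: w'_def)
  \<comment> \<open>Shifting the scaled sequence leaves one power of h over, hence the factor 1 / h
    in the next line.\<close>
  have "shiftD (scaled w) = (\<lambda>j y. h * scaled w' j y)"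
    by (intro ext) (simp add: shiftD_def scaled_def w'_def)
  then have Es: "Rcor l (scaled w') c = (\<lambda>s. 1 / h * Rcor l (shiftD (scaled w)) c s)" for c
    using locmapD(3)[OF locmap_Rcor D(2), of l h c] h by simp
  have per: "scaled w j (y + real N) = scaled w j y" for j y
    using Suc.prems(2)[of j] by (simp add: scaled_def periodic_def distrib_left L mult.commute[of h])
  have 1: "cellrep h (ctr (a - h/2) i) (corr_step k L C h (ctr (a - h/2)) (fst (corr k a b C h l (w' 0)))
      (fst (corr k a b C h l (w 0))) (snd (corr k a b C h l (w 0)))) (Rcor (Suc l) (scaled w) (ctr
          (a - h/2) i / h))" for i
    by (rule corr_step_eq[OF D(1) per])
      (use IH IH' in \<open>simp_all only: Es ctr_neighbours(1,2)[of a] ctr_neighbours'(1,2)[of a] simp_thms\<close>)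
  have 2: "cellrep h (ctr a i) (corr_step k L C h (ctr a) (snd (corr k a b C h l (w' 0)))
      (snd (corr k a b C h l (w 0))) (fst (corr k a b C h l (w 0)))) (Rcor (Suc l) (scaled w)
          (ctr a i / h))" for i
    by (rule corr_step_eq[OF D(1) per])
      (use IH IH' in \<open>simp_all only: Es ctr_neighbours(3,4)[of a] ctr_neighbours'(3,4)[of a] simp_thms\<close>)
  have e: "corr k a b C h (Suc l) (w 0) =
     (corr_step k L C h (ctr (a - h/2)) (fst (corr k a b C h l (w' 0))) (fst (corr k a b C h l
         (w 0))) (snd (corr k a b C h l (w 0))),
      corr_step k L C h (ctr a) (snd (corr k a b C h l (w' 0))) (snd (corr k a b C h l (w 0))) (fst
          (corr k a b C h l (w 0))))"
    by (simp add: w'0 Let_def case_prod_beta ab primal_ctr_eq dual_ctr_eq)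
  show ?case unfolding e using 1 2 by simp
qed

lemma pw_square_has_integral:
  assumes "\<And>i. cellrep h (ctr c0 i) f (poly (P i))"
  shows "((\<lambda>x. (f x)\<^sup>2) has_integral h * (\<Sum>i<n. ip (poly (P (int i))) (P
      (int i)))) {c0 - h/2..c0 - h/2 + real n * h}"
proof (induction n)
  case 0
  then show ?case by (simp add: has_integral_refl)
next
  case (Suc n)
  have "((\<lambda>s. poly (P (int n)) s * poly (P (int n)) s) has_integral ip (poly (P (int n))) (P
      (int n))) {-1/2..1/2}"
    unfolding ip_def by (intro integrable_integral integrable_continuous_interval continuous_intros)
  from has_integral_cell[OF h this, of "\<lambda>x. (f x)\<^sup>2" "ctr c0 (int n)"] cellrepD[OF assms, of _ "int n"]
  have "((\<lambda>x. (f x)\<^sup>2) has_integral h * ip (poly (P (int n))) (P (int n)))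
      {ctr c0 (int n) + h * (-1/2)..ctr c0 (int n) + h * (1/2)}"
    by (simp add: power2_eq_square)
  moreover have "ctr c0 (int n) + h * (-1/2) = c0 - h/2 + real n * h"
    "ctr c0 (int n) + h * (1/2) = c0 - h/2 + real (Suc n) * h" by (simp_all add: ctr_def algebra_simps)
  ultimately have 1: "((\<lambda>x. (f x)\<^sup>2) has_integral h * ip (poly (P (int n))) (P (int n)))
      {c0 - h/2 + real n * h..c0 - h/2 + real (Suc n) * h}" by (simp only:)
  have "c0 - h/2 \<le> c0 - h/2 + real n * h" "c0 - h/2 + real n * h \<le> c0 - h/2 + real (Suc n) * h"
    using h by (simp_all add: algebra_simps)
  from has_integral_combine[OF this Suc.IH 1] show ?case by (simp add: distrib_left)
qed

end

text \<open>Moving every argument by one cell changes the sum over a period by M, and from -4 to 4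
  there are eight such moves.\<close>

lemma sum_window:
  fixes g :: "int \<Rightarrow> real"
  assumes "\<And>i. g (i + int N) = g i + M"
  shows "(\<Sum>i<N. g (int i + 4) - g (int i - 4)) = 8 * M"
proof -
  define S where "S j = (\<Sum>i<N. g (int i + j))" for j
  have step: "S (j + 1) = S j + M" for j
  proof -
    have "S (j + 1) - S j = (\<Sum>i<N. g (int (Suc i) + j) - g (int i + j))"
      by (simp add: S_def sum_subtractf add_ac)
    also have "\<dots> = g (j + int N) - g j" by (subst sum_lessThan_telescope) (simp add: add.commute)
    finally show ?thesis using assms[of j] by simp
  qed
  have "S 4 = S (-4) + 8 * M"
    using step[of "-4"] step[of "-3"] step[of "-2"] step[of "-1"] step[of 0] step[of 1] step[of 2]
        step[of 3] by simp
  then show ?thesis by (simp add: S_def sum_subtractf)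
qed

text \<open>The integrating factor exp (- t) makes Z nonincreasing; adding B to Y absorbs the
  inhomogeneous term.\<close>

lemma gronwall:
  fixes Y :: "real \<Rightarrow> real"
  assumes T: "T > 0" and Y: "\<And>t. t \<in> {0..T} \<Longrightarrow> (Y has_real_derivative Y' t) (at t within {0..T})"
    and bound: "\<And>t. t \<in> {0..T} \<Longrightarrow> Y' t \<le> Y t + B"
  shows "Y T + B \<le> exp T * (Y 0 + B)"
proof -
  define Z where "Z t = exp (- t) * (Y t + B)" for t
  have Z: "(Z has_real_derivative exp (- t) * (Y' t - Y t - B)) (at t within {0..T})"
      if "t \<in> {0..T}" for t
    unfolding Z_def[abs_def] using Y[OF that] by (auto intro!: derivative_eq_intros simp: algebra_simps)
  have "Z T \<le> Z 0"
  proof (rule DERIV_nonpos_imp_decreasing_open[of 0 T Z])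
    show "0 \<le> T" using T by simp
    show "continuous_on {0..T} Z" by (rule DERIV_continuous_on) (rule Z)
    fix t assume t: "0 < t" "t < T"
    then have "(Z has_real_derivative exp (- t) * (Y' t - Y t - B)) (at t)"
      using Z[of t] at_within_Icc_at[of 0 t T] by simp
    moreover have "exp (- t) * (Y' t - Y t - B) \<le> 0" using bound[of t] t by
        (intro mult_nonneg_nonpos) auto
    ultimately show "\<exists>y. (Z has_real_derivative y) (at t) \<and> y \<le> 0" by blast
  qed
  then show ?thesis by (simp add: Z_def exp_minus field_simps)
qed

section \<open>One discrete solution, the exact one, and the equation for their corrected
  error\<close>

locale cdg_run = cdg_mesh k C h L N for k C h L N +
  fixes a b T :: real and v :: "nat \<Rightarrow> real \<Rightarrow> real" and u uC uD dC dD :: "real \<Rightarrow> real \<Rightarrow> real"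
  assumes ab: "b - a = L" and T: "T > 0"
    and v_cont: "continuous_on UNIV (v j)" and v_per: "periodic L (v j)"
    and v_deriv: "j < conv_order \<Longrightarrow> (v j has_real_derivative v (Suc j) x) (at x)"
    and u: "t \<in> {0..T} \<Longrightarrow> u t = (\<lambda>x. v 0 (x - t))"
    and uC: "t \<in> {0..T} \<Longrightarrow> uC t \<in> pw_poly k L h (ctr (a - h/2))"
    and uD: "t \<in> {0..T} \<Longrightarrow> uD t \<in> pw_poly k L h (ctr a)"
    and dC: "t \<in> {0..T} \<Longrightarrow> ((\<lambda>r. uC r x) has_real_derivative dC t x) (at t within {0..T})"
    and dD: "t \<in> {0..T} \<Longrightarrow> ((\<lambda>r. uD r x) has_real_derivative dD t x) (at t within {0..T})"
    and eqC: "t \<in> {0..T} \<Longrightarrow> \<phi> \<in> pw_poly k L h (ctr (a - h/2)) \<Longrightarrow>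
        integral (cell h (ctr (a - h/2) i)) (\<lambda>x. dC t x * \<phi> x) = cdg_form C h (ctr (a - h/2) i)
            (uC t) (uD t) \<phi>"
    and eqD: "t \<in> {0..T} \<Longrightarrow> \<phi> \<in> pw_poly k L h (ctr a) \<Longrightarrow>
        integral (cell h (ctr a i)) (\<lambda>x. dD t x * \<phi> x) = cdg_form C h (ctr a i) (uD t) (uC t) \<phi>"
begin

definition vt :: "real \<Rightarrow> nat \<Rightarrow> real \<Rightarrow> real" where "vt t j x = v j (x - t)"

definition Dt :: "real \<Rightarrow> nat \<Rightarrow> real \<Rightarrow> real" where "Dt t = scaled (vt t)"

text \<open>Writing minus the projection as - u + \<open>R^0\<close> u lets the sum start at level
  0, so that projection error and corrections are treated alike.\<close>

definition cell_error :: "(real \<Rightarrow> real \<Rightarrow> real) \<Rightarrow> real \<Rightarrow> real \<Rightarrow> real \<Rightarrow> real" where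
  "cell_error own c t s = own t (c + h * s) - Dt t 0 (c / h + s) + (\<Sum>l\<le>lmax. Rcor l (Dt t) (c / h) s)"

lemma lmax_less_conv_order: "lmax < conv_order" using k by (auto simp: lmax_def conv_order_def)

lemma vt_cont: "continuous_on UNIV (vt t j)"
  using continuous_on_translate[OF v_cont[of j], of UNIV "-t"] by (simp add: vt_def[abs_def])

lemma vt_per: "periodic L (vt t j)"
  unfolding periodic_def vt_def
proof
  fix x have "x + L - t = (x - t) + L" by simp
  then show "v j (x + L - t) = v j (x - t)" using v_per[of j] unfolding periodic_def by (simp only:)
qed

lemma vt_deriv: "j < conv_order \<Longrightarrow> (vt t j has_real_derivative vt t (Suc j) x) (at x)"
  using DERIV_shift[of "v j" "v (Suc j) (x - t)" x "-t"] v_deriv[of j "x - t"] by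
      (simp add: vt_def[abs_def])

lemma contD_Dt: "contD (Dt t)"
  unfolding Dt_def by (rule contD_scaled) (rule vt_cont)

lemma Dt_deriv:
  assumes "j < conv_order" shows "(Dt t j has_real_derivative Dt t (Suc j) y) (at y)"
proof -
  have "((\<lambda>y. vt t j (h * y)) has_real_derivative vt t (Suc j) (h * y) * h) (at y)"
    by (rule DERIV_chain2[OF vt_deriv[OF assms]]) (auto intro!: derivative_eq_intros)
  from DERIV_cmult[OF this, of "h ^ j"] show ?thesis by (simp add: Dt_def scaled_def[abs_def] mult_ac)
qed

lemma Dt_translate: "Dt r = (\<lambda>j y. Dt 0 j (y + - r / h))"
  using h by (intro ext) (simp add: Dt_def scaled_def vt_def algebra_simps)

lemma Dt_per: "Dt t j (y + real N) = Dt t j y"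
  using vt_per[of t j] by (simp add: Dt_def scaled_def periodic_def distrib_left L mult.commute[of h])

text \<open>The exact solution at time r is the initial one shifted by r, that is, by r / h in
  scaled coordinates. The time derivative is therefore - 1 / h times the derivative in the centre,
  which is \<open>shiftD\<close>.\<close>

lemma Rcor_time:
  assumes "l \<le> lmax" "s \<in> rcell"
  shows "((\<lambda>r. Rcor l (Dt r) c s) has_real_derivative - (1 / h) * Rcor l (shiftD (Dt t)) c s)
      (at t within S)"
proof -
  have lf: "locfun l (\<lambda>D c. Rcor l D c s)" by (rule locfun_eval[OF locmap_Rcor assms(2)])
  have tr: "Rcor l (Dt r) c s = Rcor l (Dt 0) (c + - r / h) s" for r
    by (subst Dt_translate) (rule locfunD(3)[OF lf contD_Dt])
  have sh: "Rcor l (shiftD (Dt t)) c s = Rcor l (shiftD (Dt 0)) (c + - t / h) s"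
    using locfunD(3)[OF lf contD_shiftD[OF contD_Dt[of 0]], of "- t / h" c]
    by (subst Dt_translate) (simp add: shiftD_def[abs_def])
  have "((\<lambda>c. Rcor l (Dt 0) c s) has_real_derivative Rcor l (shiftD (Dt 0)) (c + - t / h) s) (at (c
      + - t / h))"
    by (rule locfun_has_derivative[OF lf contD_Dt]) (use Dt_deriv assms(1) lmax_less_conv_order in auto)
  then have "((\<lambda>r. Rcor l (Dt 0) (c + - r / h) s) has_real_derivative Rcor l (shiftD (Dt 0)) (c
      + - t / h) s * (- (1 / h))) (at t)"
    by (rule DERIV_chain2) (use h in \<open>auto intro!: derivative_eq_intros\<close>)
  then show ?thesis unfolding tr sh by (simp add: mult.commute has_field_derivative_at_within)
qed

lemma U_time: "((\<lambda>r. Dt r 0 y) has_real_derivative - (1 / h) * Dt t 1 y) (at t within S)"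
proof -
  have "((\<lambda>r. v 0 (h * y - r)) has_real_derivative v (Suc 0) (h * y - t) * (- 1)) (at t)"
    by (rule DERIV_chain2[OF v_deriv]) (use lmax_less_conv_order in \<open>auto intro!: derivative_eq_intros\<close>)
  then show ?thesis using h by (simp add: Dt_def scaled_def vt_def has_field_derivative_at_within)
qed

lemma cell_error_time:
  assumes own: "\<And>x. ((\<lambda>r. own r x) has_real_derivative d x) (at t within {0..T})" and s: "s \<in> rcell"
  shows "((\<lambda>r. cell_error own c r s) has_real_derivative
     (d (c + h * s) + 1 / h * Dt t 1 (c / h + s) - 1 / h * (\<Sum>l\<le>lmax. Rcor l (shiftD (Dt t))
         (c / h) s))) (at t within {0..T})"
proof -
  have "((\<lambda>r. \<Sum>l\<le>lmax. Rcor l (Dt r) (c / h) s) has_real_derivative (\<Sum>l\<le>lmax. - (1 / h) * Rcor l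
      (shiftD (Dt t)) (c / h) s)) (at t within {0..T})"
    by (intro DERIV_sum Rcor_time s) auto
  from DERIV_add[OF DERIV_diff[OF own[of "c + h * s"] U_time[of "c / h + s"]] this]
  show ?thesis unfolding cell_error_def[abs_def] by (simp add: sum_distrib_left sum_negf)
qed

text \<open>The exact solution, the only part that is not a polynomial, cancels between - u and the
  level 0 term.\<close>

lemma cell_error_poly_exists:
  assumes "own t \<in> pw_poly k L h (ctr c0)"
  shows "\<exists>P. degree P \<le> k \<and> (\<forall>s. -1/2 \<le> s \<longrightarrow> s < 1/2 \<longrightarrow> cell_error own (ctr c0 i) t s = poly P s)"
proof -
  let ?c = "ctr c0 i"
  obtain p where p: "degree p \<le> k" "cellrep h ?c (own t) (poly p)" using pw_poly_cellrep[OF assms]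
      by blast
  define r where "r = solve (projF (\<lambda>s. Dt t 0 (?c / h + s)))"
  define R where "R l = solve (\<lambda>q. corrF (Rcor l) (Dt t) (?c / h) (mean0 q))" for l
  have "cell_error own ?c t s = poly (p - r + (\<Sum>l<lmax. R l)) s" if "-1/2 \<le> s" "s < 1/2" for s
    using cellrepD[OF p(2) that] unfolding cell_error_def sum.atMost_shift
    by (simp add: Rcor.simps r_def R_def poly_sum)
  moreover have "degree (p - r + (\<Sum>l<lmax. R l)) \<le> k"
    unfolding r_def R_def by (intro degree_add_le degree_diff_le degree_sum_le p degree_solve) auto
  ultimately show ?thesis by blast
qed

definition error_poly :: "(real \<Rightarrow> real \<Rightarrow> real) \<Rightarrow> real \<Rightarrow> real \<Rightarrow> real poly" where
  "error_poly own c t = (SOME P. degree P \<le> k \<and> (\<forall>s. -1/2 \<le> s \<longrightarrow> s < 1/2 \<longrightarrow> cell_error own c t s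
      = poly P s))"

lemma error_poly:
  assumes "own t \<in> pw_poly k L h (ctr c0)"
  shows "degree (error_poly own (ctr c0 i) t) \<le> k"
    and "-1/2 \<le> s \<Longrightarrow> s < 1/2 \<Longrightarrow> cell_error own (ctr c0 i) t s = poly (error_poly own (ctr c0 i) t) s"
  using someI_ex[OF cell_error_poly_exists[where own = own and t = t and i = i, OF assms]]
      unfolding error_poly_def by blast+

lemma error_poly_periodic:
  assumes "own t \<in> pw_poly k L h (ctr c0)"
  shows "error_poly own (ctr c0 (i + int N)) t = error_poly own (ctr c0 i) t"
proof -
  have p: "own t (x + L) = own t x" for x using assms unfolding pw_poly_def periodic_def by blast
  have c: "ctr c0 (i + int N) / h = ctr c0 i / h + real N" using h by
      (simp add: ctr_add_N L add_divide_distrib)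
  have "cell_error own (ctr c0 (i + int N)) t s = cell_error own (ctr c0 i) t s" for s
  proof -
    have "Rcor l (Dt t) (ctr c0 i / h + real N) = Rcor l (Dt t) (ctr c0 i / h)" for l
      using locmapD(4)[OF locmap_Rcor contD_Dt, of l t "real N" "ctr c0 i / h"] by (simp add: Dt_per)
    moreover have "own t (ctr c0 (i + int N) + h * s) = own t (ctr c0 i + h * s)"
      using p[of "ctr c0 i + h * s"] by (simp add: ctr_add_N add_ac)
    moreover have "Dt t 0 (ctr c0 i / h + real N + s) = Dt t 0 (ctr c0 i / h + s)"
      using Dt_per[of t 0 "ctr c0 i / h + s"] by (simp add: add_ac)
    ultimately show ?thesis unfolding cell_error_def c by simp
  qed
  then show ?thesis unfolding error_poly_def by simp
qed

lemma cellrep_cell_error: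
  assumes "own t \<in> pw_poly k L h (ctr c0)"
  shows "cellrep h (ctr c0 i) (own t) (\<lambda>s. poly (error_poly own (ctr c0 i) t) s + Dt t 0
      (ctr c0 i / h + s) - (\<Sum>l\<le>lmax. Rcor l (Dt t) (ctr c0 i / h) s))"
  unfolding cellrep_def using error_poly(2)[where own = own and t = t, OF assms, symmetric] by
      (simp add: cell_error_def)

lemma cellfun_cell_error:
  assumes \<Lambda>: "cellfun \<Lambda>"
  shows "\<Lambda> (\<lambda>s. poly P s + Dt t 0 (c + s) - (\<Sum>l\<le>lmax. Rcor l (Dt t) c s))
    = \<Lambda> (poly P) + \<Lambda> (\<lambda>s. Dt t 0 (c + s)) - (\<Sum>l\<le>lmax. \<Lambda> (Rcor l (Dt t) c))"
proof -
  have c: "continuous_on rcell (poly P)" "continuous_on rcell (\<lambda>s. Dt t 0 (c + s))"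
    "continuous_on rcell (Rcor l (Dt t) c)" for l
    by (rule continuous_on_poly' continuous_D0[OF contD_Dt] continuous_Rcor[OF contD_Dt])+
  show ?thesis
    by (subst cellfun_diff[OF \<Lambda>], (intro continuous_intros c)+, subst cellfun_add[OF \<Lambda> c(1,2)],
        subst cellfun_sum[OF \<Lambda>]) (auto intro: c)
qed

text \<open>Both components of the discrete solution are replaced by error plus u minus the sum of
  the \<open>R^l\<close>, and the scheme is tested with the error P itself. The terms with u cancel
  by \<open>cdg_consistency\<close>, and those with \<open>R^l\<close> gather into
  \<open>resid l\<close>.\<close>

lemma error_equation:
  assumes t: "t \<in> {0..T}" and own: "\<And>r. r \<in> {0..T} \<Longrightarrow> own r \<in> pw_poly k L h (ctr c0)"
    and oth: "oth t \<in> pw_poly k L h (ctr c1)"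
    and d: "\<And>x. ((\<lambda>r. own r x) has_real_derivative d x) (at t within {0..T})"
    and eq: "\<And>\<phi>. \<phi> \<in> pw_poly k L h (ctr c0) \<Longrightarrow>
      integral (cell h (ctr c0 i)) (\<lambda>x. d x * \<phi> x) = cdg_form C h (ctr c0 i) (own t) (oth t) \<phi>"
    and iL: "ctr c0 i - h/2 = ctr c1 iL" and iR: "ctr c0 i + h/2 = ctr c1 iR"
  defines "P \<equiv> error_poly own (ctr c0 i) t"
  shows "((\<lambda>r. h * ip (poly (error_poly own (ctr c0 i) r)) (error_poly own (ctr c0 i) r))
      has_real_derivative
     2 * (flux_left C P (poly (error_poly oth (ctr c1 iL) t)) + flux_right C P (poly (error_poly oth
         (ctr c1 iR) t)) - ip (poly P) P / C
       - (\<Sum>l\<le>lmax. resid l (Dt t) (ctr c0 i / h) P))) (at t within {0..T})"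
proof -
  let ?c = "ctr c0 i" and ?L = "error_poly oth (ctr c1 iL) t" and ?R = "error_poly oth (ctr c1 iR) t"
  let ?e = "\<lambda>s. d (?c + h * s) + 1 / h * Dt t 1 (?c / h + s) - 1 / h * (\<Sum>l\<le>lmax. Rcor l (shiftD
      (Dt t)) (?c / h) s)"
  have cL: "ctr c1 iL / h = ?c / h - 1/2" "ctr c1 iR / h = ?c / h + 1/2" using h
      unfolding iL[symmetric] iR[symmetric] by (simp_all add: field_simps)
  have "\<exists>q. degree q \<le> k \<and> (\<forall>s. -1/2 \<le> s \<longrightarrow> s < 1/2 \<longrightarrow> ?e s = poly q s) \<and>
    ((\<lambda>r. ip (poly (error_poly own ?c r)) (error_poly own ?c r)) has_real_derivative 2 * ip (poly q)
        (error_poly own ?c t)) (at t within {0..T})"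
  proof (rule poly_family_derivative[OF T t])
    show "degree (error_poly own ?c r) \<le> k" if "r \<in> {0..T}" for r by (rule error_poly(1)[where own
        = own and t = r, OF own[OF that]])
    fix s :: real assume s: "-1/2 \<le> s" "s < 1/2"
    have "((\<lambda>r. cell_error own ?c r s) has_real_derivative ?e s) (at t within {0..T})"
      by (rule cell_error_time[OF d]) (use s in \<open>simp add: rcell_def\<close>)
    then show "((\<lambda>r. poly (error_poly own ?c r) s) has_real_derivative ?e s) (at t within {0..T})"
      by (rule has_field_derivative_transform_within[OF _ zero_less_one t])
          (rule error_poly(2)[where own = own, OF own s])
  qed
  then obtain q where q: "degree q \<le> k" "\<And>s. -1/2 \<le> s \<Longrightarrow> s < 1/2 \<Longrightarrow> ?e s = poly q s"
    "((\<lambda>r. ip (poly (error_poly own ?c r)) (error_poly own ?c r)) has_real_derivative 2 * ip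
        (poly q) P) (at t within {0..T})"
    unfolding P_def by blast
  have dP: "degree P \<le> k" unfolding P_def by (rule error_poly(1)[where own = own and t
      = t, OF own[OF t]])
  have D1: "continuous_on rcell (\<lambda>s. Dt t 1 (?c / h + s))"
    using continuous_D0[OF contD_shiftD[OF contD_Dt], of t "?c / h"] by (simp add: shiftD_def)
  have Es: "continuous_on rcell (Rcor l (shiftD (Dt t)) (?c / h))" for l by
      (rule continuous_Rcor[OF contD_shiftD[OF contD_Dt]])
  let ?W = "\<lambda>s. \<Sum>l\<le>lmax. Rcor l (shiftD (Dt t)) (?c / h) s"
  have W: "continuous_on rcell ?W" by (intro continuous_on_sum Es)
  have drep: "cellrep h ?c d (\<lambda>s. poly q s - 1 / h * (Dt t 1 (?c / h + s) - ?W s))"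
    unfolding cellrep_def using q(2)[symmetric] by (simp add: right_diff_distrib)
  have dW: "continuous_on rcell (\<lambda>s. Dt t 1 (?c / h + s) - ?W s)" by (intro continuous_on_diff D1 W)
  have dc: "continuous_on rcell (\<lambda>s. poly q s - 1 / h * (Dt t 1 (?c / h + s) - ?W s))"
    by (intro continuous_on_diff continuous_on_poly' continuous_on_mult continuous_on_const dW)
  \<comment> \<open>P copied to every cell is an admissible test function that is P on the cell
    considered.\<close>
  have "integral (cell h ?c) (\<lambda>x. d x * pwf c0 (\<lambda>_. P) x) = h * ip (\<lambda>s. poly q s - 1 / h * (Dt t 1
      (?c / h + s) - ?W s)) P"
    by (rule integral_unique[OF cell_has_integral[OF h dc drep cellrep_pwf]])
  also have "ip (\<lambda>s. poly q s - 1 / h * (Dt t 1 (?c / h + s) - ?W s)) P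
      = ip (poly q) P - 1 / h * (ip (\<lambda>s. Dt t 1 (?c / h + s)) P - (\<Sum>l\<le>lmax. ip (Rcor l (shiftD
          (Dt t)) (?c / h)) P))"
    by (subst cellfun_diff[OF cellfun_ip continuous_on_poly'], intro continuous_on_mult
        continuous_on_const dW,
        subst cellfun_scale[OF cellfun_ip dW], subst cellfun_diff[OF cellfun_ip D1 W], subst
            cellfun_sum[OF cellfun_ip])
      (auto intro: Es)
  finally have lhs: "integral (cell h ?c) (\<lambda>x. d x * pwf c0 (\<lambda>_. P) x)
      = h * ip (poly q) P - (ip (\<lambda>s. Dt t 1 (?c / h + s)) P - (\<Sum>l\<le>lmax. ip (Rcor l (shiftD (Dt t))
          (?c / h)) P))"
    using h by (simp add: right_diff_distrib)
  have cont: "continuous_on rcell (\<lambda>s. poly Q s + Dt t 0 (c + s) - (\<Sum>l\<le>lmax. Rcor l (Dt t) c s))" for Q c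
    by (intro continuous_on_diff continuous_on_add continuous_on_poly' continuous_D0
        continuous_on_sum continuous_Rcor contD_Dt)
  have rep: "cellrep h ?c (pwf c0 (\<lambda>_. error_poly own ?c t)) (poly (error_poly own ?c t))"
    by (rule cellrep_pwf[where P = "\<lambda>_. error_poly own ?c t"])
  have "cdg_form C h ?c (own t) (oth t) (pwf c0 (\<lambda>_. P))
      = flux_left C P (\<lambda>s. poly ?L s + Dt t 0 (?c / h - 1/2 + s) - (\<Sum>l\<le>lmax. Rcor l (Dt t)
          (?c / h - 1/2) s))
      + flux_right C P (\<lambda>s. poly ?R s + Dt t 0 (?c / h + 1/2 + s) - (\<Sum>l\<le>lmax. Rcor l (Dt t) (?c / h
          + 1/2) s))
      - ip (\<lambda>s. poly P s + Dt t 0 (?c / h + s) - (\<Sum>l\<le>lmax. Rcor l (Dt t) (?c / h) s)) P / C"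
    using cellrep_cell_error[of own t c0 i] cellrep_cell_error[where own = oth and t = t and i
        = iL, OF oth] cellrep_cell_error[where own = oth and t = t and i = iR, OF oth] own[OF t]
    by (intro cdg_form_eq[OF h C cont cont cont]) (simp_all add: rep P_def iL iR cL)
  also have "\<dots> = (flux_left C P (poly ?L) + flux_right C P (poly ?R) - ip (poly P) P / C)
      + (flux_left C P (\<lambda>s. Dt t 0 (?c / h - 1/2 + s)) + flux_right C P (\<lambda>s. Dt t 0 (?c / h + 1/2
          + s)) - ip (\<lambda>s. Dt t 0 (?c / h + s)) P / C)
      - (\<Sum>l\<le>lmax. flux_left C P (Rcor l (Dt t) (?c / h - 1/2)) + flux_right C P (Rcor l (Dt t)
          (?c / h + 1/2)) - ip (Rcor l (Dt t) (?c / h)) P / C)"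
    unfolding cellfun_cell_error[OF cellfun_flux_left] cellfun_cell_error[OF cellfun_flux_right]
        cellfun_cell_error[OF cellfun_ip]
    by (simp add: sum.distrib sum_subtractf sum_divide_distrib add_divide_distrib diff_divide_distrib)
  also have "flux_left C P (\<lambda>s. Dt t 0 (?c / h - 1/2 + s)) + flux_right C P (\<lambda>s. Dt t 0 (?c / h
      + 1/2 + s)) - ip (\<lambda>s. Dt t 0 (?c / h + s)) P / C
      = - ip (\<lambda>s. Dt t 1 (?c / h + s)) P"
    by (rule cdg_consistency) (use Dt_deriv[of 0] lmax_less_conv_order contD_Dt[of t] in \<open>auto simp:
        contD_def\<close>)
  finally have rhs: "cdg_form C h ?c (own t) (oth t) (pwf c0 (\<lambda>_. P))
      = (flux_left C P (poly ?L) + flux_right C P (poly ?R) - ip (poly P) P / C) + - ip (\<lambda>s. Dt t 1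
          (?c / h + s)) P
      - (\<Sum>l\<le>lmax. flux_left C P (Rcor l (Dt t) (?c / h - 1/2)) + flux_right C P (Rcor l (Dt t)
          (?c / h + 1/2)) - ip (Rcor l (Dt t) (?c / h)) P / C)" .
  have "pwf c0 (\<lambda>_. P) \<in> pw_poly k L h (ctr c0)" by (rule pwf_in_pw_poly) (use dP in auto)
  from eq[OF this] have "h * ip (poly q) P = flux_left C P (poly ?L) + flux_right C P (poly ?R) - ip
      (poly P) P / C
       - (\<Sum>l\<le>lmax. resid l (Dt t) (?c / h) P)"
    unfolding lhs rhs resid_def by (simp add: sum.distrib sum_subtractf)
  then show ?thesis using DERIV_cmult[OF q(3), of h] by (simp only: mult.left_commute[of h 2])
qed

end

section \<open>Summation over both meshes and the final estimate\<close>

context cdg_run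
begin

definition pC :: "int \<Rightarrow> real \<Rightarrow> real poly" where "pC i t = error_poly uC (ctr (a - h/2) i) t"
definition pD :: "int \<Rightarrow> real \<Rightarrow> real poly" where "pD i t = error_poly uD (ctr a i) t"

definition YC :: "real \<Rightarrow> real" where "YC t = (\<Sum>i<N. h * ip (poly (pC (int i) t)) (pC (int i) t))"
definition YD :: "real \<Rightarrow> real" where "YD t = (\<Sum>i<N. h * ip (poly (pD (int i) t)) (pD (int i) t))"

definition BC :: "real \<Rightarrow> int \<Rightarrow> real" where
  "BC t i = flux_left C (pC i t) (poly (pD (i - 1) t)) + flux_right C (pC i t) (poly (pD i t)) - ip
      (poly (pC i t)) (pC i t) / C"
definition BD :: "real \<Rightarrow> int \<Rightarrow> real" where
  "BD t i = flux_left C (pD i t) (poly (pC i t)) + flux_right C (pD i t) (poly (pC (i + 1) t)) - ip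
      (poly (pD i t)) (pD i t) / C"
definition RC :: "real \<Rightarrow> int \<Rightarrow> real" where
  "RC t i = (\<Sum>l\<le>lmax. resid l (Dt t) (ctr (a - h/2) i / h) (pC i t))"
definition RD :: "real \<Rightarrow> int \<Rightarrow> real" where
  "RD t i = (\<Sum>l\<le>lmax. resid l (Dt t) (ctr a i / h) (pD i t))"

lemma p_periodic:
  assumes "t \<in> {0..T}" shows "pC (i + int N) t = pC i t" "pD (i + int N) t = pD i t"
  unfolding pC_def pD_def
  by (rule error_poly_periodic[where own = uC and t = t, OF uC[OF assms]] error_poly_periodic[where
      own = uD and t = t, OF uD[OF assms]])+

lemma p_degree:
  assumes "t \<in> {0..T}" shows "degree (pC i t) \<le> k" "degree (pD i t) \<le> k"
  unfolding pC_def pD_def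
  by (rule error_poly(1)[where own = uC and t = t, OF uC[OF assms]] error_poly(1)[where own
      = uD and t = t, OF uD[OF assms]])+

lemma Y_derivative:
  assumes t: "t \<in> {0..T}"
  shows "((\<lambda>t. YC t + YD t) has_real_derivative
     (\<Sum>i<N. 2 * (BC t (int i) - RC t (int i))) + (\<Sum>i<N. 2 * (BD t (int i) - RD t (int i))))
         (at t within {0..T})"
  unfolding YC_def[abs_def] YD_def[abs_def]
proof (intro DERIV_add DERIV_sum)
  fix i
  show "((\<lambda>t. h * ip (poly (pC (int i) t)) (pC (int i) t)) has_real_derivative 2 * (BC t
      (int i) - RC t (int i))) (at t within {0..T})"
    unfolding pC_def pD_def BC_def RC_def
    by (rule error_equation[where own = uC and oth = uD and d
        = "dC t", OF t uC uD[OF t] dC[OF t] eqC[OF t] ctr_neighbours(1,2)])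
  show "((\<lambda>t. h * ip (poly (pD (int i) t)) (pD (int i) t)) has_real_derivative 2 * (BD t
      (int i) - RD t (int i))) (at t within {0..T})"
    unfolding pC_def pD_def BD_def RD_def
    by (rule error_equation[where own = uD and oth = uC and d
        = "dD t", OF t uD uC[OF t] dD[OF t] eqD[OF t] ctr_neighbours(3,4)])
qed

lemma half_energy_nonpos:
  "flux_right C p (poly q) - integral {0..1/2} (\<lambda>s. (poly p s)\<^sup>2) / C
       + flux_left C q (poly p) - integral {-1/2..0} (\<lambda>s. (poly q s)\<^sup>2) / C \<le> 0"
proof -
  have "0 \<le> integral {0..1/2} (\<lambda>s. (poly p s - poly q (s - 1/2))\<^sup>2)"
    by (rule integral_nonneg) (auto intro!: integrable_continuous_interval continuous_intros)
  then show ?thesis unfolding half_cell_energy using C by simp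
qed

text \<open>The terms are regrouped by overlaps, so that \<open>half_energy_nonpos\<close> applies
  to each. f i pairs the right half of primal cell i with the left half of dual cell i. The right
  half r i of dual cell i meets the left half of primal cell i + 1, which is why g is shifted
  cyclically.\<close>

lemma energy_nonpos:
  assumes t: "t \<in> {0..T}"
  shows "(\<Sum>i<N. BC t (int i)) + (\<Sum>i<N. BD t (int i)) \<le> 0"
proof -
  define f where "f i = flux_right C (pC i t) (poly (pD i t)) - integral {0..1/2} (\<lambda>s. (poly
      (pC i t) s)\<^sup>2) / C
       + flux_left C (pD i t) (poly (pC i t)) - integral {-1/2..0} (\<lambda>s. (poly (pD i t) s)\<^sup>2) / C" for i
  define r where "r i = flux_right C (pD i t) (poly (pC (i + 1) t)) - integral {0..1/2} (\<lambda>s. (poly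
      (pD i t) s)\<^sup>2) / C" for i
  define g where "g i = flux_left C (pC i t) (poly (pD (i - 1) t)) - integral {-1/2..0} (\<lambda>s. (poly
      (pC i t) s)\<^sup>2) / C" for i
  have B: "BC t i + BD t i = f i + r i + g i" for i
    unfolding BC_def BD_def f_def r_def g_def ip_self_split by (simp add: add_divide_distrib)
  have "g (int N) = g 0"
    using p_periodic[OF t, of 0] p_periodic(2)[OF t, of "-1"] by (simp add: g_def)
  then have "(\<Sum>i<N. g (int i)) = (\<Sum>i<N. g (int i + 1))" by (rule sum_cyclic_shift[symmetric])
  then have "(\<Sum>i<N. BC t (int i)) + (\<Sum>i<N. BD t (int i)) = (\<Sum>i<N. f (int i)) + (\<Sum>i<N. r (int i) + g
      (int i + 1))"
    by (simp add: sum.distrib[symmetric] B) (simp add: sum.distrib)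
  also have "\<dots> \<le> 0"
  proof (rule add_nonpos_nonpos; rule sum_nonpos)
    show "f (int i) \<le> 0" for i unfolding f_def by (rule half_energy_nonpos)
    show "r (int i) + g (int i + 1) \<le> 0" for i
      using half_energy_nonpos[of "pD (int i) t" "pC (int i + 1) t"] by (simp add: r_def g_def)
  qed
  finally show ?thesis .
qed

lemma corr_error_rep:
  assumes t: "t \<in> {0..T}"
  shows "cellrep h (ctr (a - h/2) i) (fst (corr_error k a b C h (u t) (uC t) (uD t))) (poly (pC i t))"
    and "cellrep h (ctr a i) (snd (corr_error k a b C h (u t) (uC t) (uD t))) (poly (pD i t))"
proof -
  have u0: "u t = vt t 0" using u[OF t] by (simp add: vt_def[abs_def])
  have "deriv (vt t j) = vt t (Suc j)" if "j < l" "l \<le> lmax" for j l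
    by (rule ext, rule DERIV_imp_deriv, rule vt_deriv) (use that lmax_less_conv_order in simp)
  then have c: "(\<forall>i. cellrep h (ctr (a - h/2) i) (fst (corr k a b C h l (u t))) (Rcor l (Dt t) (ctr
      (a - h/2) i / h))) \<and>
    (\<forall>i. cellrep h (ctr a i) (snd (corr k a b C h l (u t))) (Rcor l (Dt t) (ctr a i / h)))" if "l
        \<le> lmax" for l
    unfolding u0 Dt_def using that by (intro corr_eq vt_cont vt_per ab) auto
  have e: "fst (corr_error k a b C h (u t) (uC t) (uD t)) x = uC t x - u t x + (\<Sum>l\<le>lmax. fst
      (corr k a b C h l (u t)) x)"
    "snd (corr_error k a b C h (u t) (uC t) (uD t)) x = uD t x - u t x + (\<Sum>l\<le>lmax. snd
        (corr k a b C h l (u t)) x)" for x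
    unfolding sum.atMost_shift by (simp_all add: corr_error_def sum.atLeast1_atMost_eq lmax_def)
  have ut: "u t (c + h * s) = Dt t 0 (c / h + s)" for c s
    using h by (simp add: u0 Dt_def scaled_def distrib_left)
  show "cellrep h (ctr (a - h/2) i) (fst (corr_error k a b C h (u t) (uC t) (uD t))) (poly (pC i t))"
    unfolding cellrep_def
  proof (intro allI impI)
    fix s :: real assume s: "- 1/2 \<le> s" "s < 1/2"
    have "(\<Sum>l\<le>lmax. fst (corr k a b C h l (u t)) (ctr (a - h/2) i + h * s)) = (\<Sum>l\<le>lmax. Rcor l
        (Dt t) (ctr (a - h/2) i / h) s)"
      using c s by (intro sum.cong refl) (auto intro: cellrepD)
    then show "fst (corr_error k a b C h (u t) (uC t) (uD t)) (ctr (a - h/2) i + h * s) = poly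
        (pC i t) s"
      unfolding e ut pC_def using error_poly(2)[where own = uC and t
          = t, OF uC[OF t] s, of i, symmetric] by (simp add: cell_error_def)
  qed
  show "cellrep h (ctr a i) (snd (corr_error k a b C h (u t) (uC t) (uD t))) (poly (pD i t))"
    unfolding cellrep_def
  proof (intro allI impI)
    fix s :: real assume s: "- 1/2 \<le> s" "s < 1/2"
    have "(\<Sum>l\<le>lmax. snd (corr k a b C h l (u t)) (ctr a i + h * s)) = (\<Sum>l\<le>lmax. Rcor l (Dt t)
        (ctr a i / h) s)"
      using c s by (intro sum.cong refl) (auto intro: cellrepD)
    then show "snd (corr_error k a b C h (u t) (uC t) (uD t)) (ctr a i + h * s) = poly (pD i t) s"
      unfolding e ut pD_def using error_poly(2)[where own = uD and t
          = t, OF uD[OF t] s, of i, symmetric] by (simp add: cell_error_def)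
  qed
qed

text \<open>The cells numbered from 0 begin at c0 - h/2, one cell left of a for the primal mesh and
  half a cell for the dual one; periodicity moves the integral to [a, b].\<close>

lemma pw_square_period_integral:
  assumes f: "\<And>i. cellrep h (ctr c0 i) f (poly (P i))" and P: "\<And>i. P (i + int N) = P i"
    and c: "c0 - h/2 \<le> a" "a \<le> c0 - h/2 + L"
  shows "((\<lambda>x. (f x)\<^sup>2) has_integral (\<Sum>i<N. h * ip (poly (P (int i))) (P (int i)))) {a..b}"
proof -
  have per: "f (x + L) = f x" for x
  proof -
    obtain i s where x: "x = ctr c0 i + h * s" "-1/2 \<le> s" "s < 1/2" using cell_exists by blast
    have "x + L = ctr c0 (i + int N) + h * s" using x by (simp add: ctr_add_N)
    then show ?thesis using cellrepD[OF f x(2,3), of "i + int N"] cellrepD[OF f x(2,3), of i]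
        \<open>x + L = _\<close> x(1) P by (simp only:)
  qed
  have "((\<lambda>x. (f x)\<^sup>2) has_integral h * (\<Sum>i<N. ip (poly (P (int i))) (P (int i)))) {a..a + L}"
    by (rule periodic_has_integral[OF pw_square_has_integral[OF f, of N, folded L] _ c]) (simp add: per)
  moreover have "a + L = b" using ab by simp
  ultimately show ?thesis by (simp add: sum_distrib_left)
qed

lemma norm_eq_Y:
  assumes t: "t \<in> {0..T}"
  shows "L2_pair_norm a b (corr_error k a b C h (u t) (uC t) (uD t)) = sqrt (YC t + YD t)"
proof -
  have Lh: "h \<le> L" using N h unfolding L by (simp add: mult_le_cancel_right1)
  have "((\<lambda>x. (fst (corr_error k a b C h (u t) (uC t) (uD t)) x)\<^sup>2) has_integral YC t) {a..b}"
    unfolding YC_def by (rule pw_square_period_integral[OF corr_error_rep(1)[OF t] p_periodic(1)[OF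
        t]]) (use Lh h in auto)
  moreover have "((\<lambda>x. (snd (corr_error k a b C h (u t) (uC t) (uD t)) x)\<^sup>2) has_integral YD t) {a..b}"
    unfolding YD_def by (rule pw_square_period_integral[OF corr_error_rep(2)[OF t] p_periodic(2)[OF
        t]]) (use Lh h in auto)
  ultimately show ?thesis unfolding L2_pair_norm_def by (simp add: has_integral_add integral_unique)
qed

text \<open>The weights are chosen so that the second term is one summand of the energy, while the 1
  / h in the first is compensated by the factor h contained in A^2.\<close>

lemma young: "2 * (K * (x * y)) \<le> K\<^sup>2 * x\<^sup>2 / h + h * y\<^sup>2"
proof -
  have "0 \<le> (K * x - h * y)\<^sup>2 / h" using h by simp
  also have "\<dots> = K\<^sup>2 * x\<^sup>2 / h + h * y\<^sup>2 - 2 * (K * (x * y))" using h by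
      (simp add: field_simps power2_eq_square)
  finally show ?thesis by simp
qed

text \<open>\<open>residual_bound\<close> with A the oscillation of the scaled derivative of order
  \<open>conv_order\<close>, followed by Young's inequality. The bound is an increment of \<Gamma>,
  so it can be summed over cells without counting them.\<close>

lemma residual_cell:
  assumes K: "K \<ge> 0"
    and RB: "\<And>D c A \<phi>. contD D \<Longrightarrow> (\<And>j y. j < conv_order \<Longrightarrow> (D j has_real_derivative D (Suc j) y) (at y)) \<Longrightarrow>
      (\<And>y. \<bar>y - c\<bar> \<le> 4 \<Longrightarrow> \<bar>D conv_order y - D conv_order c\<bar> \<le> A) \<Longrightarrow> degree \<phi> \<le> k \<Longrightarrow>
      \<bar>\<Sum>l\<le>lmax. resid l D c \<phi>\<bar> \<le> K * A * sqrt (ip (poly \<phi>) \<phi>)"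
    and \<Gamma>: "mono \<Gamma>" "\<And>x y. y \<le> x \<Longrightarrow> (v conv_order x - v conv_order y)\<^sup>2 \<le> (x - y) * (\<Gamma> x - \<Gamma> y)"
    and \<phi>: "degree \<phi> \<le> k"
  shows "- (2 * (\<Sum>l\<le>lmax. resid l (Dt t) (c / h) \<phi>))
     \<le> 4 * K\<^sup>2 * h ^ (2 * conv_order) * (\<Gamma> (c - t + 4 * h) - \<Gamma> (c - t - 4 * h)) + h * ip (poly \<phi>) \<phi>"
proof -
  define G where "G = \<Gamma> (c - t + 4 * h) - \<Gamma> (c - t - 4 * h)"
  have G: "G \<ge> 0" unfolding G_def using monoD[OF \<Gamma>(1), of "c - t - 4 * h" "c - t + 4 * h"] h by simp
  \<comment> \<open>The scaled radius 4 is 4 h on the mesh. There the squared oscillation is at most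
    4 h times the increment G of \<Gamma>, and h ^ conv_order comes from the scaling in
    \<open>Dt\<close>.\<close>
  define A where "A = h ^ conv_order * sqrt (4 * h * G)"
  have osc: "\<bar>Dt t conv_order y - Dt t conv_order (c / h)\<bar> \<le> A" if y: "\<bar>y - c / h\<bar> \<le> 4" for y
  proof -
    define x where "x = h * y - t"
    define x0 where "x0 = c - t"
    have "x - x0 = h * (y - c / h)" using h by (simp add: x_def x0_def right_diff_distrib)
    then have x: "\<bar>x - x0\<bar> \<le> 4 * h" using y h by (simp add: abs_mult mult.commute)
    have "(v conv_order x - v conv_order x0)\<^sup>2 \<le> (4 * h) * G"
    proof (cases "x0 \<le> x")
      case True
      then have "(v conv_order x - v conv_order x0)\<^sup>2 \<le> (x - x0) * (\<Gamma> x - \<Gamma> x0)" by (rule \<Gamma>(2))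
      also have "\<dots> \<le> (4 * h) * G"
        unfolding G_def x0_def[symmetric]
        using x True h monoD[OF \<Gamma>(1), of x "x0 + 4 * h"] monoD[OF \<Gamma>(1), of "x0 - 4 * h" x0] monoD[OF
            \<Gamma>(1) True]
        by (intro mult_mono) auto
      finally show ?thesis .
    next
      case False
      then have "(v conv_order x0 - v conv_order x)\<^sup>2 \<le> (x0 - x) * (\<Gamma> x0 - \<Gamma> x)" by (intro \<Gamma>(2)) simp
      also have "\<dots> \<le> (4 * h) * G"
        unfolding G_def x0_def[symmetric]
        using x False h monoD[OF \<Gamma>(1), of x0 "x0 + 4 * h"] monoD[OF \<Gamma>(1), of "x0 - 4 * h" x]
            monoD[OF \<Gamma>(1), of x x0]
        by (intro mult_mono) auto
      finally show ?thesis by (simp add: power2_commute)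
    qed
    then have "\<bar>v conv_order x - v conv_order x0\<bar> \<le> sqrt (4 * h * G)" by (simp add: real_le_rsqrt)
    then have "h ^ conv_order * \<bar>v conv_order x - v conv_order x0\<bar> \<le> A" unfolding A_def using h by
        (intro mult_left_mono) auto
    moreover have "Dt t conv_order y - Dt t conv_order (c / h) = h ^ conv_order *
        (v conv_order x - v conv_order x0)"
      using h by (simp add: Dt_def scaled_def vt_def x_def x0_def right_diff_distrib)
    ultimately show ?thesis using h by (simp add: abs_mult)
  qed
  have abs_le: "- (2 * S) \<le> 2 * X" if "\<bar>S\<bar> \<le> X" for S X :: real using that by linarith
  have "\<bar>\<Sum>l\<le>lmax. resid l (Dt t) (c / h) \<phi>\<bar> \<le> K * A * sqrt (ip (poly \<phi>) \<phi>)"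
    by (rule RB[OF contD_Dt Dt_deriv osc \<phi>])
  then have "- (2 * (\<Sum>l\<le>lmax. resid l (Dt t) (c / h) \<phi>)) \<le> 2 * (K * (A * sqrt (ip (poly \<phi>) \<phi>)))"
    unfolding mult.assoc by (rule abs_le)
  also have "\<dots> \<le> K\<^sup>2 * A\<^sup>2 / h + h * (sqrt (ip (poly \<phi>) \<phi>))\<^sup>2" by (rule young)
  also have "\<dots> = 4 * K\<^sup>2 * h ^ (2 * conv_order) * G + h * ip (poly \<phi>) \<phi>"
  proof -
    have "A\<^sup>2 = h ^ (2 * conv_order) * (4 * h * G)"
      unfolding A_def power_mult_distrib using h G by (simp add: power_mult[symmetric] mult.commute)
    then have "K\<^sup>2 * A\<^sup>2 / h = 4 * K\<^sup>2 * h ^ (2 * conv_order) * G" using h by simp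
    then show ?thesis using ip_self_nonneg[of \<phi>] by simp
  qed
  finally show ?thesis unfolding G_def .
qed

lemma error_bound:
  assumes K: "K \<ge> 0"
    and RB: "\<And>D c A \<phi>. contD D \<Longrightarrow> (\<And>j y. j < conv_order \<Longrightarrow> (D j has_real_derivative D (Suc j) y) (at y)) \<Longrightarrow>
      (\<And>y. \<bar>y - c\<bar> \<le> 4 \<Longrightarrow> \<bar>D conv_order y - D conv_order c\<bar> \<le> A) \<Longrightarrow> degree \<phi> \<le> k \<Longrightarrow>
      \<bar>\<Sum>l\<le>lmax. resid l D c \<phi>\<bar> \<le> K * A * sqrt (ip (poly \<phi>) \<phi>)"
    and \<Gamma>: "mono \<Gamma>" "\<And>x y. y \<le> x \<Longrightarrow> (v conv_order x - v conv_order y)\<^sup>2 \<le> (x - y) * (\<Gamma> x - \<Gamma> y)"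
    and \<Gamma>per: "\<And>x. \<Gamma> (x + L) = \<Gamma> x + M"
    and init: "L2_pair_norm a b (corr_error k a b C h (u 0) (uC 0) (uD 0)) \<le> M0 * h ^ conv_order"
  shows "L2_pair_norm a b (corr_error k a b C h (u T) (uC T) (uD T))
     \<le> sqrt (exp T * (M0\<^sup>2 + 64 * K\<^sup>2 * M)) * h ^ conv_order"
proof -
  define Y where "Y t = YC t + YD t" for t
  \<comment> \<open>Each of the two meshes contributes 4 K^2 times the window sum 8 M.\<close>
  define B where "B = 64 * K\<^sup>2 * M * h ^ (2 * conv_order)"
  have M: "M \<ge> 0" using \<Gamma>per[of 0] monoD[OF \<Gamma>(1), of 0 L] N h by (simp add: L)
  have window: "(\<Sum>i<N. \<Gamma> (ctr c0 (int i) - t + 4 * h) - \<Gamma> (ctr c0 (int i) - t - 4 * h)) = 8 * M" for c0 t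
  proof -
    have "\<Gamma> (ctr c0 (i + int N) - t) = \<Gamma> (ctr c0 i - t) + M" for i
      using \<Gamma>per[of "ctr c0 i - t"] by (simp add: ctr_add_N algebra_simps)
    from sum_window[of "\<lambda>i. \<Gamma> (ctr c0 i - t)", OF this]
    show ?thesis by (simp add: ctr_def algebra_simps)
  qed
  have "Y T + B \<le> exp T * (Y 0 + B)"
  proof (rule gronwall[OF T])
    fix t assume t: "t \<in> {0..T}"
    show "(Y has_real_derivative
       (\<Sum>i<N. 2 * (BC t (int i) - RC t (int i))) + (\<Sum>i<N. 2 * (BD t (int i) - RD t (int i))))
           (at t within {0..T})"
      unfolding Y_def[abs_def] by (rule Y_derivative[OF t])
    note cellb = residual_cell[OF K RB \<Gamma>]
    have C1: "(\<Sum>i<N. - (2 * RC t (int i))) \<le> (\<Sum>i<N. 4 * K\<^sup>2 * h ^ (2 * conv_order) *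
        (\<Gamma> (ctr (a - h/2) (int i) - t + 4 * h) - \<Gamma> (ctr (a - h/2) (int i) - t - 4 * h)) + h * ip
            (poly (pC (int i) t)) (pC (int i) t))"
      unfolding RC_def by (intro sum_mono cellb p_degree t)
    have D1: "(\<Sum>i<N. - (2 * RD t (int i))) \<le> (\<Sum>i<N. 4 * K\<^sup>2 * h ^ (2 * conv_order) *
        (\<Gamma> (ctr a (int i) - t + 4 * h) - \<Gamma> (ctr a (int i) - t - 4 * h)) + h * ip (poly (pD
            (int i) t)) (pD (int i) t))"
      unfolding RD_def by (intro sum_mono cellb p_degree t)
    have e: "2 * ((\<Sum>i<N. BC t (int i)) + (\<Sum>i<N. BD t (int i))) \<le> 0" using energy_nonpos[OF t] by simp
    have wC: "(\<Sum>i<N. 4 * K\<^sup>2 * h ^ (2 * conv_order) * (\<Gamma> (ctr (a - h/2) (int i) - t + 4 * h) - \<Gamma>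
        (ctr (a - h/2) (int i) - t - 4 * h))
        + h * ip (poly (pC (int i) t)) (pC (int i) t)) = 4 * K\<^sup>2 * h ^ (2 * conv_order) * (8 * M) + YC t"
      unfolding YC_def sum.distrib window[of "a - h/2" t, symmetric] sum_distrib_left ..
    have wD: "(\<Sum>i<N. 4 * K\<^sup>2 * h ^ (2 * conv_order) * (\<Gamma> (ctr a (int i) - t + 4 * h) - \<Gamma> (ctr a
        (int i) - t - 4 * h))
        + h * ip (poly (pD (int i) t)) (pD (int i) t)) = 4 * K\<^sup>2 * h ^ (2 * conv_order) * (8 * M) + YD t"
      unfolding YD_def sum.distrib window[of a t, symmetric] sum_distrib_left ..
    have "(\<Sum>i<N. 2 * (BC t (int i) - RC t (int i))) + (\<Sum>i<N. 2 * (BD t (int i) - RD t (int i)))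
       = 2 * ((\<Sum>i<N. BC t (int i)) + (\<Sum>i<N. BD t (int i))) + (\<Sum>i<N. - (2 * RC t (int i))) + (\<Sum>i<N. -
           (2 * RD t (int i)))"
      by (simp add: right_diff_distrib sum_subtractf sum_negf sum_distrib_left)
    also have "\<dots> \<le> 0 + (4 * K\<^sup>2 * h ^ (2 * conv_order) * (8 * M) + YC t) + (4 * K\<^sup>2 * h ^
        (2 * conv_order) * (8 * M) + YD t)"
      by (rule add_mono[OF add_mono[OF e C1[unfolded wC]] D1[unfolded wD]])
    finally show "(\<Sum>i<N. 2 * (BC t (int i) - RC t (int i))) + (\<Sum>i<N. 2 * (BD t (int i) - RD t
        (int i))) \<le> Y t + B"
      by (simp add: Y_def B_def mult_ac)
  qed
  moreover have "Y 0 \<le> M0\<^sup>2 * h ^ (2 * conv_order)"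
  proof -
    have Y0: "Y 0 \<ge> 0" unfolding Y_def YC_def YD_def using h ip_self_nonneg by
        (intro add_nonneg_nonneg sum_nonneg) auto
    have "sqrt (Y 0) \<le> M0 * h ^ conv_order" using init norm_eq_Y[of 0] T by (simp add: Y_def)
    then have "(sqrt (Y 0))\<^sup>2 \<le> (M0 * h ^ conv_order)\<^sup>2" using Y0 by (intro power_mono) auto
    then show ?thesis using Y0 by (simp add: power_mult_distrib power_mult[symmetric] mult.commute)
  qed
  then have "exp T * (Y 0 + B) \<le> exp T * (M0\<^sup>2 * h ^ (2 * conv_order) + B)" by simp
  moreover have "B \<ge> 0" using M h by (simp add: B_def)
  ultimately have "Y T \<le> exp T * (M0\<^sup>2 * h ^ (2 * conv_order) + B)" by linarith
  also have "\<dots> = exp T * (M0\<^sup>2 + 64 * K\<^sup>2 * M) * h ^ (2 * conv_order)"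
    unfolding B_def by (simp only: distrib_left distrib_right mult.assoc)
  also have "h ^ (2 * conv_order) = (h ^ conv_order)\<^sup>2" by (simp add: power_mult[symmetric] mult.commute)
  finally have "sqrt (Y T) \<le> sqrt (exp T * (M0\<^sup>2 + 64 * K\<^sup>2 * M) * (h ^ conv_order)\<^sup>2)" by simp
  also have "\<dots> = sqrt (exp T * (M0\<^sup>2 + 64 * K\<^sup>2 * M)) * h ^ conv_order" using h by
      (simp add: real_sqrt_mult)
  finally show ?thesis using norm_eq_Y[of T] T by (simp add: Y_def)
qed

end

theorem theorem3p1:
  fixes k \<sigma> :: nat and a b C T :: real and u :: "real \<Rightarrow> real \<Rightarrow> real"
  assumes "k \<ge> 1" and "T > 0" and "a < b" and "C > 0"
    and "\<sigma> = min (2 * k + 1) (k + 3)"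
    and "C1_Hs a b (\<sigma> + 1) T u"
    and "advection_solution T u"
  shows "\<forall>M0 > 0. \<exists>M > 0. \<forall>(N::nat) h uC uD.
           N \<ge> 1 \<and> h = (b - a) / real N \<and> cdg_solution k a b C h T uC uD \<and>
           L2_pair_norm a b (corr_error k a b C h (u 0) (uC 0) (uD 0)) \<le> M0 * h ^ \<sigma>
           \<longrightarrow> L2_pair_norm a b (corr_error k a b C h (u T) (uC T) (uD T)) \<le> M * h ^ \<sigma>"
proof (intro allI impI)
  fix M0 :: real assume M0: "M0 > 0"
  interpret cdg_cell k C using assms by unfold_locales auto
  have \<sigma>: "\<sigma> = conv_order" using assms(5) by (simp add: conv_order_def)
  \<comment> \<open>Since k \<ge> 1 gives \<sigma> \<ge> 3, the regularity \<sigma> + 1 has the form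
    n + 3 on which \<open>advection_transport\<close> is stated.\<close>
  define n where "n = \<sigma> - 2"
  have n: "\<sigma> + 1 = Suc (Suc (Suc n))" using assms(1,5) by (auto simp: n_def)
  have zero: "0 \<in> {0..T}" using assms(2) by simp
  have u0: "u 0 \<in> Hs a b (Suc \<sigma>)" using assms(6) zero unfolding C1_Hs_def by auto
  have u0c: "continuous_on UNIV (u 0)"
    using assms(7) zero unfolding advection_solution_def
    by (metis DERIV_isCont continuous_at_imp_continuous_on)
  obtain D \<Gamma> M where D: "D 0 = u 0" "\<And>j x. j < \<sigma> \<Longrightarrow> (D j has_real_derivative D (Suc j) x) (at x)"
    "\<And>j. j \<le> \<sigma> \<Longrightarrow> periodic (b - a) (D j)" "\<And>j. j \<le> \<sigma> \<Longrightarrow> continuous_on UNIV (D j)"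
    and \<Gamma>: "mono \<Gamma>" "\<And>x. \<Gamma> (x + (b - a)) = \<Gamma> x + M"
    "\<And>x y. y \<le> x \<Longrightarrow> (D \<sigma> x - D \<sigma> y)\<^sup>2 \<le> (x - y) * (\<Gamma> x - \<Gamma> y)"
    using Hs_regular[OF assms(3) u0 u0c] by metis
  have M: "M \<ge> 0" using \<Gamma>(2)[of 0] monoD[OF \<Gamma>(1), of 0 "b - a"] assms(3) by simp
  \<comment> \<open>Derivatives exist classically up to order \<sigma>; zeros beyond keep every
    member of the sequence continuous, as \<open>contD\<close> asks.\<close>
  define v where "v j = (if j \<le> \<sigma> then D j else (\<lambda>_. 0))" for j
  obtain K where K: "K \<ge> 0"
    "\<And>D c A \<phi>. contD D \<Longrightarrow> (\<And>j y. j < conv_order \<Longrightarrow> (D j has_real_derivative D (Suc j) y) (at y)) \<Longrightarrow>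
      (\<And>y. \<bar>y - c\<bar> \<le> 4 \<Longrightarrow> \<bar>D conv_order y - D conv_order c\<bar> \<le> A) \<Longrightarrow> degree \<phi> \<le> k \<Longrightarrow>
      \<bar>\<Sum>l\<le>lmax. resid l D c \<phi>\<bar> \<le> K * A * sqrt (ip (poly \<phi>) \<phi>)"
    using residual_bound by blast
  \<comment> \<open>M and K depend on u, k and C alone, so this constant is fixed before the mesh
    and the discrete solution.\<close>
  define M' where "M' = sqrt (exp T * (M0\<^sup>2 + 64 * K\<^sup>2 * M))"
  have "M' > 0" unfolding M'_def using M0 M by (auto intro!: mult_pos_pos add_pos_nonneg)
  moreover have "L2_pair_norm a b (corr_error k a b C h (u T) (uC T) (uD T)) \<le> M' * h ^ \<sigma>"
    if N: "N \<ge> 1" and h: "h = (b - a) / real N" and sol: "cdg_solution k a b C h T uC uD"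
      and init: "L2_pair_norm a b (corr_error k a b C h (u 0) (uC 0) (uD 0)) \<le> M0 * h ^ \<sigma>"
    for N h uC uD
  proof -
    interpret cdg_mesh k C h "b - a" N
      using N h assms(3) by unfold_locales auto
    note sol' = sol[unfolded cdg_solution_def primal_ctr_eq dual_ctr_eq]
    have "\<forall>t\<in>{0..T}. \<exists>dC dD. (\<forall>x. ((\<lambda>r. uC r x) has_real_derivative dC x) (at t within {0..T})) \<and>
           (\<forall>x. ((\<lambda>r. uD r x) has_real_derivative dD x) (at t within {0..T})) \<and>
           (\<forall>i. \<forall>\<phi>1 \<in> pw_poly k (b - a) h (ctr (a - h/2)). \<forall>\<phi>2 \<in> pw_poly k (b - a) h (ctr a).
              integral (cell h (ctr (a - h/2) i)) (\<lambda>x. dC x * \<phi>1 x) = cdg_form C h (ctr (a - h/2) i)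
                  (uC t) (uD t) \<phi>1 \<and>
              integral (cell h (ctr a i)) (\<lambda>x. dD x * \<phi>2 x) = cdg_form C h (ctr a i) (uD t) (uC t) \<phi>2)"
      using sol' by blast
    then obtain dC dD where d: "\<forall>t\<in>{0..T}. (\<forall>x. ((\<lambda>r. uC r x) has_real_derivative dC t x)
        (at t within {0..T})) \<and>
           (\<forall>x. ((\<lambda>r. uD r x) has_real_derivative dD t x) (at t within {0..T})) \<and>
           (\<forall>i. \<forall>\<phi>1 \<in> pw_poly k (b - a) h (ctr (a - h/2)). \<forall>\<phi>2 \<in> pw_poly k (b - a) h (ctr a).
              integral (cell h (ctr (a - h/2) i)) (\<lambda>x. dC t x * \<phi>1 x) = cdg_form C h (ctr
                  (a - h/2) i) (uC t) (uD t) \<phi>1 \<and>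
              integral (cell h (ctr a i)) (\<lambda>x. dD t x * \<phi>2 x) = cdg_form C h (ctr a i) (uD t) (uC t) \<phi>2)"
      unfolding bchoice_iff by blast
    interpret cdg_run k C h "b - a" N a b T v u uC uD dC dD
    proof
      show "continuous_on UNIV (v j)" "periodic (b - a) (v j)" for j
        using D(3,4) by (auto simp: v_def periodic_def)
      show "(v j has_real_derivative v (Suc j) x) (at x)" if "j < conv_order" for j x
        using D(2)[of j x] that by (simp add: v_def \<sigma>)
      show "u t = (\<lambda>x. v 0 (x - t))" if "t \<in> {0..T}" for t
        using advection_transport[OF assms(3,2) assms(6)[unfolded n] assms(7) that] D(1) by
            (auto simp: v_def)
      show "uC t \<in> pw_poly k (b - a) h (ctr (a - h/2))" "uD t \<in> pw_poly k (b - a) h (ctr a)"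
          if "t \<in> {0..T}" for t
        using sol' that by blast+
      show "integral (cell h (ctr (a - h/2) i)) (\<lambda>x. dC t x * \<phi> x) = cdg_form C h (ctr (a - h/2) i)
          (uC t) (uD t) \<phi>"
        if "t \<in> {0..T}" "\<phi> \<in> pw_poly k (b - a) h (ctr (a - h/2))" for t \<phi> i
        using d that sol' by blast
      show "integral (cell h (ctr a i)) (\<lambda>x. dD t x * \<phi> x) = cdg_form C h (ctr a i) (uD t) (uC t) \<phi>"
        if "t \<in> {0..T}" "\<phi> \<in> pw_poly k (b - a) h (ctr a)" for t \<phi> i
        using d that sol' by blast
    qed (use assms d in auto)
    show ?thesis
      unfolding M'_def \<sigma>
      by (rule error_bound[OF K \<Gamma>(1) _ \<Gamma>(2)]) (use \<Gamma>(3) init in \<open>auto simp: v_def \<sigma>\<close>)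
  qed
  ultimately show "\<exists>M > 0. \<forall>(N::nat) h uC uD.
           N \<ge> 1 \<and> h = (b - a) / real N \<and> cdg_solution k a b C h T uC uD \<and>
           L2_pair_norm a b (corr_error k a b C h (u 0) (uC 0) (uD 0)) \<le> M0 * h ^ \<sigma>
           \<longrightarrow> L2_pair_norm a b (corr_error k a b C h (u T) (uC T) (uD T)) \<le> M * h ^ \<sigma>"
    by blast
qed

end
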